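(* For any prime $p$, any $H\in\mathbb{N}^*$, and any $\Delta=(\Delta_1,\ldots,\Delta_H)\in(\mathbb{N}^* )^H$, we have $$\rho_p(\Delta):=\frac{N_{Q,p}(\Delta)}{\#\mathcal{F}_{Q,p}}=\sum_{R=H+1}^{2H+1}\ \sum_{\substack{(\alpha,n)\in\mathcal{A}_R\\ \delta(\alpha,n)=\Delta}}\frac{2\,\mathrm{Area}(\mathcal{T}_{n_1,\ldots,n_{R-2}})}{p(p-1)}+O_H\left(\frac{\log^2 Q}{Q}\right).$$
   Context: $\mathbb{N}^*=\{1,2,3,\ldots\}$ and $[t]$ denotes the integer part (floor) of a real number $t$. $Q$ is a positive integer, and the estimate is asymptotic as $Q\to\infty$; the subscript in $O_H$ indicates that the implied constant depends on $H$. **Farey sets.** $\mathcal{F}_Q=\{a/q\in\mathbb{Q}: 0\le a/q\le 1,\ 1\le q\le Q,\ \gcd(a,q)=1\}$ and, for a prime $p$, $\mathcal{F}_{Q,p}=\{a/q\in\mathcal{F}_Q: p\nmid q\}$ (fractions in lowest terms with positive denominators, ordered increasingly). For $\Delta=(\Delta_1,\ldots,\Delta_H)\in(\mathbb{N}^* )^H$, $N_{Q,p}(\Delta)$ is the number of $(H+1)$-tuples $a_1/q_1<\cdots<a_{H+1}/q_{H+1}$ of consecutive elements of $\mathcal{F}_{Q,p}$ such that $q_ha_{h+1}-a_hq_{h+1}=\Delta_h$ for every $h\in\{1,\ldots,H\}$. **Regions.** Let $\mathcal{T}=\{(x,y)\in[0,1]\times[0,1]: x+y>1\}$, and define $T:\mathcal{T}\to\mathcal{T}$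 by $T(x,y)=\left(y,\left[\frac{1+x}{y}\right]y-x\right)$. For $m\in\mathbb{N}^*$ let $\mathcal{T}_m=\{(x,y)\in\mathcal{T}:\left[\frac{1+x}{y}\right]=m\}$. For positive integers $n_1,\ldots,n_k$ with $k\ge 1$ let $\mathcal{T}_{n_1,\ldots,n_k}=\mathcal{T}_{n_1}\cap T^{-1}\mathcal{T}_{n_2}\cap\cdots\cap T^{1-k}\mathcal{T}_{n_k}$, where $T^{-j}$ denotes preimage under the $j$-th iterate of $T$. When the index list is empty (the case $R=2$), $\mathcal{T}_{n_1,\ldots,n_{R-2}}$ means $\mathcal{T}$. $\mathrm{Area}$ is area in the plane. **The set $\mathcal{A}_R$** (depending on $p$ and $H$). $\mathcal{A}_R$ is the set of all $(\alpha,n)=((\alpha_1,\ldots,\alpha_R),(n_1,\ldots,n_{R-2}))\in(\mathbb{Z}/p\mathbb{Z})^R\times(\mathbb{N}^* )^{R-2}$ such that: (1) $\alpha_1$ and $\alpha_R$ are nonzero; (2) for each $r\in\{1,\ldots,R-1\}$, if $\alpha_r=0$ then $\alpha_{r+1}\ne 0$; (3) the number of $r\in\{1,\ldots,R\}$ for which $\alpha_r\neq 0$ is $H+1$; (4) for each $r\in\{1,\ldots,R-2\}$, each of the following four conditions on the congruence class of $n_r$ modulo $p$ holds: - if $\alpha_r=\alpha_{r+2}=0$ and $\alpha_{r+1}\ne0$, then $p\mid n_r$; - if $\alpha_r=0$, $\alpha_{r+1}\neq0$, and $\alpha_{r+2}\ne0$, then $n_r\equiv\alpha_{r+2}\alpha_{r+1}^{-1}\pmod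 p$; - if $\alpha_r\ne0$, $\alpha_{r+1}\ne0$, and $\alpha_{r+2}=0$, then $n_r\equiv\alpha_r\alpha_{r+1}^{-1}\pmod p$; - if $\alpha_r\ne0$, $\alpha_{r+1}\ne0$, and $\alpha_{r+2}\ne0$, then $n_r\equiv(\alpha_{r+2}+\alpha_r)\alpha_{r+1}^{-1}\pmod p$. **The map $\delta$.** $\delta:\mathcal{A}_R\to(\mathbb{N}^* )^H$ is defined as follows: given $(\alpha,n)\in\mathcal{A}_R$, let $r_1<\cdots<r_{H+1}$ be the indices $r\in\{1,\ldots,R\}$ with $\alpha_r\ne0$. Then $r_{h+1}\in\{r_h+1,r_h+2\}$ for each $h\in\{1,\ldots,H\}$, and $\delta(\alpha,n)=(\delta_1,\ldots,\delta_H)$ with $\delta_h=1$ if $r_{h+1}=r_h+1$ and $\delta_h=n_{r_h}$ if $r_{h+1}=r_h+2$.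
   Formalization: The set A_R gets one further condition: if α_{r+1}=0 then α_{r+2}=-α_r in Z/pZ (for 1≤r≤R-2); without it the formula fails, e.g. for p=5, H=1, Δ=(1) the sum is 16/15>1. Convergence of the inner sums is also stated. *)

theory Defs
  imports "HOL-Analysis.Analysis" "HOL-Number_Theory.Number_Theory"
begin

definition rnum :: "rat \<Rightarrow> int" where
  "rnum x = fst (quotient_of x)"

definition rden :: "rat \<Rightarrow> int" where
  "rden x = snd (quotient_of x)"

definition farey :: "nat \<Rightarrow> rat set" where
  "farey Q = {x. 0 \<le> x \<and> x \<le> 1 \<and> rden x \<le> int Q}"

definition farey_coprime :: "nat \<Rightarrow> nat \<Rightarrow> rat set" where
  "farey_coprime Q p = {x \<in> farey Q. \<not> int p dvd rden x}"

definition consecutive_in :: "rat set \<Rightarrow> rat \<Rightarrow> rat \<Rightarrow> bool" where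
  "consecutive_in F x y \<longleftrightarrow> x \<in> F \<and> y \<in> F \<and> x < y \<and> \<not> (\<exists>z\<in>F. x < z \<and> z < y)"

definition farey_tuple_count :: "nat \<Rightarrow> nat \<Rightarrow> nat list \<Rightarrow> nat" where
  "farey_tuple_count Q p \<Delta> = card {xs :: rat list. length xs = length \<Delta> + 1 \<and>
     (\<forall>h<length \<Delta>. consecutive_in (farey_coprime Q p) (xs ! h) (xs ! (h+1)) \<and>
        rden (xs ! h) * rnum (xs ! (h+1)) - rnum (xs ! h) * rden (xs ! (h+1)) = int (\<Delta> ! h))}"

definition rho :: "nat \<Rightarrow> nat \<Rightarrow> nat list \<Rightarrow> real" where
  "rho Q p \<Delta> = real (farey_tuple_count Q p \<Delta>) / real (card (farey_coprime Q p))"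

definition triangle :: "(real \<times> real) set" where
  "triangle = {(x, y). 0 \<le> x \<and> x \<le> 1 \<and> 0 \<le> y \<and> y \<le> 1 \<and> x + y > 1}"

definition farey_index :: "real \<times> real \<Rightarrow> int" where
  "farey_index = (\<lambda>(x, y). \<lfloor>(1 + x) / y\<rfloor>)"

(* This maps triangle into itself; its values elsewhere are irrelevant. *)
definition farey_map :: "real \<times> real \<Rightarrow> real \<times> real" where
  "farey_map = (\<lambda>(x, y). (y, of_int (farey_index (x, y)) * y - x))"

definition triangle_piece :: "nat \<Rightarrow> (real \<times> real) set" where
  "triangle_piece m = {z \<in> triangle. farey_index z = int m}"

definition triangle_cell :: "nat list \<Rightarrow> (real \<times> real) set" where
  "triangle_cell ns =
     {z \<in> triangle. \<forall>j<length ns. (farey_map ^^ j) z \<in> triangle_piece (ns ! j)}"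

definition area :: "(real \<times> real) set \<Rightarrow> real" where
  "area S = measure lborel S"

(* Z/pZ is represented by {0..<p}, and lists are indexed from 0.  The entries of \<alpha> are the
   residues of R consecutive Farey denominators, which satisfy
   \<alpha>_(r+2) = n_r \<alpha>_(r+1) - \<alpha>_r.  The first four conditions on a triple solve this for n_r
   when \<alpha>_(r+1) is invertible.  The last one is the case \<alpha>_(r+1) = 0, which the source does
   not list: it says nothing about n_r, but without it \<alpha>_(r+2) is arbitrary, and for p = 5
   and H = 1 the limiting proportion of \<Delta> = (1) would be 16/15.  For p = 2 it is automatic. *)
definition admissible :: "nat \<Rightarrow> nat \<Rightarrow> nat \<Rightarrow> (int list \<times> nat list) set" where
  "admissible p H R = {(\<alpha>, n).
     length \<alpha> = R \<and> set \<alpha> \<subseteq> {0..<int p} \<and>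
     length n = R - 2 \<and> (\<forall>m\<in>set n. m \<ge> 1) \<and>
     \<alpha> ! 0 \<noteq> 0 \<and> \<alpha> ! (R - 1) \<noteq> 0 \<and>
     (\<forall>r<R-1. \<alpha> ! r = 0 \<longrightarrow> \<alpha> ! (r+1) \<noteq> 0) \<and>
     card {r. r < R \<and> \<alpha> ! r \<noteq> 0} = H + 1 \<and>
     (\<forall>r<R-2.
        (\<alpha> ! r = 0 \<and> \<alpha> ! (r+1) \<noteq> 0 \<and> \<alpha> ! (r+2) = 0 \<longrightarrow> p dvd n ! r) \<and>
        (\<alpha> ! r = 0 \<and> \<alpha> ! (r+1) \<noteq> 0 \<and> \<alpha> ! (r+2) \<noteq> 0 \<longrightarrow>
           [int (n ! r) = \<alpha> ! (r+2) * modular_inverse (int p) (\<alpha> ! (r+1))] (mod int p)) \<and>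
        (\<alpha> ! r \<noteq> 0 \<and> \<alpha> ! (r+1) \<noteq> 0 \<and> \<alpha> ! (r+2) = 0 \<longrightarrow>
           [int (n ! r) = \<alpha> ! r * modular_inverse (int p) (\<alpha> ! (r+1))] (mod int p)) \<and>
        (\<alpha> ! r \<noteq> 0 \<and> \<alpha> ! (r+1) \<noteq> 0 \<and> \<alpha> ! (r+2) \<noteq> 0 \<longrightarrow>
           [int (n ! r) = (\<alpha> ! (r+2) + \<alpha> ! r) * modular_inverse (int p) (\<alpha> ! (r+1))]
             (mod int p)) \<and>
        (\<alpha> ! (r+1) = 0 \<longrightarrow> [\<alpha> ! (r+2) = - \<alpha> ! r] (mod int p)))}"

definition delta :: "int list \<times> nat list \<Rightarrow> nat list" where
  "delta = (\<lambda>(\<alpha>, n).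
     let rs = filter (\<lambda>r. \<alpha> ! r \<noteq> 0) [0..<length \<alpha>]
     in map (\<lambda>h. if rs ! (h+1) = rs ! h + 1 then 1 else n ! (rs ! h)) [0..<length rs - 1])"

definition fibre :: "nat \<Rightarrow> nat list \<Rightarrow> nat \<Rightarrow> (int list \<times> nat list) set" where
  "fibre p \<Delta> R = {an \<in> admissible p (length \<Delta>) R. delta an = \<Delta>}"

definition weight :: "nat \<Rightarrow> int list \<times> nat list \<Rightarrow> real" where
  "weight p = (\<lambda>(\<alpha>, n). 2 * area (triangle_cell n) / (real p * (real p - 1)))"

end

theory Submission
  imports Defs "HOL-Computational_Algebra.Squarefree" "HOL-Real_Asymp.Real_Asymp"
begin

text \<open>
Consecutive elements of \<open>\<F>\<^sub>Q\<close> correspond to coprime pairs \<open>(q, q')\<close> in \<open>Q \<T>\<close>, the next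
denominator being given by the map \<open>T\<close>. Removing the denominators divisible by \<open>p\<close> merges at most
two consecutive gaps, so whether a tuple of gaps occurs at \<open>(q, q')\<close> depends only on the cell
\<open>\<T>\<^sub>n\<close> containing \<open>(q/Q, q'/Q)\<close> and on the set of positions at which the orbit of \<open>(q, q')\<close> vanishes
modulo \<open>p\<close>. This set is constant on lines through the origin of \<open>(\<int>/p)\<^sup>2\<close>, and only boundedly many lines
meet a zero. Hence in each cell the count is a combination, with boundedly many terms, of counts of coprime points
in sublattices of index \<open>p\<close>, with an error that is uniform in \<open>p\<close>.

A cell with largest index \<open>m\<close> is convex of diameter \<open>O(1/m)\<close> and area \<open>O(1/m\<^sup>3)\<close>, there are
boundedly many of them for each \<open>m\<close> because a large index determines all the others, and the
dilate of such a cell by \<open>Q/d\<close> contains lattice points only if \<open>d \<le> 2Q/m\<close>. Moebius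
inversion therefore gives the error
\<open>\<Sum>\<^bsub>m\<^esub> \<Sum>\<^bsub>d \<le> 2Q/m\<^esub> O(Q/(dm) + 1) = O(Q log\<^sup>2 Q)\<close> against a main term of order \<open>Q\<^sup>2\<close>.
\<close>

section \<open>Lattice points in convex sets\<close>

text \<open>The constant may not depend on \<open>p\<close>, and \<open>p\<close> may even exceed
  \<open>Q\<close>. Treating the residue classes modulo \<open>p\<close> one by one would cost p^2
  error terms. What avoids this is that the orbit is linear in its starting pair: a zero at a given
  position is one linear condition modulo \<open>p\<close> whose coefficients depend on the cell
  alone, and counting in a sublattice is no less accurate than counting in the full lattice.

  The density factor \<open>kappa p\<close> is common to the number of tuples and the number of
  fractions. Both are compared with the same \<open>main_scale Q p\<close>, so it cancels in the
  ratio, and what enters is a lower bound for it that is uniform in \<open>p\<close>.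

  The target is an infinite sum over index lists, while only finitely many lists occur for a given
  \<open>Q\<close>. The lattice estimate is therefore proved for arbitrary finite families of cells,
  with a bound that does not mention the family; letting the family grow at fixed \<open>Q\<close>
  produces the infinite sum.\<close>

abbreviation vol :: "'a::euclidean_space set \<Rightarrow> real" where
  "vol \<equiv> measure lborel"

lemma card_int_interval:
  fixes J :: "real set"
  assumes "convex J" "bounded J"
  shows "finite {b::int. of_int b \<in> J}" "\<bar>real (card {b::int. of_int b \<in> J}) - vol J\<bar> \<le> 1"
proof -
  have ivl: "x \<in> J" if "a \<in> J" "b \<in> J" "a \<le> x" "x \<le> b" for a b x
    using assms(1) that mem_is_interval_1_I is_interval_convex_1 by metis
  obtain B where B: "\<And>x. x \<in> J \<Longrightarrow> \<bar>x\<bar> \<le> B" using assms(2) unfolding bounded_iff by auto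
  have J1: "\<not> {b<..} \<subseteq> J" for b
  proof
    assume "{b<..} \<subseteq> J"
    then have "max b B + 1 \<in> J" by auto
    from B[OF this] show False by auto
  qed
  have J2: "\<not> {..<b} \<subseteq> J" for b
  proof
    assume "{..<b} \<subseteq> J"
    then have "min b (-B) - 1 \<in> J" by auto
    from B[OF this] show False by auto
  qed
  have "\<exists>a b. J = {} \<or> J = UNIV \<or> J = {..<b} \<or> J = {..b} \<or> J = {a<..} \<or> J = {a..} \<or>
      J = {a<..<b} \<or> J = {a<..b} \<or> J = {a..<b} \<or> J = {a..b}"
    by (rule interval_cases) (use ivl in blast)
  moreover have "J \<noteq> UNIV" using J1[of 0] by auto
  moreover have "J \<noteq> {..<b}" "J \<noteq> {..b}" "J \<noteq> {b<..}" "J \<noteq> {b..}" for b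
    using J1[of b] J2[of b] by auto
  ultimately obtain a b where J: "J = {} \<or> (J \<noteq> {} \<and> (J = {a<..<b} \<or> J = {a<..b} \<or> J = {a..<b} \<or> J = {a..b}))"
    by metis
  show fin: "finite {b::int. of_int b \<in> J}"
  proof (rule finite_subset)
    show "{b::int. of_int b \<in> J} \<subseteq> {-\<lceil>B\<rceil>..\<lceil>B\<rceil>}" using B by (fastforce simp: abs_le_iff le_ceiling_iff minus_le_iff intro: le_of_int_ceiling order_trans)
  qed auto
  show "\<bar>real (card {b::int. of_int b \<in> J}) - vol J\<bar> \<le> 1"
  proof (cases "J = {}")
    case False
    with J have ab: "a \<le> b" and meas: "vol J = b - a" by auto
    \<comment> \<open>All four kinds of interval at once: the closed one has at most
      \<open>b - a + 1\<close> integers and the open one at least \<open>b - a - 1\<close>.\<close>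
    have sub1: "{b::int. of_int b \<in> J} \<subseteq> {\<lceil>a\<rceil>..\<lfloor>b\<rfloor>}"
      using J False by (auto simp: ceiling_le_iff le_floor_iff)
    have sub2: "{\<lfloor>a\<rfloor>+1..\<lceil>b\<rceil>-1} \<subseteq> {b::int. of_int b \<in> J}"
    proof
      fix c assume "c \<in> {\<lfloor>a\<rfloor>+1..\<lceil>b\<rceil>-1}"
      then have "a < of_int c" "of_int c < b" by (auto simp: floor_less_iff less_ceiling_iff add1_zle_eq)
      with J False show "c \<in> {b::int. of_int b \<in> J}" by auto
    qed
    have "card {b::int. of_int b \<in> J} \<le> nat (\<lfloor>b\<rfloor> - \<lceil>a\<rceil> + 1)" using card_mono[OF _ sub1] by simp
    moreover have "card {b::int. of_int b \<in> J} \<ge> nat (\<lceil>b\<rceil> - \<lfloor>a\<rfloor> - 1)" using card_mono[OF fin sub2] by (simp add: algebra_simps)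
    moreover have "\<lfloor>b\<rfloor> - \<lceil>a\<rceil> + 1 \<ge> 0" using ab by linarith
    ultimately show ?thesis unfolding meas by linarith
  qed simp
qed

text \<open>The shift \<open>s\<close> will take a different value in each column, which makes
  sheared lattices as easy to count as the standard one.\<close>

lemma card_int_interval_affine:
  fixes J :: "real set"
  assumes J: "convex J" "bounded J" and N: "N > 0"
  shows "finite {b::int. (of_int b + s) / N \<in> J}"
    "\<bar>real (card {b::int. (of_int b + s) / N \<in> J}) - N * vol J\<bar> \<le> 1"
proof -
  define K where "K = {y. (y + s) / N \<in> J}"
  have K2: "K = (\<lambda>y. -s + y) ` (\<lambda>y. N *\<^sub>R y) ` J"
  proof (intro Set.set_eqI iffI)
    fix y assume "y \<in> K"
    then show "y \<in> (\<lambda>y. -s + y) ` (\<lambda>y. N *\<^sub>R y) ` J"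
      unfolding K_def image_image using N by (intro image_eqI[where x = "(y+s)/N"]) auto
  qed (use N in \<open>auto simp: K_def\<close>)
  have cK: "convex K" unfolding K2 by (intro convex_translation convex_scaling J)
  have bK: "bounded K" unfolding K2 by (intro bounded_translation bounded_scaling J)
  have [measurable]: "J \<in> sets borel" using J(1) by (intro real_interval_borel_measurable) (simp add: is_interval_convex_1)
  have "(\<integral>x. indicator J x \<partial>lborel :: real) = \<bar>1/N\<bar> *\<^sub>R (\<integral>x. indicator J (s/N + (1/N) * x) \<partial>lborel)"
    using N by (intro lborel_integral_real_affine) auto
  also have "(\<lambda>x. indicator J (s/N + (1/N) * x)) = (indicator K :: real \<Rightarrow> real)"
    by (auto simp: K_def indicator_def add_divide_distrib add.commute)
  finally have m: "vol K = N * vol J" using N by (simp add: field_simps)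
  show "finite {b::int. (of_int b + s) / N \<in> J}"
    "\<bar>real (card {b::int. (of_int b + s) / N \<in> J}) - N * vol J\<bar> \<le> 1"
    using card_int_interval[OF cK bK] unfolding m unfolding K_def by auto
qed

lemma convex_slices:
  assumes "convex C"
  shows "convex {y. (x, y) \<in> C}" "convex {x. (x, y) \<in> C}"
proof -
  have "{y. (x, y) \<in> C} = snd ` (C \<inter> {x} \<times> UNIV)" "{x. (x, y) \<in> C} = fst ` (C \<inter> UNIV \<times> {y})" by force+
  then show "convex {y. (x, y) \<in> C}" "convex {x. (x, y) \<in> C}"
    using assms by (auto intro!: convex_linear_image linear_fst linear_snd convex_Int convex_Times)
qed

text \<open>Only the slices of \<^term>\<open>C\<close> matter: counting along columns compares the lattice points with
  the sum of the column lengths, and exchanging that finite sum with the integral over rows compares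
  the sum with the area.\<close>

lemma lattice_count:
  fixes C :: "(real \<times> real) set" and s :: "int \<Rightarrow> real"
  assumes meas [measurable]: "C \<in> sets borel" and conv: "convex C"
    and box: "C \<subseteq> {x0..x0+w} \<times> {y0..y0+h}" and wh: "w \<ge> 0" "h \<ge> 0" and N: "N1 > 0" "N2 > 0"
  defines "S \<equiv> {(a::int, b::int). (of_int a / N1, (of_int b + s a) / N2) \<in> C}"
  shows "finite S" "\<bar>real (card S) - N1 * N2 * vol C\<bar> \<le> N1 * w + 1 + N2 * h"
proof -
  define A where "A = {a::int. (of_int a + 0) / N1 \<in> {x0..x0+w}}"
  have A: "finite A" "real (card A) \<le> N1 * w + 1"
    using card_int_interval_affine[of "{x0..x0+w}" N1 0] N wh unfolding A_def by auto
  define Cx where "Cx x = {y. (x, y) \<in> C}" for x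
  define Cy where "Cy y = {x. (x, y) \<in> C}" for y
  have bCx: "Cx x \<subseteq> {y0..y0+h}" for x using box by (auto simp: Cx_def)
  have bCy: "Cy x \<subseteq> {x0..x0+w}" for x using box by (auto simp: Cy_def)
  have Cx: "convex (Cx x)" "bounded (Cx x)" for x
    using convex_slices(1)[OF conv] bounded_subset[OF bounded_closed_interval bCx] by (auto simp: Cx_def)
  have Cy: "convex (Cy x)" "bounded (Cy x)" for x
    using convex_slices(2)[OF conv] bounded_subset[OF bounded_closed_interval bCy] by (auto simp: Cy_def)
  have mCx [measurable]: "Cx x \<in> sets borel" for x
    using Cx by (intro real_interval_borel_measurable) (simp add: is_interval_convex_1)
  have mCy [measurable]: "Cy x \<in> sets borel" for x
    using Cy by (intro real_interval_borel_measurable) (simp add: is_interval_convex_1)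
  have fCx: "emeasure lborel (Cx x) < \<infinity>" for x
    using emeasure_mono[OF bCx[of x], of lborel] wh by (simp add: le_less_trans[OF _ ennreal_less_top])
  define B where "B a = {b::int. (of_int b + s a) / N2 \<in> Cx (of_int a / N1)}" for a
  have B: "finite (B a)" "\<bar>real (card (B a)) - N2 * vol (Cx (of_int a / N1))\<bar> \<le> 1" for a
    unfolding B_def using card_int_interval_affine[OF Cx N(2)] by auto
  have S: "S = Sigma A B"
    using box by (auto simp: S_def A_def B_def Cx_def)
  show "finite S" unfolding S using A B by auto
  have cS: "real (card S) = (\<Sum>a\<in>A. real (card (B a)))"
    unfolding S using A B by (simp add: card_SigmaI)
  have fC: "emeasure lborel C < \<infinity>"
  proof -
    have "emeasure lborel C \<le> emeasure lborel (cbox (x0,y0) (x0+w,y0+h))"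
      using box by (intro emeasure_mono) (auto simp: cbox_Pair_eq intro!: borel_closed closed_Times)
    also have "\<dots> < \<infinity>" by (rule emeasure_lborel_cbox_finite)
    finally show ?thesis .
  qed
  have intC: "integrable lborel (indicator C :: real \<times> real \<Rightarrow> real)" using fC by simp
  define T where "T = (\<Sum>a\<in>A. vol (Cx (of_int a / N1)))"
  have ind: "(\<lambda>y. indicator C (x, y) :: real) = indicator (Cx x)" for x
    by (auto simp: Cx_def indicator_def)
  have iCx: "integrable lborel (\<lambda>y. indicator C (x, y) :: real)" for x
    using fCx unfolding ind by simp
  have T: "T = (\<integral>y. (\<Sum>a\<in>A. indicator C (of_int a / N1, y)) \<partial>lborel)"
    unfolding T_def by (subst Bochner_Integration.integral_sum[OF iCx]) (simp add: ind)
  have area: "vol C = (\<integral>y. vol (Cy y) \<partial>lborel)"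
    and iCy: "integrable lborel (\<lambda>y. vol (Cy y))"
  proof -
    have eq: "(\<integral>x. indicator C (x, y) \<partial>lborel) = vol (Cy y)" for y
    proof -
      have "(\<lambda>x. indicator C (x, y) :: real) = indicator (Cy y)"
        by (auto simp: Cy_def indicator_def)
      then show ?thesis by simp
    qed
    have int': "integrable (lborel \<Otimes>\<^sub>M lborel) (case_prod (\<lambda>x y. indicator C (x, y) :: real))"
      using intC unfolding lborel_prod by simp
    show "vol C = (\<integral>y. vol (Cy y) \<partial>lborel)"
      using lborel_pair.integral_snd[OF int'] unfolding lborel_prod eq by simp
    show "integrable lborel (\<lambda>y. vol (Cy y))"
      using lborel_pair.integrable_snd[OF int'] unfolding eq by simp
  qed
  \<comment> \<open>Outside the box both terms vanish, so the unit error of a row is paid only for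
    \<open>y\<close> in an interval of length \<open>h\<close> and integrates to
    \<open>h\<close>.\<close>
  have cnt: "\<bar>(\<Sum>a\<in>A. indicator C (of_int a / N1, y)) - N1 * vol (Cy y)\<bar> \<le> indicator {y0..y0+h} y" for y
  proof (cases "y \<in> {y0..y0+h}")
    case True
    have "(\<Sum>a\<in>A. indicator C (of_int a / N1, y) :: real) = real (card {a::int. (of_int a + 0) / N1 \<in> Cy y})"
    proof -
      have "(\<Sum>a\<in>A. indicator C (of_int a / N1, y) :: real) = (\<Sum>a\<in>A \<inter> {a. (of_int a / N1, y) \<in> C}. 1)"
        using A by (auto simp: sum.inter_restrict indicator_def intro!: sum.cong)
      also have "A \<inter> {a. (of_int a / N1, y) \<in> C} = {a::int. (of_int a + 0) / N1 \<in> Cy y}"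
        using box by (auto simp: A_def Cy_def)
      finally show ?thesis by simp
    qed
    then show ?thesis using card_int_interval_affine(2)[OF Cy N(1), of 0 y] True by simp
  next
    case False
    then have "Cy y = {}" "\<And>a. (of_int a / N1, y) \<notin> C" using box by (auto simp: Cy_def)
    then show ?thesis using False by simp
  qed
  have TA: "\<bar>T - N1 * vol C\<bar> \<le> h"
  proof -
    have "T - N1 * vol C = (\<integral>y. (\<Sum>a\<in>A. indicator C (of_int a / N1, y)) - N1 * vol (Cy y) \<partial>lborel)"
      unfolding T area using iCx iCy by (subst Bochner_Integration.integral_diff) auto
    also have "\<bar>\<dots>\<bar> \<le> (\<integral>y. indicator {y0..y0+h} y \<partial>lborel)"
      using cnt iCx iCy wh
      by (intro order_trans[OF integral_abs_bound] integral_mono) auto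
    also have "\<dots> = h" using wh by simp
    finally show ?thesis .
  qed
  have "\<bar>real (card S) - N2 * T\<bar> \<le> real (card A)"
  proof -
    have "real (card S) - N2 * T = (\<Sum>a\<in>A. real (card (B a)) - N2 * vol (Cx (of_int a / N1)))"
      unfolding cS T_def by (simp add: sum_subtractf sum_distrib_left)
    also have "\<bar>\<dots>\<bar> \<le> (\<Sum>a\<in>A. 1)" using B by (intro order_trans[OF sum_abs] sum_mono) auto
    finally show ?thesis by simp
  qed
  moreover have "\<bar>N2 * T - N1 * N2 * vol C\<bar> \<le> N2 * h"
  proof -
    have "N2 * T - N1 * N2 * vol C = N2 * (T - N1 * vol C)" by (simp add: algebra_simps)
    then show ?thesis using TA N by (simp add: abs_mult)
  qed
  ultimately show "\<bar>real (card S) - N1 * N2 * vol C\<bar> \<le> N1 * w + 1 + N2 * h"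
    using A(2) by linarith
qed

section \<open>Coprime lattice points and zeros modulo a prime\<close>

definition moebius :: "nat \<Rightarrow> real" where
  "moebius n = (if squarefree n then (-1) ^ card (prime_factors n) else 0)"

lemma abs_moebius_le: "\<bar>moebius n\<bar> \<le> 1"
  by (auto simp: moebius_def power_abs)

lemma moebius_1 [simp]: "moebius 1 = 1" "moebius (Suc 0) = 1"
  by (auto simp: moebius_def)

lemma moebius_prime_mult:
  assumes "prime p" "\<not> p dvd d" "d > 0"
  shows "moebius (p * d) = - moebius d"
proof -
  have "coprime p d" using assms by (simp add: prime_imp_coprime)
  then have "squarefree (p * d) \<longleftrightarrow> squarefree d"
    using assms(1) squarefree_mult_coprime squarefree_multD(2) squarefree_prime by metis
  moreover have "prime_factors (p * d) = insert p (prime_factors d)"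
    using assms by (simp add: prime_factors_product prime_prime_factors)
  moreover have "p \<notin> prime_factors d" using assms by auto
  ultimately show ?thesis by (simp add: moebius_def)
qed

text \<open>For a prime \<^term>\<open>p\<close> dividing \<^term>\<open>n\<close>, the squarefree divisors cancel in pairs
  \<^term>\<open>d\<close>, \<^term>\<open>p * d\<close>.\<close>

lemma sum_moebius_divisors:
  assumes "n > 0"
  shows "(\<Sum>d | d dvd n. moebius d) = (if n = 1 then 1 else 0)"
proof (cases "n = 1")
  case False
  then obtain p where p: "prime p" "p dvd n" using prime_factor_nat by blast
  define D where "D = {d. d dvd n \<and> squarefree d \<and> \<not> p dvd d}"
  have fin: "finite {d. d dvd n}" using assms by simp
  have finD: "finite D" unfolding D_def by (rule finite_subset[OF _ fin]) auto
  have pos: "d > 0" if "d dvd n" for d using that assms by (auto intro: Nat.gr0I)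
  have "(\<Sum>d | d dvd n. moebius d) = (\<Sum>d\<in>{d. d dvd n \<and> squarefree d}. moebius d)"
    using fin by (intro sum.mono_neutral_right) (auto simp: moebius_def)
  also have "{d. d dvd n \<and> squarefree d} = D \<union> (*) p ` D"
  proof (intro equalityI subsetI)
    fix d assume d: "d \<in> {d. d dvd n \<and> squarefree d}"
    show "d \<in> D \<union> (*) p ` D"
    proof (cases "p dvd d")
      case True
      then obtain e where e: "d = p * e" by blast
      have "\<not> p dvd e"
      proof
        assume "p dvd e"
        then have "p^2 dvd d" unfolding e by (auto simp: power2_eq_square)
        then show False using d p(1) squarefreeD by (metis (no_types, lifting) mem_Collect_eq not_prime_unit)
      qed
      then have "e \<in> D" using d e by (auto simp: D_def dvd_mult_right squarefree_multD(2) intro: dvd_mult_right)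
      then show ?thesis using e by auto
    qed (use d in \<open>auto simp: D_def\<close>)
  next
    fix d assume "d \<in> D \<union> (*) p ` D"
    then consider "d \<in> D" | e where "e \<in> D" "d = p * e" by auto
    then show "d \<in> {d. d dvd n \<and> squarefree d}"
    proof cases
      case 2
      then have "coprime p e" using p by (auto simp: D_def prime_imp_coprime)
      then show ?thesis using 2 p by (auto simp: D_def divides_mult squarefree_mult_coprime squarefree_prime)
    qed (auto simp: D_def)
  qed
  also have "(\<Sum>d\<in>D \<union> (*) p ` D. moebius d) = (\<Sum>d\<in>D. moebius d) + (\<Sum>d\<in>(*) p ` D. moebius d)"
    using finD by (intro sum.union_disjoint) (auto simp: D_def)
  also have "(\<Sum>d\<in>(*) p ` D. moebius d) = (\<Sum>d\<in>D. moebius (p * d))"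
    using p(1) prime_gt_0_nat[OF p(1)] by (subst sum.reindex) (auto intro: inj_onI)
  also have "\<dots> = (\<Sum>d\<in>D. - moebius d)"
    using p(1) pos by (intro sum.cong) (auto simp: D_def moebius_prime_mult)
  finally show ?thesis using False by (simp add: sum_negf)
qed (use assms in simp)

section \<open>Zeros of linear forms modulo a prime\<close>

lemma det_dvd_of_common_zero:
  fixes p :: int
  assumes "prime p" "\<not> (p dvd u \<and> p dvd v)" "p dvd u * x + v * y" "p dvd u * x' + v * y'"
  shows "p dvd x * y' - x' * y"
proof -
  have "p dvd y' * (u * x + v * y) - y * (u * x' + v * y')" using assms by (intro dvd_diff dvd_mult) auto
  also have "\<dots> = u * (x * y' - x' * y)" by (simp add: algebra_simps)
  finally have 1: "p dvd u \<or> p dvd x * y' - x' * y" using assms(1) by (simp add: prime_dvd_mult_iff)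
  have "p dvd x * (u * x' + v * y') - x' * (u * x + v * y)" using assms by (intro dvd_diff dvd_mult) auto
  also have "\<dots> = v * (x * y' - x' * y)" by (simp add: algebra_simps)
  finally have "p dvd v \<or> p dvd x * y' - x' * y" using assms(1) by (simp add: prime_dvd_mult_iff)
  with 1 assms(2) show ?thesis by auto
qed

lemma zero_of_proportional:
  fixes p :: int
  assumes p: "prime p" and "p dvd x * y' - x' * y" "\<not> (p dvd x' \<and> p dvd y')" "p dvd u * x' + v * y'"
  shows "p dvd u * x + v * y"
proof -
  have "p dvd x * (u * x' + v * y') - v * (x * y' - x' * y)" by (rule dvd_diff[OF dvd_mult[OF assms(4)] dvd_mult[OF assms(2)]])
  also have "\<dots> = x' * (u * x + v * y)" by (simp add: algebra_simps)
  finally have 1: "p dvd x' \<or> p dvd u * x + v * y" using p by (simp add: prime_dvd_mult_iff)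
  have "p dvd y * (u * x' + v * y') + u * (x * y' - x' * y)" by (rule dvd_add[OF dvd_mult[OF assms(4)] dvd_mult[OF assms(2)]])
  also have "\<dots> = y' * (u * x + v * y)" by (simp add: algebra_simps)
  finally have "p dvd y' \<or> p dvd u * x + v * y" using p by (simp add: prime_dvd_mult_iff)
  with 1 assms show ?thesis by auto
qed

definition zero_set :: "int \<Rightarrow> nat \<Rightarrow> (nat \<Rightarrow> int) \<Rightarrow> (nat \<Rightarrow> int) \<Rightarrow> int \<Rightarrow> int \<Rightarrow> nat set" where
  "zero_set p R u v x y = {j. j < R \<and> p dvd u j * x + v j * y}"

text \<open>A nonzero form modulo \<open>p\<close> vanishes on a line, so two nonzero points killed
  by the same form are proportional, and then every form kills both or neither.\<close>

lemma zero_set_eq: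
  fixes p :: int
  assumes p: "prime p" and uv: "\<And>j. j < R \<Longrightarrow> \<not> (p dvd u j \<and> p dvd v j)"
    and xy: "\<not> (p dvd x \<and> p dvd y)" "\<not> (p dvd x' \<and> p dvd y')"
    and i: "i \<in> zero_set p R u v x y" "i \<in> zero_set p R u v x' y'"
  shows "zero_set p R u v x y = zero_set p R u v x' y'"
proof -
  have d: "p dvd x * y' - x' * y" "p dvd x' * y - x * y'"
    using i uv p unfolding zero_set_def by (auto intro: det_dvd_of_common_zero)
  show ?thesis unfolding zero_set_def using zero_of_proportional[OF p d(1) xy(2)] zero_of_proportional[OF p d(2) xy(1)]
    by blast
qed

text \<open>The zero set is constant on each line through the origin modulo \<^term>\<open>p\<close>, and only \<^term>\<open>R\<close>
  lines meet a zero; so a condition on the zero set costs only \<^term>\<open>R\<close> sublattices,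
  whatever \<^term>\<open>p\<close> is.\<close>

lemma zero_set_indicator:
  fixes p :: int and P :: "nat set \<Rightarrow> bool"
  assumes p: "prime p" and uv: "\<And>j. j < R \<Longrightarrow> \<not> (p dvd u j \<and> p dvd v j)"
  shows "\<exists>e :: nat \<Rightarrow> real. (\<forall>j. \<bar>e j\<bar> \<le> 1) \<and>
    (\<forall>x y. \<not> (p dvd x \<and> p dvd y) \<longrightarrow> of_bool (P (zero_set p R u v x y)) =
       of_bool (P {}) + (\<Sum>j<R. e j * of_bool (p dvd u j * x + v j * y)))"
proof -
  \<comment> \<open>\<open>Q j x y\<close> says that \<open>j\<close> is the first zero on the line
    through \<open>(x, y)\<close>. Charging a line to its first zero alone makes its correction
    count once even if it has several zeros. The representative chosen in \<open>e\<close> is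
    immaterial by \<open>zero_set_eq\<close>.\<close>
  define Q where "Q j x y \<longleftrightarrow> \<not> (p dvd x \<and> p dvd y) \<and> j \<in> zero_set p R u v x y \<and>
      (\<forall>i\<in>zero_set p R u v x y. j \<le> i)" for j x y
  define e where "e j = (if \<exists>x y. Q j x y
     then of_bool (P (zero_set p R u v (fst (SOME z. Q j (fst z) (snd z))) (snd (SOME z. Q j (fst z) (snd z))))) - of_bool (P {}) else (0::real))" for j
  have e1: "e j = of_bool (P (zero_set p R u v x y)) - of_bool (P {})" if "Q j x y" for j x y
  proof -
    define z where "z = (SOME z. Q j (fst z) (snd z))"
    have "Q j (fst (x,y)) (snd (x,y))" using that by simp
    then have "Q j (fst z) (snd z)" unfolding z_def by (rule someI)
    then have "zero_set p R u v x y = zero_set p R u v (fst z) (snd z)"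
      using that zero_set_eq[OF p uv, where x=x and y=y and x'="fst z" and y'="snd z" and i=j] unfolding Q_def by auto
    then show ?thesis using that unfolding e_def z_def by auto
  qed
  show ?thesis
  proof (intro exI[of _ e] conjI allI impI)
    show "\<bar>e j\<bar> \<le> 1" for j unfolding e_def by (auto simp: of_bool_def)
    fix x y assume xy: "\<not> (p dvd x \<and> p dvd y)"
    let ?Z = "zero_set p R u v x y"
    have fin: "finite ?Z" unfolding zero_set_def by auto
    have sum: "(\<Sum>j<R. e j * of_bool (p dvd u j * x + v j * y)) = (\<Sum>j\<in>?Z. e j)"
      by (rule sum.mono_neutral_cong_right) (auto simp: zero_set_def)
    show "of_bool (P ?Z) = of_bool (P {}) + (\<Sum>j<R. e j * of_bool (p dvd u j * x + v j * y))"
    proof (cases "?Z = {}")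
      case True
      then show ?thesis unfolding sum by simp
    next
      case False
      define m where "m = Min ?Z"
      have m: "m \<in> ?Z" "\<And>i. i \<in> ?Z \<Longrightarrow> m \<le> i" using False fin unfolding m_def by auto
      \<comment> \<open>Otherwise \<open>j\<close> would be the first zero of some line; sharing the
        zero \<open>j\<close>, that line has the zero set \<open>?Z\<close>, whose first element is
        \<open>m\<close>.\<close>
      have "e j = 0" if j: "j \<in> ?Z" "j \<noteq> m" for j
      proof (rule ccontr)
        assume "e j \<noteq> 0"
        then obtain x' y' where q: "Q j x' y'" unfolding e_def by (meson)
        then have "zero_set p R u v x' y' = ?Z"
          using zero_set_eq[OF p uv, where x=x' and y=y' and x'=x and y'=y and i=j] j xy unfolding Q_def by auto
        then show False using q m j unfolding Q_def by (metis le_antisym)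
      qed
      then have "(\<Sum>j\<in>?Z. e j) = e m" using m fin by (subst sum.remove[of _ m]) auto
      also have "\<dots> = of_bool (P ?Z) - of_bool (P {})" using m xy by (intro e1) (auto simp: Q_def)
      finally show ?thesis unfolding sum by simp
    qed
  qed
qed

text \<open>With \<open>r\<close> an inverse of \<open>v\<close>, the condition fixes
  \<open>y\<close> modulo \<open>p\<close> for each \<open>x\<close>: in a column of the lattice it
  selects a progression of step \<open>p\<close>.\<close>

lemma line_as_graph:
  fixes p :: int
  assumes p: "prime p" and v: "\<not> p dvd v"
  shows "\<exists>r. \<forall>x y. p dvd u * x + v * y \<longleftrightarrow> p dvd y + u * x * r"
proof -
  have "coprime v p" using p v by (metis coprime_commute prime_imp_coprime)
  then obtain r where r: "[v * r = 1] (mod p)" using cong_solve_coprime_int by blast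
  have "\<not> p dvd r"
  proof
    assume "p dvd r"
    then have "[v * r = 0] (mod p)" by (simp add: cong_0_iff)
    then have "[1 = 0] (mod p)" using r by (metis cong_sym cong_trans)
    then show False using p by (simp add: cong_0_iff not_prime_unit)
  qed
  moreover have "[r * (u * x + v * y) = y + u * x * r] (mod p)" for x y
  proof -
    have "r * (u * x + v * y) = (v * r) * y + u * x * r" by (simp add: algebra_simps)
    also have "[\<dots> = 1 * y + u * x * r] (mod p)" using r by (intro cong_add cong_mult) auto
    finally show ?thesis by simp
  qed
  ultimately have "p dvd u * x + v * y \<longleftrightarrow> p dvd y + u * x * r" for x y
    using p by (metis cong_dvd_iff prime_dvd_mult_iff)
  then show ?thesis by blast
qed

lemma card_residues_line:
  fixes p :: int
  assumes p: "prime p" and uv: "\<not> (p dvd u \<and> p dvd v)"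
  shows "card {(x, y). x \<in> {0..<p} \<and> y \<in> {0..<p} \<and> \<not> (p dvd x \<and> p dvd y) \<and> p dvd u * x + v * y} = nat p - 1"
    (is "card ?S = _")
proof -
  let ?X = "\<lambda>u v. {(x, y). x \<in> {0..<p} \<and> y \<in> {0..<p} \<and> p dvd u * x + v * y}"
  have swap: "card (?X u v) = nat p" if nv: "\<not> p dvd v" for u v
  proof -
    obtain r where r: "\<And>x y. p dvd u * x + v * y \<longleftrightarrow> p dvd y + u * x * r" using line_as_graph[OF p nv] by metis
    have "p dvd u * x + v * y \<longleftrightarrow> y = (- u * x * r) mod p" if "y \<in> {0..<p}" for x y
    proof -
      have "p dvd u * x + v * y \<longleftrightarrow> [y = - u * x * r] (mod p)" unfolding r by (simp add: cong_iff_dvd_diff)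
      then show ?thesis using that by (simp add: cong_def)
    qed
    then have "?X u v = (\<lambda>x. (x, (- u * x * r) mod p)) ` {0..<p}"
      using prime_gt_0_int[OF p] by auto
    then show ?thesis by (simp add: card_image inj_on_def)
  qed
  have all: "card (?X u v) = nat p"
  proof (cases "p dvd v")
    case True
    then have "\<not> p dvd u" using uv by auto
    from swap[OF this, of v]
    have "card (?X v u) = nat p" .
    moreover have "?X u v =
       prod.swap ` (?X v u)"
      by (force simp: add.commute)
    ultimately show ?thesis by (simp add: card_image)
  qed (use swap in blast)
  have small: "x = 0" if "x \<in> {0..<p}" "p dvd x" for x using that zdvd_imp_le[of p x] by (cases "x = 0") auto
  have "?S = ?X u v - {(0,0)}"
    using small by auto
  also have "card \<dots> = nat p - 1" using p prime_gt_0_int[OF p] all by (subst card_Diff_singleton) auto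
  finally show ?thesis .
qed

lemma card_residues_nonzero:
  fixes p :: int
  assumes p: "p > 0"
  shows "real (card {(x, y). x \<in> {0..<p} \<and> y \<in> {0..<p} \<and> \<not> (p dvd x \<and> p dvd y)}) = (of_int p)^2 - 1"
proof -
  have small: "x = 0" if "x \<in> {0..<p}" "p dvd x" for x using that zdvd_imp_le[of p x] by (cases "x = 0") auto
  have "{(x, y). x \<in> {0..<p} \<and> y \<in> {0..<p} \<and> \<not> (p dvd x \<and> p dvd y)} = {0..<p} \<times> {0..<p} - {(0,0)}"
    using small by auto
  moreover have "card ({0..<p} \<times> {0..<p} - {(0::int,0::int)}) = nat p * nat p - 1"
    using p by (subst card_Diff_singleton) (auto simp: card_cartesian_product)
  moreover have "nat p * nat p \<ge> 1" using p by (simp add: Suc_leI)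
  ultimately show ?thesis using p by (simp add: of_nat_diff power2_eq_square)
qed

section \<open>Lattice points of a convex set in sublattices\<close>

definition fits :: "real \<Rightarrow> (real \<times> real) set \<Rightarrow> bool" where
  "fits D C \<longleftrightarrow> D \<ge> 0 \<and> C \<in> sets borel \<and> convex C \<and> (\<exists>x0 y0. C \<subseteq> {x0..x0+D} \<times> {y0..y0+D})"

definition lattice_pts :: "(real \<times> real) set \<Rightarrow> real \<Rightarrow> (int \<times> int) set" where
  "lattice_pts C N = {(a, b). (of_int a / N, of_int b / N) \<in> C}"

lemma lattice_pts_count:
  assumes "fits D C" "N > 0"
  shows "finite (lattice_pts C N)" "\<bar>real (card (lattice_pts C N)) - N^2 * vol C\<bar> \<le> 2 * N * D + 1"
proof -
  obtain x0 y0 where C: "C \<subseteq> {x0..x0+D} \<times> {y0..y0+D}" "C \<in> sets borel" "convex C" "D \<ge> 0"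
    using assms unfolding fits_def by auto
  from lattice_count[OF C(2,3,1,4,4) assms(2,2), of "\<lambda>_. 0"]
  show "finite (lattice_pts C N)" "\<bar>real (card (lattice_pts C N)) - N^2 * vol C\<bar> \<le> 2 * N * D + 1"
    by (auto simp: lattice_pts_def power2_eq_square mult_ac)
qed

text \<open>One of the two scales is divided by \<open>p\<close> and the other is kept, so the error
  is no larger than for the full lattice. This is where uniformity in \<open>p\<close> comes
  from.\<close>

lemma lattice_pts_line_count:
  fixes p :: int
  assumes "fits D C" and N: "N > 0" and p: "prime p" and uv: "\<not> (p dvd u \<and> p dvd v)"
  shows "\<bar>real (card {(a, b) \<in> lattice_pts C N. p dvd u * a + v * b}) - N^2 * vol C / p\<bar> \<le> 2 * N * D + 1"
proof -
  let ?U = "{(a, b) \<in> lattice_pts C N. p dvd u * a + v * b}"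
  obtain x0 y0 where C: "C \<subseteq> {x0..x0+D} \<times> {y0..y0+D}" "C \<in> sets borel" "convex C" and D: "D \<ge> 0"
    using assms unfolding fits_def by auto
  have p1: "real_of_int p \<ge> 1" "p > 0" using prime_gt_0_int[OF p] by auto
  have Np: "N / p > 0" using N p1 by simp
  have le: "N / p * D \<le> N * D" using N p1 D by (intro mult_right_mono) (auto simp: field_simps mult_le_cancel_left1)
  show ?thesis
  proof (cases "p dvd v")
    case False
    obtain r where dv: "\<And>a b. p dvd u * a + v * b \<longleftrightarrow> p dvd b + u * a * r" using line_as_graph[OF p False] by metis
    \<comment> \<open>Writing the second coordinate as \<open>p * c - u * a * r\<close> turns the
      points of column \<open>a\<close> into a full column in \<open>c\<close> at scale
      \<open>N / p\<close>, displaced by \<open>s a\<close>.\<close>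
    define s where "s a = real_of_int (- u * a * r) / p" for a
    define S where "S = {(a::int, b::int). (of_int a / N, (of_int b + s a) / (N / p)) \<in> C}"
    have eq: "(of_int b + s a) / (N / p) = of_int (p * b - u * a * r) / N" for a b
      using p1 N by (simp add: s_def field_simps)
    have "?U = (\<lambda>(a, b). (a, p * b - u * a * r)) ` S" (is "?L = ?R")
    proof (intro equalityI subsetI)
      fix z assume "z \<in> ?L"
      then obtain a b where z: "z = (a, b)" "(a, b) \<in> lattice_pts C N" "p dvd b + u * a * r" by (auto simp: dv)
      then obtain c where c: "b + u * a * r = p * c" by blast
      then have b: "b = p * c - u * a * r" by simp
      have "(a, c) \<in> S" using z(2) by (simp only: S_def lattice_pts_def mem_Collect_eq split_conv eq b)
      then show "z \<in> ?R" using z b by force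
    next
      fix z assume "z \<in> ?R"
      then obtain a c where ac: "z = (a, p * c - u * a * r)" "(a, c) \<in> S" by auto
      then have "z \<in> lattice_pts C N" by (simp only: S_def lattice_pts_def mem_Collect_eq split_conv eq)
      then show "z \<in> ?L" using ac(1) by (simp add: dv)
    qed
    moreover have "inj_on (\<lambda>(a, b). (a, p * b - u * a * r)) S" using p1 by (auto simp: inj_on_def)
    ultimately have "card ?U = card S" by (simp add: card_image)
    moreover have "\<bar>real (card S) - N * (N / p) * vol C\<bar> \<le> N * D + 1 + N / p * D"
      unfolding S_def by (rule lattice_count(2)[OF C(2,3,1) D D N Np])
    ultimately show ?thesis using le by (simp add: power2_eq_square)
  next
    case True
    then have u: "\<not> p dvd u" using uv by auto
    \<comment> \<open>The condition is now \<open>p dvd a\<close>, which is no graph over the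
      columns; it is the first coordinate that is divided by \<open>p\<close>.\<close>
    define S where "S = {(a::int, b::int). (of_int a / (N / p), (of_int b + 0) / N) \<in> C}"
    have dv: "p dvd u * a + v * b \<longleftrightarrow> p dvd a" for a b
      using True u p by (simp add: dvd_add_left_iff prime_dvd_mult_iff)
    have "?U = (\<lambda>(a, b). (p * a, b)) ` S" (is "?L = ?R")
    proof (intro equalityI subsetI)
      fix z assume "z \<in> ?L"
      then obtain a b where z: "z = (p * a, b)" "(p * a, b) \<in> lattice_pts C N" by (auto simp: dv elim!: dvdE)
      have "(a, b) \<in> S" using z(2) unfolding S_def lattice_pts_def by (auto simp: mult.commute)
      then show "z \<in> ?R" using z by force
    next
      fix z assume "z \<in> ?R"
      then obtain a b where ab: "z = (p * a, b)" "(a, b) \<in> S" by auto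
      then have "z \<in> lattice_pts C N" by (auto simp: S_def lattice_pts_def mult.commute)
      then show "z \<in> ?L" using ab(1) by (simp add: dv)
    qed
    moreover have "inj_on (\<lambda>(a, b). (p * a, b)) S" using p1 by (auto simp: inj_on_def)
    ultimately have "card ?U = card S" by (simp add: card_image)
    moreover have "\<bar>real (card S) - N / p * N * vol C\<bar> \<le> N / p * D + 1 + N * D"
      unfolding S_def by (rule lattice_count(2)[OF C(2,3,1) D D Np N])
    ultimately show ?thesis using le by (simp add: power2_eq_square)
  qed
qed

lemma lattice_pts_multiple_count:
  fixes p :: int
  assumes C: "fits D C" and N: "N > 0" and p: "p > 0"
  shows "\<bar>real (card {(a, b) \<in> lattice_pts C N. p dvd a \<and> p dvd b}) - N^2 * vol C / p^2\<bar> \<le> 2 * N * D + 1"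
proof -
  have Np: "N / p > 0" using N p by simp
  have p1: "real_of_int p \<ge> 1" using p by simp
  have D: "D \<ge> 0" using C by (auto simp: fits_def)
  have le: "N / p * D \<le> N * D" using N p1 D by (intro mult_right_mono) (auto simp: field_simps mult_le_cancel_left1)
  have "{(a, b) \<in> lattice_pts C N. p dvd a \<and> p dvd b} = (\<lambda>(a, b). (p * a, p * b)) ` lattice_pts C (N / p)" (is "?L = ?R")
  proof (intro equalityI subsetI)
    fix z assume "z \<in> ?L"
    then obtain a b where z: "z = (p * a, p * b)" "(p * a, p * b) \<in> lattice_pts C N" by (auto elim!: dvdE)
    have "(a, b) \<in> lattice_pts C (N / p)" using z(2) unfolding lattice_pts_def by (auto simp: mult.commute)
    then show "z \<in> ?R" using z by force
  next
    fix z assume "z \<in> ?R"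
    then show "z \<in> ?L" unfolding lattice_pts_def by (auto simp: mult.commute)
  qed
  moreover have "inj_on (\<lambda>(a, b). (p * a, p * b)) (lattice_pts C (N / p))" using p by (auto simp: inj_on_def)
  ultimately have "card {(a, b) \<in> lattice_pts C N. p dvd a \<and> p dvd b} = card (lattice_pts C (N / p))" by (simp add: card_image)
  then show ?thesis using lattice_pts_count(2)[OF C Np] le by (simp add: power_divide)
qed

definition residue_pairs :: "int \<Rightarrow> nat \<Rightarrow> (nat \<Rightarrow> int) \<Rightarrow> (nat \<Rightarrow> int) \<Rightarrow> (nat set \<Rightarrow> bool) \<Rightarrow> (int \<times> int) set" where
  "residue_pairs p R u v P = {(x, y). x \<in> {0..<p} \<and> y \<in> {0..<p} \<and> \<not> (p dvd x \<and> p dvd y) \<and> P (zero_set p R u v x y)}"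

lemma finite_residue_pairs: "finite (residue_pairs p R u v P)"
  by (rule finite_subset[of _ "{0..<p} \<times> {0..<p}"]) (auto simp: residue_pairs_def)

lemma card_residue_pairs_le:
  assumes "p \<ge> 0"
  shows "real (card (residue_pairs p R u v P)) \<le> (real_of_int p)^2"
proof -
  have "card (residue_pairs p R u v P) \<le> card ({0..<p} \<times> {0..<p})"
    by (rule card_mono) (auto simp: residue_pairs_def)
  also have "\<dots> = nat p * nat p" by (simp add: card_cartesian_product)
  finally have "real (card (residue_pairs p R u v P)) \<le> real (nat p * nat p)" by (simp only: of_nat_le_iff)
  then show ?thesis using assms by (simp add: power2_eq_square)
qed

text \<open>By \<open>zero_set_indicator\<close> the count is a combination of \<open>R + 1\<close>
  counts of points that are nonzero modulo \<open>p\<close>, each a difference of two lattice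
  counts; hence the factor \<open>2 * (R + 1)\<close>.\<close>

lemma zero_set_count:
  fixes p :: int
  assumes C: "fits D C" and N: "N > 0" and p: "prime p" and uv: "\<And>j. j < R \<Longrightarrow> \<not> (p dvd u j \<and> p dvd v j)"
  shows "\<bar>real (card {(a, b) \<in> lattice_pts C N. \<not> (p dvd a \<and> p dvd b) \<and> P (zero_set p R u v a b)})
     - N^2 * vol C * card (residue_pairs p R u v P) / p^2\<bar> \<le> real (2 * (R + 1)) * (2 * N * D + 1)"
proof -
  obtain e :: "nat \<Rightarrow> real" where e0: "(\<forall>j. \<bar>e j\<bar> \<le> 1) \<and>
    (\<forall>x y. \<not> (p dvd x \<and> p dvd y) \<longrightarrow> of_bool (P (zero_set p R u v x y)) =
       of_bool (P {}) + (\<Sum>j<R. e j * of_bool (p dvd u j * x + v j * y)))"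
    using zero_set_indicator[OF p uv, where P = P] by (rule exE)
  note e = e0[THEN conjunct1, rule_format] and ind = e0[THEN conjunct2, rule_format]
  define c where "c = (of_bool (P {}) :: real)"
  have c: "\<bar>c\<bar> \<le> 1" unfolding c_def by auto
  have p0: "p > 0" using prime_gt_0_int[OF p] .
  \<comment> \<open>Stated for any finite \<open>S\<close> because it is used twice: for the lattice
    points and for a complete system of residues. The second use identifies the main term although
    the coefficients \<open>e\<close> are unknown.\<close>
  have split: "real (card {(a, b) \<in> S. \<not> (p dvd a \<and> p dvd b) \<and> P (zero_set p R u v a b)}) =
      c * card {(a, b) \<in> S. \<not> (p dvd a \<and> p dvd b)} +
      (\<Sum>j<R. e j * card {(a, b) \<in> S. \<not> (p dvd a \<and> p dvd b) \<and> p dvd u j * a + v j * b})" if S: "finite S" for S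
  proof -
    define W where "W = {(a, b) \<in> S. \<not> (p dvd a \<and> p dvd b)}"
    have W: "finite W" unfolding W_def by (rule finite_subset[OF _ S]) auto
    have cnt: "real (card {(a, b) \<in> W. Q a b}) = (\<Sum>z\<in>W. of_bool (Q (fst z) (snd z)))" for Q
    proof -
      have "{(a, b) \<in> W. Q a b} = {z\<in>W. Q (fst z) (snd z)}" by auto
      then show ?thesis using W by (simp add: of_bool_def sum.If_cases Int_def)
    qed
    have "real (card {(a, b) \<in> W. P (zero_set p R u v a b)}) = (\<Sum>z\<in>W. of_bool (P (zero_set p R u v (fst z) (snd z))))"
      by (rule cnt)
    also have "\<dots> = (\<Sum>z\<in>W. c + (\<Sum>j<R. e j * of_bool (p dvd u j * fst z + v j * snd z)))"
      unfolding c_def by (intro sum.cong refl ind) (auto simp: W_def)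
    also have "\<dots> = c * card W + (\<Sum>j<R. e j * (\<Sum>z\<in>W. of_bool (p dvd u j * fst z + v j * snd z)))"
      by (simp only: sum.distrib sum_distrib_left sum_constant) (subst sum.swap, simp)
    also have "\<dots> = c * card W + (\<Sum>j<R. e j * real (card {(a, b) \<in> W. p dvd u j * a + v j * b}))"
      by (simp add: cnt)
    also have "{(a, b) \<in> W. P (zero_set p R u v a b)} = {(a, b) \<in> S. \<not> (p dvd a \<and> p dvd b) \<and> P (zero_set p R u v a b)}"
      by (auto simp: W_def)
    also have "(\<lambda>j. {(a, b) \<in> W. p dvd u j * a + v j * b}) = (\<lambda>j. {(a, b) \<in> S. \<not> (p dvd a \<and> p dvd b) \<and> p dvd u j * a + v j * b})"
      by (auto simp: W_def)
    finally show ?thesis unfolding W_def by meson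
  qed
  define M where "M = N^2 * vol C"
  define E where "E = 2 * N * D + 1"
  define Lt where "Lt = lattice_pts C N"
  let ?Bo = "{(a, b) \<in> Lt. p dvd a \<and> p dvd b}" and ?Nz = "{(a, b) \<in> Lt. \<not> (p dvd a \<and> p dvd b)}"
  let ?Ln = "\<lambda>j. {(a, b) \<in> Lt. \<not> (p dvd a \<and> p dvd b) \<and> p dvd u j * a + v j * b}"
  have finL: "finite Lt" unfolding Lt_def using lattice_pts_count(1)[OF C N] .
  have both: "\<bar>real (card ?Bo) - M / p^2\<bar> \<le> E"
    unfolding Lt_def M_def E_def by (rule lattice_pts_multiple_count[OF C N p0])
  have nz: "\<bar>real (card ?Nz) - M * (real_of_int p^2 - 1) / p^2\<bar> \<le> 2 * E"
  proof -
    have "?Nz = Lt - ?Bo" by auto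
    then have "real (card ?Nz) = real (card Lt) - card ?Bo"
      using finL finite_subset[OF _ finL, of "?Bo"] card_mono[OF finL, of "?Bo"]
      by (auto simp: card_Diff_subset of_nat_diff subset_iff)
    moreover have "\<bar>real (card Lt) - M\<bar> \<le> E" unfolding Lt_def M_def E_def by (rule lattice_pts_count[OF C N])
    moreover have "M * (real_of_int p^2 - 1) / p^2 = M - M / p^2" using p0 by (simp add: field_simps)
    ultimately show ?thesis using both by linarith
  qed
  have ln: "\<bar>real (card (?Ln j)) - M * (real_of_int p - 1) / p^2\<bar> \<le> 2 * E"
    if j: "j < R" for j
  proof -
    let ?X = "{(a, b) \<in> Lt. p dvd u j * a + v j * b}" and ?Y = "?Bo"
    have fX: "finite ?X" by (rule finite_subset[OF _ finL]) auto
    have YX: "?Y \<subseteq> ?X" by auto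
    have "(?Ln j) = ?X - ?Y" by auto
    then have "real (card (?Ln j)) = real (card ?X) - card ?Y"
      using fX YX by (simp add: card_Diff_subset finite_subset of_nat_diff card_mono)
    moreover have "\<bar>real (card ?X) - M / p\<bar> \<le> E" unfolding Lt_def M_def E_def
      by (rule lattice_pts_line_count[OF C N p uv[OF j]])
    moreover have "M * (real_of_int p - 1) / p^2 = M / p - M / p^2" using p0 by (simp add: field_simps power2_eq_square)
    ultimately show ?thesis using both by linarith
  qed
  have A: "real (card (residue_pairs p R u v P)) = c * (real_of_int p^2 - 1) + (\<Sum>j<R. e j * (real_of_int p - 1))"
  proof -
    have "residue_pairs p R u v P = {(a, b) \<in> {0..<p} \<times> {0..<p}. \<not> (p dvd a \<and> p dvd b) \<and> P (zero_set p R u v a b)}"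
      by (auto simp: residue_pairs_def)
    moreover have "{(a, b) \<in> {0..<p} \<times> {0..<p}. \<not> (p dvd a \<and> p dvd b)} = {(x, y). x \<in> {0..<p} \<and> y \<in> {0..<p} \<and> \<not> (p dvd x \<and> p dvd y)}" by auto
    moreover have "real (card {(a, b) \<in> {0..<p} \<times> {0..<p}. \<not> (p dvd a \<and> p dvd b) \<and> p dvd u j * a + v j * b}) = real_of_int p - 1"
      if j: "j < R" for j
    proof -
      have "{(a, b) \<in> {0..<p} \<times> {0..<p}. \<not> (p dvd a \<and> p dvd b) \<and> p dvd u j * a + v j * b} =
        {(x, y). x \<in> {0..<p} \<and> y \<in> {0..<p} \<and> \<not> (p dvd x \<and> p dvd y) \<and> p dvd u j * x + v j * y}" by auto
      then show ?thesis using card_residues_line[OF p uv[OF j]] p0 by (simp add: of_nat_diff)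
    qed
    ultimately show ?thesis using split[of "{0..<p} \<times> {0..<p}"] card_residues_nonzero[OF p0] by simp
  qed
  have "real (card {(a, b) \<in> Lt. \<not> (p dvd a \<and> p dvd b) \<and> P (zero_set p R u v a b)}) - M * card (residue_pairs p R u v P) / p^2
     = c * (real (card ?Nz) - M * (real_of_int p^2 - 1) / p^2)
     + (\<Sum>j<R. e j * (real (card (?Ln j)) - M * (real_of_int p - 1) / p^2))"
  proof -
    define Y where "Y j = real (card (?Ln j))" for j
    define X where "X = real (card ?Nz)"
    have "(\<Sum>j<R. e j * (Y j - M * (real_of_int p - 1) / p^2)) =
        (\<Sum>j<R. e j * Y j) - (\<Sum>j<R. e j * (M * (real_of_int p - 1) / p^2))"
      by (simp only: right_diff_distrib sum_subtractf)
    also have "(\<Sum>j<R. e j * (M * (real_of_int p - 1) / p^2)) = M * (\<Sum>j<R. e j * (real_of_int p - 1)) / p^2"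
      unfolding sum_distrib_left sum_divide_distrib by (intro sum.cong) auto
    finally have eq: "(\<Sum>j<R. e j * (Y j - M * (real_of_int p - 1) / p^2)) =
        (\<Sum>j<R. e j * Y j) - M * (\<Sum>j<R. e j * (real_of_int p - 1)) / p^2" .
    have combine: "c * x + s2 - M * (c * a + s3) / q = c * (x - M * a / q) + s1" if "s1 = s2 - M * s3 / q"
      for s1 s2 s3 x a q :: real using that by (simp add: algebra_simps add_divide_distrib)
    show ?thesis using combine[OF eq] unfolding split[OF finL] A Y_def X_def .
  qed
  also have "\<bar>\<dots>\<bar> \<le> 1 * (2 * E) + (\<Sum>j<R. 1 * (2 * E))"
    using c nz e ln
    by (intro order_trans[OF abs_triangle_ineq] add_mono order_trans[OF sum_abs] sum_mono)
       (auto simp only: abs_mult lessThan_iff intro!: mult_mono)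
  also have "\<dots> = real (2 * (R + 1)) * E" by (simp add: algebra_simps)
  finally show ?thesis unfolding M_def E_def Lt_def .
qed

section \<open>For prime \<open>p\<close>, \<open>kappa p\<close> is the product of 1 - l^(-2) over
  the primes l other than \<open>p\<close>\<close>

definition kappa :: "nat \<Rightarrow> real" where
  "kappa p = (\<Sum>d. if p dvd d then 0 else moebius d / (real d)^2)"

lemma sums_inverse_product: "(\<lambda>n. 2 / (real (n + Suc X) * real (n + Suc X + 1))) sums (2 / real (Suc X))"
proof -
  have "(\<lambda>n. 2 / (real n + real (Suc X))) \<longlonglongrightarrow> 0" by real_asymp
  then have "(\<lambda>n. 2 / real (n + Suc X)) \<longlonglongrightarrow> 0" by (simp only: of_nat_add)
  from telescope_sums'[OF this]
  have "(\<lambda>n. 2 / real (n + Suc X) - 2 / real (Suc n + Suc X)) sums (2 / real (0 + Suc X) - 0)" .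
  moreover have "2 / real (n + Suc X) - 2 / real (Suc n + Suc X) = 2 / (real (n + Suc X) * real (n + Suc X + 1))" for n
    by (simp add: divide_simps)
  ultimately show ?thesis by simp
qed

lemma kappa_term_bound: "\<bar>if p dvd d then 0 else moebius d / (real d)^2\<bar> \<le> 1 / (real d)^2"
  using abs_moebius_le[of d] by (auto simp: abs_divide divide_right_mono)

lemma inverse_square_shift_le: "1 / (real (n + Suc X))^2 \<le> 2 / (real (n + Suc X) * real (n + Suc X + 1))"
proof -
  define k where "k = real (n + Suc X)"
  have "k \<ge> 1" unfolding k_def by simp
  then have "k + 1 \<le> 2 * k" by simp
  then have "k * (k + 1) \<le> 2 * k^2" using \<open>k \<ge> 1\<close> by (simp add: power2_eq_square mult.left_commute)
  then have "2 / (2 * k^2) \<le> 2 / (k * (k + 1))" using \<open>k \<ge> 1\<close> by (intro divide_left_mono) auto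
  then have "1 / k^2 \<le> 2 / (k * (k + 1))" by simp
  then show ?thesis unfolding k_def by (simp add: add.commute)
qed

lemma kappa_summable: "summable (\<lambda>d. if p dvd d then 0 else moebius d / (real d)^2)"
proof (rule summable_comparison_test_ev)
  show "\<forall>\<^sub>F n in sequentially. norm (if p dvd n then 0 else moebius n / (real n)^2) \<le> 1 / (real n)^2"
    using kappa_term_bound by (auto simp del: abs_divide)
  show "summable (\<lambda>n. 1 / (real n)^2)" using inverse_power_summable[of 2, where 'a = real] by (simp add: inverse_eq_divide)
qed

text \<open>The terms \<open>1 / k^2\<close> are compared with \<open>2 / k - 2 / (k + 1)\<close>,
  which telescopes.\<close>

lemma kappa_tail: "\<bar>kappa p - (\<Sum>d\<in>{1..X}. if p dvd d then 0 else moebius d / (real d)^2)\<bar> \<le> 2 / real (Suc X)"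
proof -
  define f where "f d = (if p dvd d then 0 else moebius d / (real d)^2)" for d
  have sf: "summable f" unfolding f_def by (rule kappa_summable)
  have f0: "f 0 = 0" unfolding f_def by simp
  have "kappa p = (\<Sum>n. f (n + Suc X)) + (\<Sum>d<Suc X. f d)"
    unfolding kappa_def f_def[symmetric] by (rule suminf_split_initial_segment[OF sf])
  also have "(\<Sum>d<Suc X. f d) = (\<Sum>d\<in>{1..X}. f d)"
    by (rule sum.mono_neutral_right) (auto simp: f0 Suc_le_eq not_le intro!: gr0I)
  finally have "kappa p - (\<Sum>d\<in>{1..X}. f d) = (\<Sum>n. f (n + Suc X))" by simp
  also have "\<bar>\<dots>\<bar> \<le> (\<Sum>n. 2 / (real (n + Suc X) * real (n + Suc X + 1)))"
  proof -
    have "norm (\<Sum>n. f (n + Suc X)) \<le> (\<Sum>n. 2 / (real (n + Suc X) * real (n + Suc X + 1)))"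
    proof (rule norm_suminf_le)
      show "summable (\<lambda>n. 2 / (real (n + Suc X) * real (n + Suc X + 1)))" using sums_inverse_product by (rule sums_summable)
      show "norm (f (n + Suc X)) \<le> 2 / (real (n + Suc X) * real (n + Suc X + 1))" for n
        using kappa_term_bound[of p "n + Suc X"] inverse_square_shift_le[of n X] unfolding f_def real_norm_def by linarith
    qed
    then show ?thesis by simp
  qed
  also have "\<dots> = 2 / real (Suc X)" using sums_inverse_product by (rule sums_unique[symmetric])
  finally show ?thesis unfolding f_def .
qed

text \<open>The terms up to 2 contribute at least \<open>3/4\<close> and the tail is at most
  \<open>2/3\<close>. A bound that is the same for all \<open>p\<close> keeps the number of
  fractions of order \<open>Q^2\<close> uniformly.\<close>

lemma kappa_ge:
  assumes "prime p"
  shows "kappa p \<ge> 1 / 12"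
proof -
  have "(\<Sum>d\<in>{1..2}. if p dvd d then 0 else moebius d / (real d)^2) \<ge> 3/4"
  proof -
    have "{1..2} = {1, 2::nat}" by auto
    moreover have "\<not> p dvd 1" using assms by (simp add: prime_nat_iff)
    moreover have "moebius 2 \<ge> -1" using abs_moebius_le[of 2] by linarith
    ultimately show ?thesis by simp
  qed
  moreover have "2 / real (Suc 2) = 2 / 3" by simp
  ultimately show ?thesis using kappa_tail[of p 2] by linarith
qed

lemma sum_inverse_le_ln: "X \<ge> 1 \<Longrightarrow> (\<Sum>d\<in>{1..X}. 1 / real d) \<le> 1 + ln (real X)"
proof (induction X rule: dec_induct)
  case (step X)
  have "ln (real X / real (Suc X)) \<le> real X / real (Suc X) - 1" using step by (intro ln_le_minus_one) auto
  then have "1 / real (Suc X) \<le> ln (real (Suc X)) - ln (real X)" using step by (simp add: ln_div field_simps)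
  then show ?case using step by simp
qed simp

text \<open>Points that are not divisible by \<^term>\<open>p\<close> only have common divisors prime to \<^term>\<open>p\<close>, so
  the inversion runs over those; this is why the same factor \<^term>\<open>kappa p\<close> appears for every
  condition \<^term>\<open>P\<close>.\<close>

lemma coprime_zero_set_count:
  fixes p :: nat
  assumes C: "fits D C" and Q: "Q \<ge> 1" and p: "prime p" and uv: "\<And>j. j < R \<Longrightarrow> \<not> (int p dvd u j \<and> int p dvd v j)"
    and m: "m \<ge> 1" and far: "\<And>N. N > 0 \<Longrightarrow> lattice_pts C N \<noteq> {} \<Longrightarrow> m \<le> 2 * N"
  shows "\<bar>real (card {(a, b) \<in> lattice_pts C Q. coprime a b \<and> P (zero_set p R u v a b)})
     - kappa p * Q^2 * vol C * card (residue_pairs p R u v P) / real p^2\<bar>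
     \<le> (if m \<le> 2 * Q then real (2 * (R + 1)) * (2 * Q * D * (1 + ln (2 * Q)) + 2 * Q / m) else 0) + Q * m * vol C"
proof -
  let ?K = "{(a, b) \<in> lattice_pts C Q. coprime a b \<and> P (zero_set p R u v a b)}"
  let ?err = "(if m \<le> 2 * Q then real (2 * (R + 1)) * (2 * Q * D * (1 + ln (2 * Q)) + 2 * Q / m) else 0)"
  \<comment> \<open>By \<open>far\<close> the dilate by \<open>Q / d\<close> has no lattice points
    once \<open>d > 2 * Q / m\<close>. Cutting the inversion there loses nothing, and the constant
    error of each dilate is paid at most \<open>2 * Q / m\<close> times.\<close>
  define X where "X = nat \<lfloor>2 * Q / m\<rfloor>"
  have X: "d \<le> X \<longleftrightarrow> real d \<le> 2 * Q / m" for d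
    unfolding X_def using m Q by (simp add: le_nat_floor le_nat_iff le_floor_iff)
  have p0: "p > 0" using p by (rule prime_gt_0_nat)
  have pi: "prime (int p)" using p by simp
  have D: "D \<ge> 0" using C by (simp add: fits_def)
  define G where "G N = {(a, b) \<in> lattice_pts C N. \<not> (int p dvd a \<and> int p dvd b) \<and> P (zero_set p R u v a b)}" for N
  have finG: "finite (G N)" if "N > 0" for N
    by (rule finite_subset[OF _ lattice_pts_count(1)[OF C that]]) (auto simp: G_def)
  \<comment> \<open>A factor \<open>d\<close> prime to \<open>p\<close> does not move the zeros, so
    the condition on the zero set passes to the quotient by \<open>d\<close>.\<close>
  have zs: "zero_set p R u v (int d * a) (int d * b) = zero_set p R u v a b" if "\<not> p dvd d" for d a b
  proof -
    have "u j * (int d * a) + v j * (int d * b) = int d * (u j * a + v j * b)" for j by (simp add: algebra_simps)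
    then show ?thesis using that pi unfolding zero_set_def by (simp add: prime_dvd_mult_iff)
  qed
  have multG: "{(a, b) \<in> G Q. int d dvd a \<and> int d dvd b} = (\<lambda>(a, b). (int d * a, int d * b)) ` G (Q / d)"
    if d: "d \<ge> 1" "\<not> p dvd d" for d
  proof (intro equalityI subsetI)
    fix z assume "z \<in> {(a, b) \<in> G Q. int d dvd a \<and> int d dvd b}"
    then obtain a b where z: "z = (int d * a, int d * b)" "(int d * a, int d * b) \<in> G Q" by (auto elim!: dvdE)
    have "(a, b) \<in> G (Q / d)" using z(2) d zs[OF d(2)] unfolding G_def lattice_pts_def by (auto simp: mult.commute)
    then show "z \<in> (\<lambda>(a, b). (int d * a, int d * b)) ` G (Q / d)" using z(1) by force
  next
    fix z assume "z \<in> (\<lambda>(a, b). (int d * a, int d * b)) ` G (Q / d)"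
    then obtain a b where z: "z = (int d * a, int d * b)" "(a, b) \<in> G (Q / d)" by auto
    have "(int d * a, int d * b) \<in> G Q" using z(2) d zs[OF d(2)] pi unfolding G_def lattice_pts_def
      by (auto simp: mult.commute prime_dvd_mult_iff)
    then show "z \<in> {(a, b) \<in> G Q. int d dvd a \<and> int d dvd b}" using z(1) by auto
  qed
  have cardmult: "card {(a, b) \<in> G Q. int d dvd a \<and> int d dvd b} = card (G (Q / d))" if d: "d \<ge> 1" "\<not> p dvd d" for d
    unfolding multG[OF d] using d by (intro card_image) (auto simp: inj_on_def)
  have moeb: "of_bool (coprime a b) = (\<Sum>d\<in>{1..X}. if p dvd d then 0 else moebius d * of_bool (int d dvd a \<and> int d dvd b))"
    if ab: "(a, b) \<in> G Q" for a b
  proof -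
    define g where "g = nat (gcd a b)"
    have nz: "\<not> (int p dvd a \<and> int p dvd b)" using ab by (auto simp: G_def)
    then have g: "g > 0" "int g = gcd a b" unfolding g_def by (auto simp: gcd_pos_int)
    have dg: "d dvd g \<longleftrightarrow> int d dvd a \<and> int d dvd b" for d
      using g(2) by (metis gcd_greatest_iff int_dvd_int_iff)
    have sub: "d \<in> {1..X}" "\<not> p dvd d" if "d dvd g" for d
    proof -
      show np: "\<not> p dvd d" using nz dg that by (metis dvd_trans int_dvd_int_iff)
      have d1: "d \<ge> 1" using that g by (metis Suc_leI One_nat_def dvd_pos_nat)
      have "(a, b) \<in> {(a, b) \<in> G Q. int d dvd a \<and> int d dvd b}" using ab dg that by auto
      then have "lattice_pts C (Q / d) \<noteq> {}" unfolding multG[OF d1 np] by (auto simp: G_def)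
      then have "m \<le> 2 * (Q / d)" using far[of "Q / d"] d1 Q by simp
      then have "real d \<le> 2 * Q / m" using m d1 by (simp add: field_simps)
      then show "d \<in> {1..X}" using X d1 by simp
    qed
    have "of_bool (coprime a b) = (if g = 1 then 1 else (0::real))"
      using g(2) by (auto simp: coprime_iff_gcd_eq_1)
    also have "\<dots> = (\<Sum>d | d dvd g. moebius d)" using sum_moebius_divisors[OF g(1)] by simp
    also have "\<dots> = (\<Sum>d\<in>{1..X}. if p dvd d then 0 else moebius d * of_bool (int d dvd a \<and> int d dvd b))"
      using sub by (intro sum.mono_neutral_cong_left) (auto simp: dg)
    finally show ?thesis .
  qed
  have K: "real (card ?K) =
     (\<Sum>d\<in>{1..X}. if p dvd d then 0 else moebius d * card (G (Q / d)))"
  proof -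
    have ncop: "\<not> (int p dvd a \<and> int p dvd b)" if "coprime a b" for a b
      using that pi by (metis coprime_common_divisor not_prime_unit)
    have "?K = {z \<in> G Q. coprime (fst z) (snd z)}"
      using ncop by (auto simp: G_def)
    then have "real (card ?K) =
        (\<Sum>z\<in>G Q. of_bool (coprime (fst z) (snd z)))"
      using finG[of Q] Q by (simp add: of_bool_def sum.If_cases Int_def)
    also have "\<dots> = (\<Sum>z\<in>G Q. \<Sum>d\<in>{1..X}. if p dvd d then 0 else moebius d * of_bool (int d dvd fst z \<and> int d dvd snd z))"
      using moeb by (intro sum.cong) auto
    also have "\<dots> = (\<Sum>d\<in>{1..X}. \<Sum>z\<in>G Q. if p dvd d then 0 else moebius d * of_bool (int d dvd fst z \<and> int d dvd snd z))"
      by (rule sum.swap)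
    also have "\<dots> = (\<Sum>d\<in>{1..X}. if p dvd d then 0 else moebius d * card (G (Q / d)))"
    proof (intro sum.cong refl)
      fix d assume d: "d \<in> {1..X}"
      show "(\<Sum>z\<in>G Q. if p dvd d then 0 else moebius d * of_bool (int d dvd fst z \<and> int d dvd snd z)) =
         (if p dvd d then 0 else moebius d * card (G (Q / d)))"
      proof (cases "p dvd d")
        case False
        have "(\<Sum>z\<in>G Q. of_bool (int d dvd fst z \<and> int d dvd snd z)) = real (card {z\<in>G Q. int d dvd fst z \<and> int d dvd snd z})"
          using finG[of Q] Q by (simp add: of_bool_def sum.If_cases Int_def)
        also have "{z\<in>G Q. int d dvd fst z \<and> int d dvd snd z} = {(a, b) \<in> G Q. int d dvd a \<and> int d dvd b}" by auto
        finally show ?thesis using False cardmult[of d] d by (simp add: sum_distrib_left[symmetric])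
      qed simp
    qed
    finally show ?thesis .
  qed
  define M where "M = vol C * card (residue_pairs p R u v P) / real p^2"
  have Gc: "\<bar>real (card (G (Q / d))) - (Q / d)^2 * M\<bar> \<le> real (2 * (R + 1)) * (2 * (Q / d) * D + 1)" if "d \<ge> 1" for d :: nat
    using zero_set_count[where u = u and v = v and R = R and N = "Q / d" and P = P, OF C _ pi uv] that Q unfolding G_def M_def by (simp add: mult.assoc algebra_simps)
  define S where "S = (\<Sum>d\<in>{1..X}. if p dvd d then 0 else moebius d / (real d)^2)"
  have "\<bar>(\<Sum>d\<in>{1..X}. if p dvd d then 0 else moebius d * card (G (Q / d))) - Q^2 * M * S\<bar> \<le>
      (\<Sum>d\<in>{1..X}. real (2 * (R + 1)) * (2 * (Q / d) * D + 1))"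
  proof -
    have "(\<Sum>d\<in>{1..X}. if p dvd d then 0 else moebius d * card (G (Q / d))) - Q^2 * M * S =
      (\<Sum>d\<in>{1..X}. if p dvd d then 0 else moebius d * (card (G (Q / d)) - (Q / d)^2 * M))"
      unfolding S_def sum_distrib_left sum_subtractf[symmetric]
      by (intro sum.cong) (auto simp: algebra_simps power_divide)
    also have "\<bar>\<dots>\<bar> \<le> (\<Sum>d\<in>{1..X}. real (2 * (R + 1)) * (2 * (Q / d) * D + 1))"
    proof (intro order_trans[OF sum_abs] sum_mono)
      fix d assume "d \<in> {1..X}"
      then have d: "d \<ge> 1" by simp
      have "\<bar>moebius d\<bar> * \<bar>card (G (Q / d)) - (Q / d)^2 * M\<bar> \<le> 1 * (real (2 * (R + 1)) * (2 * (Q / d) * D + 1))"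
        by (intro mult_mono abs_moebius_le Gc d) auto
      moreover have "0 \<le> real (2 * (R + 1)) * (2 * (Q / d) * D + 1)" using Q D by (intro mult_nonneg_nonneg add_nonneg_nonneg) auto
      ultimately show "\<bar>if p dvd d then 0 else moebius d * (card (G (Q / d)) - (Q / d)^2 * M)\<bar> \<le> real (2 * (R + 1)) * (2 * (Q / d) * D + 1)"
        by (simp add: abs_mult)
    qed
    finally show ?thesis .
  qed
  also have "(\<Sum>d\<in>{1..X}. real (2 * (R + 1)) * (2 * (Q / d) * D + 1)) = real (2 * (R + 1)) * (2 * Q * D * (\<Sum>d\<in>{1..X}. 1 / real d) + X)"
    by (simp add: sum_distrib_left sum.distrib distrib_left mult_ac)
  also have "\<dots> \<le> ?err"
  proof (cases "m \<le> 2 * Q")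
    case True
    have X1: "X \<ge> 1" using X[of 1] True m by simp
    have XQ: "real X \<le> 2 * Q / m" using X[of X] by simp
    have "(\<Sum>d\<in>{1..X}. 1 / real d) \<le> 1 + ln (2 * Q)"
    proof -
      have "2 * Q / m \<le> 2 * Q" using m Q by (simp add: field_simps)
      then have "ln (real X) \<le> ln (2 * Q)" using X1 XQ by (subst ln_le_cancel_iff) auto
      then show ?thesis using sum_inverse_le_ln[OF X1] by linarith
    qed
    then show ?thesis using True XQ Q D by (simp) (intro mult_left_mono add_mono; simp)
  next
    case False
    then have "X = 0" using X[of 1] m by (simp add: not_le)
    then show ?thesis using False by simp
  qed
  finally have 1: "\<bar>real (card ?K) - Q^2 * M * S\<bar> \<le>
     ?err"
    unfolding K .
  have M: "0 \<le> M" "M \<le> vol C"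
  proof -
    show "0 \<le> M" unfolding M_def by simp
    have "M = vol C * (card (residue_pairs p R u v P) / real p^2)" unfolding M_def by simp
    also have "\<dots> \<le> vol C * 1"
      using card_residue_pairs_le[of "int p" R u v P] p0 by (intro mult_left_mono) auto
    finally show "M \<le> vol C" by simp
  qed
  \<comment> \<open>\<open>S\<close> is \<open>kappa p\<close> cut off at \<open>X\<close>. Its tail
    is at most \<open>2 / (X + 1)\<close>, and \<open>X + 1 > 2 * Q / m\<close>; this yields the
    last error term \<open>Q * m * vol C\<close>.\<close>
  have "\<bar>Q^2 * M * S - kappa p * Q^2 * M\<bar> \<le> Q * m * vol C"
  proof -
    have "2 * Q / m < real (Suc X)" using X[of "Suc X"] by (simp add: not_le)
    then have "2 / real (Suc X) \<le> m / Q" using m Q by (simp add: field_simps)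
    then have t: "\<bar>kappa p - S\<bar> \<le> m / Q" using kappa_tail[of p X] unfolding S_def by linarith
    have "\<bar>Q^2 * M * S - kappa p * Q^2 * M\<bar> = \<bar>Q^2 * M * (S - kappa p)\<bar>" by (simp add: algebra_simps)
    also have "\<dots> = Q^2 * M * \<bar>kappa p - S\<bar>" using M Q by (simp add: abs_mult abs_minus_commute)
    also have "\<dots> \<le> Q^2 * vol C * (m / Q)"
      using t M Q by (intro mult_mono) auto
    finally show ?thesis using Q by (simp add: power2_eq_square mult_ac)
  qed
  moreover have "kappa p * Q^2 * vol C * card (residue_pairs p R u v P) / real p^2 = kappa p * Q^2 * M"
    unfolding M_def by simp
  ultimately show ?thesis using 1 by linarith
qed

section \<open>Cells of the triangle\<close>

text \<open>The same recurrence gives the coordinates of the orbit under \<^term>\<open>farey_map\<close> (over the reals),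
  the denominators and numerators of consecutive Farey fractions (over the integers), and the residues
  in \<^term>\<open>admissible\<close> (modulo \<open>p\<close>).\<close>

fun cont :: "(nat \<Rightarrow> nat) \<Rightarrow> 'a::comm_ring_1 \<Rightarrow> 'a \<Rightarrow> nat \<Rightarrow> 'a" where
  "cont f x y 0 = x"
| "cont f x y (Suc 0) = y"
| "cont f x y (Suc (Suc j)) = of_nat (f j) * cont f x y (Suc j) - cont f x y j"

lemma cont_linear: "cont f x y j = cont f 1 0 j * x + cont f 0 1 j * y"
  by (induction f x y j rule: cont.induct) (simp_all add: algebra_simps)

lemma cont_cong: "(\<And>i. i + 2 \<le> j \<Longrightarrow> f i = g i) \<Longrightarrow> cont f x y j = cont g x y j"
  by (induction f x y j rule: cont.induct) auto

lemma of_int_cont: "of_int (cont f x y j) = cont f (of_int x) (of_int y) j"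
  by (induction f x y j rule: cont.induct) auto

lemma cont_scale: "cont f (c * x) (c * y) j = c * cont f x y j"
  by (induction f x y j rule: cont.induct) (auto simp: algebra_simps)

text \<open>Each step acts by a matrix of determinant 1. For denominators and numerators this is the
  relation between neighbouring Farey fractions; for the unit vectors it shows that the two
  coefficients of a position do not both vanish modulo \<open>p\<close>.\<close>

lemma cont_det:
  "cont f x y j * cont f x' y' (Suc j) - cont f x' y' j * cont f x y (Suc j) = x * y' - x' * y"
proof (induction j)
  case (Suc j)
  have "cont f x y (Suc j) * cont f x' y' (Suc (Suc j)) - cont f x' y' (Suc j) * cont f x y (Suc (Suc j)) =
    cont f x y j * cont f x' y' (Suc j) - cont f x' y' j * cont f x y (Suc j)"
    by (simp add: algebra_simps)
  then show ?case using Suc by (simp only:)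
qed simp

section \<open>Cells as intersections of linear preimages of the triangle\<close>

definition idx :: "real \<times> real \<Rightarrow> nat \<Rightarrow> nat" where
  "idx z j = nat (farey_index ((farey_map ^^ j) z))"

abbreviation "cell \<equiv> triangle_cell"

lemma triangle_pos: "(x, y) \<in> triangle \<Longrightarrow> 0 < x \<and> 0 < y"
  by (auto simp: triangle_def)

text \<open>The next pair lies in the triangle only if
  \<open>k * b - a \<le> 1 < (k + 1) * b - a\<close>, which is the floor condition; membership alone
  reveals the index.\<close>

lemma farey_index_eq:
  assumes "(a, b) \<in> triangle" "(b, of_nat k * b - a) \<in> triangle"
  shows "farey_index (a, b) = int k"
proof -
  have b: "b > 0" using triangle_pos[OF assms(1)] by simp
  have "of_nat k * b \<le> 1 + a" "1 + a < (of_nat k + 1) * b" using assms(2) by (auto simp: triangle_def algebra_simps)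
  then have "of_nat k \<le> (1 + a) / b" "(1 + a) / b < of_nat k + 1" using b by (auto simp: field_simps)
  then show ?thesis by (simp add: farey_index_def floor_unique)
qed

lemma farey_map_triangle:
  assumes "z \<in> triangle"
  shows "farey_map z \<in> triangle" "farey_index z \<ge> 1"
proof -
  obtain x y where z: "z = (x, y)" by (cases z)
  have y: "x > 0" "y > 0" "y \<le> 1" "x \<le> 1" using triangle_pos assms unfolding z by (auto simp: triangle_def)
  define k where "k = \<lfloor>(1 + x) / y\<rfloor>"
  have "of_int k \<le> (1 + x) / y" "(1 + x) / y < of_int k + 1" unfolding k_def by linarith+
  then have "of_int k * y \<le> 1 + x" "1 + x < (of_int k + 1) * y" using y by (auto simp: field_simps)
  moreover have "farey_map z = (y, of_int k * y - x)" by (simp add: z farey_map_def farey_index_def k_def)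
  ultimately show "farey_map z \<in> triangle" using y by (auto simp: triangle_def algebra_simps)
  have "1 \<le> (1 + x) / y" using y by (simp add: field_simps)
  then show "farey_index z \<ge> 1" unfolding z farey_index_def by (simp add: le_floor_iff)
qed

lemma funpow_farey_map_triangle: "z \<in> triangle \<Longrightarrow> (farey_map ^^ j) z \<in> triangle"
  by (induction j) (auto simp: farey_map_triangle)

lemma idx_pos: "z \<in> triangle \<Longrightarrow> idx z j \<ge> 1"
  using farey_map_triangle(2)[OF funpow_farey_map_triangle[of z j]] unfolding idx_def by linarith

lemma funpow_farey_map:
  assumes "(x, y) \<in> triangle"
  shows "(farey_map ^^ j) (x, y) = (cont (idx (x, y)) x y j, cont (idx (x, y)) x y (Suc j))"
proof (induction j)
  case (Suc j)
  have "farey_index ((farey_map ^^ j) (x, y)) = int (idx (x, y) j)"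
    using farey_map_triangle(2)[OF funpow_farey_map_triangle[OF assms, of j]] unfolding idx_def by simp
  then show ?case using Suc by (simp add: farey_map_def)
qed simp

lemma mem_triangle_cell_iff_idx:
  "z \<in> cell n \<longleftrightarrow> z \<in> triangle \<and> n = map (idx z) [0..<length n]"
proof -
  have "(farey_map ^^ j) z \<in> triangle_piece (n ! j) \<longleftrightarrow> idx z j = n ! j" if "z \<in> triangle" for j
    using funpow_farey_map_triangle[OF that, of j] farey_map_triangle(2)[OF funpow_farey_map_triangle[OF that, of j]]
    unfolding triangle_piece_def idx_def by auto
  moreover have "n = map (idx z) [0..<length n] \<longleftrightarrow> (\<forall>j<length n. idx z j = n ! j)"
    by (subst list_eq_iff_nth_eq) auto
  ultimately show ?thesis unfolding triangle_cell_def by blast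
qed

text \<open>The right side does not mention the index: staying in the triangle forces it to be the
  entry of \<open>n\<close>, by \<open>farey_index_eq\<close>. The conditions are linear in
  \<open>(x, y)\<close>, which makes cells convex and Borel.\<close>

lemma mem_triangle_cell_iff_cont:
  "(x, y) \<in> cell n \<longleftrightarrow> (\<forall>j\<le>length n. (cont ((!) n) x y j, cont ((!) n) x y (Suc j)) \<in> triangle)"
proof
  assume z: "(x, y) \<in> cell n"
  then have T: "(x, y) \<in> triangle" and n: "n = map (idx (x, y)) [0..<length n]"
    unfolding mem_triangle_cell_iff_idx by auto
  have nj: "n ! i = idx (x, y) i" if "i < length n" for i
    using that arg_cong[OF n, of "\<lambda>l. l ! i"] by (simp del: nth_map add: nth_map[of _ "[0..<length n]"])
  show "\<forall>j\<le>length n. (cont ((!) n) x y j, cont ((!) n) x y (Suc j)) \<in> triangle"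
  proof (intro allI impI)
    fix j assume j: "j \<le> length n"
    have "cont ((!) n) x y j = cont (idx (x, y)) x y j" "cont ((!) n) x y (Suc j) = cont (idx (x, y)) x y (Suc j)"
      by (rule cont_cong, rule nj, use j in simp)+
    then show "(cont ((!) n) x y j, cont ((!) n) x y (Suc j)) \<in> triangle"
      using funpow_farey_map_triangle[OF T, of j] funpow_farey_map[OF T, of j] by simp
  qed
next
  assume A: "\<forall>j\<le>length n. (cont ((!) n) x y j, cont ((!) n) x y (Suc j)) \<in> triangle"
  have T: "(x, y) \<in> triangle" using A[rule_format, of 0] by simp
  have "j < length n \<Longrightarrow> idx (x, y) j = n ! j" for j
  proof (induction j rule: less_induct)
    case (less j)
    have "cont (idx (x, y)) x y j = cont ((!) n) x y j" "cont (idx (x, y)) x y (Suc j) = cont ((!) n) x y (Suc j)"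
      by (rule cont_cong, rule less.IH, use less.prems in simp_all)+
    then have "(farey_map ^^ j) (x, y) = (cont ((!) n) x y j, cont ((!) n) x y (Suc j))"
      using funpow_farey_map[OF T, of j] by simp
    moreover have "farey_index (cont ((!) n) x y j, cont ((!) n) x y (Suc j)) = int (n ! j)"
      using A[rule_format, of j] A[rule_format, of "Suc j"] less.prems by (intro farey_index_eq) auto
    ultimately show ?case unfolding idx_def by simp
  qed
  then show "(x, y) \<in> cell n" unfolding mem_triangle_cell_iff_idx using T
    by (intro conjI, simp) (subst list_eq_iff_nth_eq, simp)
qed

lemma triangle_borel [measurable]: "triangle \<in> sets borel"
proof -
  have "triangle = ({0..1} \<times> {0..1}) \<inter> {z. 1 < fst z + snd z}" by (auto simp: triangle_def)
  moreover have "closed ({0..1::real} \<times> {0..1::real})" by (intro closed_Times) auto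
  moreover have "open {z::real\<times>real. 1 < fst z + snd z}" by (intro open_Collect_less continuous_intros)
  ultimately show ?thesis by (metis borel_closed borel_open sets.Int)
qed

lemma convex_triangle: "convex triangle"
proof -
  have "triangle = ({0..1} \<times> {0..1}) \<inter> {z. inner (1, 1) z > 1}" by (auto simp: triangle_def)
  moreover have "convex \<dots>" by (intro convex_Int convex_Times convex_halfspace_gt) auto
  ultimately show ?thesis by simp
qed

lemma triangle_cell_vimage:
  "cell n = (\<Inter>j\<in>{..length n}. (\<lambda>z. (cont ((!) n) (fst z) (snd z) j, cont ((!) n) (fst z) (snd z) (Suc j))) -` triangle)"
  using mem_triangle_cell_iff_cont[of _ _ n] by auto

lemma triangle_cell_map:
  "(\<lambda>z::real\<times>real. (cont f (fst z) (snd z) j, cont f (fst z) (snd z) (Suc j))) =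
   (\<lambda>z. (cont f 1 0 j * fst z + cont f 0 1 j * snd z, cont f 1 0 (Suc j) * fst z + cont f 0 1 (Suc j) * snd z))"
  by (intro ext) (simp only: cont_linear[symmetric])

lemma triangle_cell_borel [measurable]: "cell n \<in> sets borel"
proof -
  have "(\<lambda>z::real\<times>real. (cont ((!) n) (fst z) (snd z) j, cont ((!) n) (fst z) (snd z) (Suc j))) \<in> borel_measurable borel" for j
    unfolding triangle_cell_map by (intro borel_measurable_continuous_onI continuous_intros)
  then have "(\<lambda>z::real\<times>real. (cont ((!) n) (fst z) (snd z) j, cont ((!) n) (fst z) (snd z) (Suc j))) -` triangle \<inter> space borel \<in> sets borel" for j
    by (rule measurable_sets) (rule triangle_borel)
  then show ?thesis unfolding triangle_cell_vimage by (intro sets.finite_INT) auto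
qed

lemma convex_triangle_cell: "convex (cell n)"
proof -
  have "linear (\<lambda>z::real\<times>real. (cont ((!) n) (fst z) (snd z) j, cont ((!) n) (fst z) (snd z) (Suc j)))" for j
    unfolding triangle_cell_map by (intro linearI) (auto simp: algebra_simps)
  then show ?thesis unfolding triangle_cell_vimage by (intro convex_INT convex_linear_vimage convex_triangle)
qed

lemma triangle_cell_subset: "cell n \<subseteq> triangle"
  by (auto simp: triangle_cell_def)

lemma fits_triangle_cell: "fits 1 (cell n)"
proof -
  have "cell n \<subseteq> {0..0+1} \<times> {0..0+1}" using triangle_cell_subset[of n] by (auto simp: triangle_def)
  then show ?thesis unfolding fits_def using triangle_cell_borel[of n] convex_triangle_cell[of n]
    by (intro conjI exI[of _ 0]) auto
qed

lemma fits_mono: "fits D C \<Longrightarrow> D \<le> D' \<Longrightarrow> fits D' C"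
proof -
  assume A: "fits D C" "D \<le> D'"
  then obtain x0 y0 where "C \<subseteq> {x0..x0+D} \<times> {y0..y0+D}" unfolding fits_def by auto
  then have "C \<subseteq> {x0..x0+D'} \<times> {y0..y0+D'}" using A(2) by force
  then show "fits D' C" using A unfolding fits_def by (intro conjI exI[of _ x0] exI[of _ y0]) auto
qed

text \<open>The function \<open>g\<close> lets the strip be slanted: a thin cell runs either along a
  horizontal line or along a diagonal.\<close>

lemma measure_strip_le:
  fixes C :: "(real \<times> real) set"
  assumes C: "C \<in> sets borel" "C \<subseteq> {(x, y). a \<le> x \<and> x \<le> a + D \<and> g x \<le> y \<and> y \<le> g x + h}" and "D \<ge> 0" "h \<ge> 0"
  shows "vol C \<le> D * h"
proof -
  have "emeasure lborel C = emeasure (lborel \<Otimes>\<^sub>M lborel) C" by (simp add: lborel_prod)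
  also have "\<dots> = (\<integral>\<^sup>+x. emeasure lborel (Pair x -` C) \<partial>lborel)"
    using C(1) by (intro lborel.emeasure_pair_measure_alt) (simp only: lborel_prod sets_lborel)
  also have "\<dots> \<le> (\<integral>\<^sup>+x. ennreal h * indicator {a..a+D} x \<partial>lborel)"
  proof (intro nn_integral_mono)
    fix x :: real
    show "emeasure lborel (Pair x -` C) \<le> ennreal h * indicator {a..a+D} x"
    proof (cases "x \<in> {a..a+D}")
      case True
      have "emeasure lborel (Pair x -` C) \<le> emeasure lborel {g x..g x + h}"
        using C(2) by (intro emeasure_mono) auto
      then show ?thesis using True assms by simp
    next
      case False
      then have "Pair x -` C = {}" using C(2) by auto
      then show ?thesis by simp
    qed
  qed
  also have "\<dots> = ennreal (D * h)" using assms by (simp add: nn_integral_cmult_indicator ennreal_mult' mult.commute)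
  finally show ?thesis unfolding measure_def using assms by (intro enn2real_leI) auto
qed

lemma measure_triangle: "vol triangle = 1 / 2"
proof -
  have "emeasure lborel triangle = emeasure (lborel \<Otimes>\<^sub>M lborel) triangle" by (simp add: lborel_prod)
  also have "\<dots> = (\<integral>\<^sup>+x. emeasure lborel (Pair x -` triangle) \<partial>lborel)"
    using triangle_borel by (intro lborel.emeasure_pair_measure_alt) (simp only: lborel_prod sets_lborel)
  also have "\<dots> = (\<integral>\<^sup>+x. ennreal x * indicator {0..1} x \<partial>lborel)"
  proof (intro nn_integral_cong)
    fix x :: real
    show "emeasure lborel (Pair x -` triangle) = ennreal x * indicator {0..1} x"
    proof (cases "x \<in> {0..1}")
      case True
      then have "Pair x -` triangle = {1-x<..1}" by (auto simp: triangle_def)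
      then show ?thesis using True by simp
    next
      case False
      then have "Pair x -` triangle = {}" by (auto simp: triangle_def)
      then show ?thesis using False by simp
    qed
  qed
  also have "\<dots> = ennreal (1^2/2 - 0^2/2)"
    by (rule nn_integral_FTC_Icc) (auto intro!: derivative_eq_intros)
  also have "1^2/2 - 0^2/2 = (1/2::real)" by simp
  finally show ?thesis by (intro measure_eq_emeasure_eq_ennreal) auto
qed

text \<open>Near a cusp the dynamics is rigid, so one large index determines all the others; the
  recurrence being symmetric, this also applies backwards.\<close>

lemma small_entry_forces:
  fixes t :: "nat \<Rightarrow> real" and f :: "nat \<Rightarrow> nat"
  assumes rec: "\<And>j. j < K \<Longrightarrow> t (Suc (Suc j)) = f j * t (Suc j) - t j"
    and le1: "\<And>j. j \<le> Suc K \<Longrightarrow> t j \<le> 1" and sum: "\<And>j. j \<le> K \<Longrightarrow> t j + t (Suc j) > 1"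
    and small: "0 < t 0" "(2 * K + 4) * t 0 \<le> 1"
  shows "j \<le> K \<Longrightarrow> (\<forall>i\<le>j. t (Suc i) = t 1 - i * t 0) \<and> (\<forall>i<j. f i = (if i = 0 then 1 else 2))"
proof (induction j)
  case (Suc j)
  define y where "y = t 0"
  define b where "b = t 1"
  have b: "1 - y < b" "b \<le> 1" using sum[of 0] le1[of 1] unfolding y_def b_def by auto
  note ih = Suc.IH[OF Suc_leD[OF Suc.prems]]
  have IH: "t (Suc i) = b - i * y" if "i \<le> j" for i
    using ih[THEN conjunct1, rule_format, OF that] unfolding y_def b_def .
  \<comment> \<open>From \<open>j < K\<close>. The slack excludes indices that are too large: an
    index 3 would need \<open>2 * (b - j * y) - y \<le> 1\<close> although
    \<open>b > 1 - y\<close>.\<close>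
  have jK: "(2 * real j + 6) * y \<le> 1"
  proof -
    have "(2 * real j + 6) * y \<le> (2 * real K + 4) * y" using Suc.prems small by (intro mult_right_mono) (auto simp: y_def)
    then show ?thesis using small unfolding y_def by linarith
  qed
  have y: "y > 0" using small unfolding y_def by simp
  have jy: "real j * y \<ge> 0" "2 * (real j * y) + 6 * y \<le> 1" using y jK by (auto simp: algebra_simps)
  have step: "t (Suc (Suc j)) = f j * t (Suc j) - t j" using rec[of j] Suc.prems by simp
  have up: "f j * t (Suc j) - t j \<le> 1" and lo: "(real (f j) + 1) * t (Suc j) - t j > 1"
    using le1[of "Suc (Suc j)"] sum[of "Suc j"] Suc.prems unfolding step by (auto simp: algebra_simps)
  have tSj: "t (Suc j) = b - j * y" using IH[of j] by simp
  have tpos: "t (Suc j) > 0" using tSj b jy y by linarith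
  have ge: "c * t (Suc j) \<le> f j * t (Suc j)" if "c \<le> real (f j)" for c
    using that tpos by (intro mult_right_mono) auto
  have le: "(real (f j) + 1) * t (Suc j) \<le> c * t (Suc j)" if "real (f j) + 1 \<le> c" for c
    using that tpos by (intro mult_right_mono) auto
  \<comment> \<open>The term after the small one is close to 1 and the sequence then falls by
    \<open>y\<close> at each step, so the first index is 1 and the later ones are 2.\<close>
  have main: "f j = (if j = 0 then 1 else 2) \<and> t (Suc (Suc j)) = b - Suc j * y"
  proof (cases j)
    case 0
    have t1: "t (Suc j) = b" "t j = y" using tSj 0 by (auto simp: y_def)
    have "\<not> 2 \<le> real (f j)"
    proof
      assume "2 \<le> real (f j)"
      from ge[OF this] up b jy y show False unfolding t1 by linarith
    qed
    moreover have "\<not> real (f j) + 1 \<le> 1"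
    proof
      assume "real (f j) + 1 \<le> 1"
      from le[OF this] lo b jy y show False unfolding t1 by simp
    qed
    ultimately have "f j = 1" by linarith
    then show ?thesis using step t1 0 by simp
  next
    case (Suc l)
    have "t j = b - real l * y" using IH[of l] Suc by simp
    then have tj: "t j = b - real j * y + y" using Suc by (simp add: algebra_simps)
    have "\<not> 3 \<le> real (f j)"
    proof
      assume "3 \<le> real (f j)"
      from ge[OF this] up b jy y tSj tj show False by linarith
    qed
    moreover have "\<not> real (f j) + 1 \<le> 2"
    proof
      assume "real (f j) + 1 \<le> 2"
      from le[OF this] lo b jy y tSj tj show False by linarith
    qed
    ultimately have "f j = 2" by linarith
    then show ?thesis using step tSj tj Suc by (simp add: algebra_simps)
  qed
  show ?case
  proof (intro conjI allI impI)
    fix i assume "i \<le> Suc j"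
    then show "t (Suc i) = t 1 - i * t 0" using IH[of i] main unfolding b_def y_def by (cases "i = Suc j") auto
  next
    fix i assume "i < Suc j"
    then show "f i = (if i = 0 then 1 else 2)" using ih[THEN conjunct2, rule_format, of i] main by (cases "i = j") auto
  qed
qed simp

lemma triangle_cell_cont_bounds:
  assumes "(x, y) \<in> cell n"
  shows "j \<le> Suc (length n) \<Longrightarrow> 0 < cont ((!) n) x y j \<and> cont ((!) n) x y j \<le> 1"
    and "j \<le> length n \<Longrightarrow> cont ((!) n) x y j + cont ((!) n) x y (Suc j) > 1"
proof -
  have T: "(cont ((!) n) x y j, cont ((!) n) x y (Suc j)) \<in> triangle" if "j \<le> length n" for j
    using assms that unfolding mem_triangle_cell_iff_cont by blast
  show "cont ((!) n) x y j + cont ((!) n) x y (Suc j) > 1" if "j \<le> length n"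
    using T[OF that] by (simp add: triangle_def)
  show "0 < cont ((!) n) x y j \<and> cont ((!) n) x y j \<le> 1" if "j \<le> Suc (length n)"
  proof (cases "j \<le> length n")
    case True
    then show ?thesis using T[OF True] triangle_pos[OF T[OF True]] by (simp add: triangle_def)
  next
    case False
    then have j: "j = Suc (length n)" using that by simp
    show ?thesis using T[of "length n"] triangle_pos[OF T[of "length n"]] unfolding j by (simp add: triangle_def)
  qed
qed

text \<open>Index times entry is the sum of the two neighbours. An index \<open>m\<close> thus
  confines its entry to \<open>(2/(m+2), 2/m]\<close>, an interval of length below
  \<open>4/m^2\<close>: the thin direction of the cell.\<close>

lemma cell_entry_bounds:
  assumes "(x, y) \<in> cell n" "i < length n"
  defines "s \<equiv> cont ((!) n) x y (Suc i)"
  shows "real (n ! i) * s \<le> 2" "(real (n ! i) + 2) * s > 2" "n ! i \<ge> 1"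
proof -
  let ?t = "cont ((!) n) x y"
  note b = triangle_cell_cont_bounds[OF assms(1)]
  have eq: "n ! i * s = ?t (Suc (Suc i)) + ?t i" unfolding s_def by simp
  have bb: "0 < ?t i" "?t i \<le> 1" "0 < ?t (Suc (Suc i))" "?t (Suc (Suc i)) \<le> 1" "?t i + s > 1" "s + ?t (Suc (Suc i)) > 1"
    using b(1)[of i] b(1)[of "Suc (Suc i)"] b(2)[of i] b(2)[of "Suc i"] assms(2) unfolding s_def by auto
  show "real (n ! i) * s \<le> 2" using eq bb by linarith
  show "(real (n ! i) + 2) * s > 2" using eq bb unfolding distrib_right by linarith
  have "n ! i \<noteq> 0"
  proof
    assume "n ! i = 0"
    then show False using eq bb by simp
  qed
  then show "n ! i \<ge> 1" by simp
qed

text \<open>The inserted 1 only matters for the empty list.\<close>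

definition max_index :: "nat list \<Rightarrow> nat" where
  "max_index n = Max (insert 1 (set n))"

lemma max_index_ge_1: "max_index n \<ge> 1"
  unfolding max_index_def by (rule Max_ge) auto

lemma max_index_cases: "max_index n = 1 \<or> (\<exists>i<length n. n ! i = max_index n)"
proof -
  have "max_index n \<in> insert 1 (set n)" unfolding max_index_def by (rule Max_in) auto
  then show ?thesis by (auto simp: in_set_conv_nth)
qed

lemma nth_le_max_index: "m \<in> set n \<Longrightarrow> m \<le> max_index n"
  unfolding max_index_def by (rule Max_ge) auto

text \<open>The entries in the orbit of a lattice point are positive multiples of
  \<open>1 / N\<close>, while an index times its entry is at most 2.\<close>

lemma max_index_le_scale:
  assumes N: "N > 0" and ne: "lattice_pts (cell n) N \<noteq> {}"
  shows "real (max_index n) \<le> 2 * N"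
proof -
  obtain a b :: int where ab: "(of_int a / N, of_int b / N) \<in> cell n"
    using ne unfolding lattice_pts_def by auto
  let ?t = "cont ((!) n) (of_int a / N) (of_int b / N)"
  note bd = triangle_cell_cont_bounds[OF ab] and en = cell_entry_bounds[OF ab]
  have int: "?t j = of_int (cont ((!) n) a b j) / N" for j
    using cont_scale[of "(!) n" "1/N" "of_int a" "of_int b" j] by (simp add: of_int_cont)
  have low: "1 \<le> N * ?t j" if "j \<le> Suc (length n)" for j
  proof -
    have "0 < ?t j" using bd(1)[OF that] by simp
    then have "0 < real_of_int (cont ((!) n) a b j)" using N unfolding int by (simp add: zero_less_divide_iff)
    then show ?thesis using N unfolding int by simp
  qed
  have N1: "N \<ge> 1"
  proof -
    have "N * ?t 0 \<le> N * 1" using bd(1)[of 0] N by (intro mult_left_mono) auto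
    then show ?thesis using low[of 0] by linarith
  qed
  show ?thesis
  proof (cases "max_index n = 1")
    case False
    then obtain i where i: "i < length n" "n ! i = max_index n" using max_index_cases[of n] by auto
    have "real (max_index n) * 1 \<le> real (max_index n) * (N * ?t (Suc i))" using low[of "Suc i"] i by (intro mult_left_mono) auto
    also have "\<dots> = N * (n ! i * ?t (Suc i))" using i(2) by simp
    also have "\<dots> \<le> N * 2" using en(1)[OF i(1)] N by (intro mult_left_mono) auto
    finally show ?thesis by simp
  qed (use N1 in simp)
qed

text \<open>A large index has a small entry \<open>s\<close>, and \<open>small_entry_forces\<close>
  applies from there in both directions, leaving only the pattern
  \<open>..., 2, 1, m, 1, 2, ...\<close>. The backward values also place \<open>x\<close> and
  \<open>y\<close> near 1, except that \<open>y\<close> is \<open>s\<close> itself when the large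
  index comes first.\<close>

lemma large_index_structure:
  assumes z: "(x, y) \<in> cell n" and i: "i < length n" and m: "n ! i \<ge> 4 * length n + 8"
  defines "s \<equiv> cont ((!) n) x y (Suc i)"
  shows "l < length n \<Longrightarrow> n ! l = (if l = i then n ! i else if l = Suc i \<or> Suc l = i then 1 else 2)"
    and "i = 0 \<Longrightarrow> y = s" "i > 0 \<Longrightarrow> y = x + s" "x \<ge> 1 - real (length n + 1) * s" "i > 0 \<Longrightarrow> y \<ge> 1 - real (length n + 1) * s"
proof -
  let ?t = "cont ((!) n) x y"
  define k where "k = length n"
  note bd = triangle_cell_cont_bounds[OF z] and en = cell_entry_bounds[OF z i]
  have s0: "s > 0" using bd(1)[of "Suc i"] i unfolding s_def by simp
  \<comment> \<open>The threshold \<open>4 * length n + 8\<close> is twice \<open>2 * k + 4\<close>,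
    and index times entry is at most 2.\<close>
  have ks: "(2 * real k + 4) * s \<le> 1"
  proof -
    have "(4 * real k + 8) * s \<le> n ! i * s" using m s0 unfolding k_def by (intro mult_right_mono) auto
    also have "\<dots> \<le> 2" using en(1) unfolding s_def .
    finally show ?thesis by (simp add: algebra_simps)
  qed
  have small: "(2 * real K + 4) * s \<le> 1" if "K \<le> k" for K
  proof -
    have "(2 * real K + 4) * s \<le> (2 * real k + 4) * s" using that s0 by (intro mult_right_mono) auto
    then show ?thesis using ks by simp
  qed
  have fwd: "\<forall>j<k - Suc i. n ! (Suc i + j) = (if j = 0 then 1 else 2)"
  proof -
    have "k - Suc i \<le> k - Suc i \<Longrightarrow> (\<forall>j\<le>k - Suc i. ?t (Suc i + Suc j) = ?t (Suc i + 1) - j * ?t (Suc i + 0)) \<and>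
        (\<forall>j<k - Suc i. n ! (Suc i + j) = (if j = 0 then 1 else 2))"
    proof (rule small_entry_forces[where t = "\<lambda>j. ?t (Suc i + j)" and f = "\<lambda>j. n ! (Suc i + j)"])
      show "?t (Suc i + Suc (Suc j)) = n ! (Suc i + j) * ?t (Suc i + Suc j) - ?t (Suc i + j)" for j by simp
      show "?t (Suc i + j) \<le> 1" if "j \<le> Suc (k - Suc i)" for j using bd(1)[of "Suc i + j"] that i unfolding k_def by simp
      show "1 < ?t (Suc i + j) + ?t (Suc i + Suc j)" if "j \<le> k - Suc i" for j
        using bd(2)[of "Suc i + j"] that i unfolding k_def by simp
      show "0 < ?t (Suc i + 0)" using s0 unfolding s_def by simp
      show "(2 * real (k - Suc i) + 4) * ?t (Suc i + 0) \<le> 1" using small[of "k - Suc i"] unfolding s_def by simp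
    qed
    then show ?thesis by blast
  qed
  have bwd: "(\<forall>j\<le>i. ?t (Suc i - Suc j) = ?t (Suc i - 1) - j * ?t (Suc i - 0)) \<and>
        (\<forall>j<i. n ! (i - Suc j) = (if j = 0 then 1 else 2))"
  proof -
    have "i \<le> i \<Longrightarrow> (\<forall>j\<le>i. ?t (Suc i - Suc j) = ?t (Suc i - 1) - j * ?t (Suc i - 0)) \<and>
        (\<forall>j<i. n ! (i - Suc j) = (if j = 0 then 1 else 2))"
    proof (rule small_entry_forces[where t = "\<lambda>j. ?t (Suc i - j)" and f = "\<lambda>j. n ! (i - Suc j)"])
      fix j assume "j < i"
      then obtain l where l: "i = Suc (j + l)" using less_imp_Suc_add by blast
      show "?t (Suc i - Suc (Suc j)) = n ! (i - Suc j) * ?t (Suc i - Suc j) - ?t (Suc i - j)"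
      proof -
        have "?t (Suc (Suc l)) = n ! l * ?t (Suc l) - ?t l" by simp
        moreover have "Suc i - Suc (Suc j) = l" "Suc i - Suc j = Suc l" "Suc i - j = Suc (Suc l)" "i - Suc j = l" using l by auto
        ultimately show ?thesis by (simp only:)
      qed
    next
      show "?t (Suc i - j) \<le> 1" for j using bd(1)[of "Suc i - j"] i by simp
      show "1 < ?t (Suc i - j) + ?t (Suc i - Suc j)" if "j \<le> i" for j
        using bd(2)[of "i - j"] that i by (simp add: Suc_diff_le add.commute)
      show "0 < ?t (Suc i - 0)" using s0 unfolding s_def by simp
      show "(2 * real i + 4) * ?t (Suc i - 0) \<le> 1" using small[of i] i unfolding s_def k_def by simp
    qed
    then show ?thesis by blast
  qed
  show "n ! l = (if l = i then n ! i else if l = Suc i \<or> Suc l = i then 1 else 2)" if "l < length n"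
  proof -
    consider "l = i" | "l > i" | "l < i" by linarith
    then show ?thesis
    proof cases
      case 2
      then have "n ! (Suc i + (l - Suc i)) = (if l - Suc i = 0 then 1 else 2)"
        using that by (intro fwd[rule_format]) (simp add: k_def)
      moreover have "Suc i + (l - Suc i) = l" using 2 by simp
      ultimately show ?thesis using 2 by (cases "l = Suc i") (simp_all only: if_True if_False, auto)
    next
      case 3
      then obtain j where j: "i = Suc (l + j)" using less_imp_Suc_add by blast
      then have "n ! (i - Suc j) = (if j = 0 then 1 else 2)"
        using bwd[THEN conjunct2, rule_format, of j] by simp
      moreover have "i - Suc j = l" using j by simp
      ultimately show ?thesis using j by auto
    qed simp
  qed
  have ti: "?t i > 1 - s" using bd(2)[of i] i unfolding s_def by simp
  have x: "x = ?t i - i * s"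
  proof -
    have "?t (Suc i - Suc i) = ?t (Suc i - 1) - i * ?t (Suc i - 0)"
      using bwd[THEN conjunct1] by blast
    then show ?thesis unfolding s_def by (simp only: diff_self_eq_0 diff_Suc_1 diff_zero cont.simps(1) minus_nat.diff_0)
  qed
  have is_le: "real (Suc i) * s \<le> real (length n + 1) * s" using s0 i by (intro mult_right_mono) auto
  show "x \<ge> 1 - real (length n + 1) * s" using x ti is_le by (simp add: algebra_simps)
  show "i = 0 \<Longrightarrow> y = s" unfolding s_def by simp
  have y: "y = ?t i - (real i - 1) * s" if "i > 0"
  proof -
    obtain l where l: "i = Suc l" using \<open>i > 0\<close> gr0_implies_Suc by blast
    have "l \<le> i" using l by simp
    then have "?t (Suc i - Suc l) = ?t (Suc i - 1) - l * ?t (Suc i - 0)"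
      using bwd[THEN conjunct1] by blast
    moreover have "Suc i - Suc l = Suc 0" using l by simp
    moreover have "real i - 1 = real l" using l by simp
    ultimately show ?thesis unfolding s_def by (simp only: diff_Suc_1 diff_zero cont.simps(2) minus_nat.diff_0)
  qed
  show yx: "y = x + s" if "i > 0" using x y[OF that] by (simp add: algebra_simps)
  show "y \<ge> 1 - real (length n + 1) * s" if "i > 0"
    using yx[OF that] \<open>x \<ge> 1 - real (length n + 1) * s\<close> s0 by simp
qed

text \<open>\<open>x\<close> stays within \<open>D\<close> of 1, while \<open>y\<close> or
  \<open>y - x\<close> equals \<open>s\<close>, which ranges over an interval of length at most
  \<open>4 / M^2\<close>: a strip of length \<open>O(1/M)\<close> and thickness
  \<open>O(1/M^2)\<close>.\<close>

lemma large_index_cell: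
  assumes i: "i < length n" and m: "n ! i \<ge> 4 * length n + 8"
  shows "fits (2 * (length n + 1) / real (n ! i)) (cell n)"
    "vol (cell n) \<le> 8 * (length n + 1) / real (n ! i) ^ 3"
proof -
  define M where "M = real (n ! i)"
  define D where "D = 2 * (length n + 1) / M"
  have M: "M > 0" using m unfolding M_def by simp
  have D: "D \<ge> 0" using M unfolding D_def by simp
  have pt: "x \<in> {1-D..1} \<and> (i = 0 \<longrightarrow> y \<in> {0..D} \<and> y \<in> {2/(M+2)..2/(M+2) + 4 / M^2}) \<and>
      (i > 0 \<longrightarrow> y \<in> {1-D..1} \<and> y \<in> {x + 2/(M+2)..x + 2/(M+2) + 4 / M^2})"
    if z: "(x, y) \<in> cell n" for x y
  proof -
    define s where "s = cont ((!) n) x y (Suc i)"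
    note st = large_index_structure[OF z i m, folded s_def]
    have xy: "0 \<le> x" "x \<le> 1" "0 \<le> y" "y \<le> 1" using z triangle_cell_subset[of n] by (auto simp: triangle_def)
    have s0: "s > 0" using triangle_cell_cont_bounds(1)[OF z, of "Suc i"] i unfolding s_def by simp
    have s: "M * s \<le> 2" "(M + 2) * s > 2" using cell_entry_bounds[OF z i] unfolding s_def M_def by auto
    then have s1: "s \<le> 2 / M" "s \<ge> 2 / (M + 2)" using M by (simp_all add: pos_le_divide_eq pos_divide_le_eq mult.commute)
    have "2 / M - 2 / (M + 2) = 4 / (M * (M + 2))" using M by (simp add: field_simps)
    also have "\<dots> \<le> 4 / M^2" using M by (intro divide_left_mono) (simp_all add: power2_eq_square distrib_left add_pos_pos)
    finally have s2: "s \<le> 2 / (M + 2) + 4 / M^2" using s1 by linarith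
    have "real (length n + 1) * s \<le> real (length n + 1) * (2 / M)" using s1 by (intro mult_left_mono) auto
    then have sD: "real (length n + 1) * s \<le> D" unfolding D_def by (simp add: algebra_simps)
    have "1 * s \<le> real (length n + 1) * s" using s0 by (intro mult_right_mono) auto
    then have "s \<le> D" using sD by simp
    then have sD': "s \<le> D" .
    have xD: "1 - D \<le> x" using st(4) sD by linarith
    show ?thesis
    proof (cases "i = 0")
      case True
      have "y = s" using st(2)[OF True] .
      then have "0 \<le> y" "y \<le> D" "2/(M+2) \<le> y" "y \<le> 2/(M+2) + 4 / M^2" using s0 sD' s1 s2 by linarith+
      with True xD xy show ?thesis by (simp del: times_divide_eq_right)
    next
      case False
      then have i0: "i > 0" by simp
      have "1 - D \<le> y" "x + 2/(M+2) \<le> y" "y \<le> x + 2/(M+2) + 4 / M^2"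
        using st(3)[OF i0] st(5)[OF i0] sD s1 s2 by linarith+
      with i0 xD xy show ?thesis by simp
    qed
  qed
  show "fits (2 * (length n + 1) / real (n ! i)) (cell n)"
  proof -
    define y0 where "y0 = (if i = 0 then 0 else 1 - D)"
    have "cell n \<subseteq> {1-D..1-D+D} \<times> {y0..y0+D}"
    proof
      fix z assume z: "z \<in> cell n"
      obtain x y where xy: "z = (x, y)" by (cases z)
      show "z \<in> {1-D..1-D+D} \<times> {y0..y0+D}" using pt[of x y] z unfolding xy y0_def by (cases "i = 0") simp_all
    qed
    then have "fits D (cell n)"
      unfolding fits_def using triangle_cell_borel[of n] convex_triangle_cell[of n] D by (intro conjI exI[of _ "1 - D"] exI[of _ y0])
    then show ?thesis unfolding D_def M_def .
  qed
  have "vol (cell n) \<le> D * (4 / M^2)"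
  proof (rule measure_strip_le[where a = "1 - D" and g = "\<lambda>x. (if i = 0 then 0 else x) + 2/(M+2)"])
    show "cell n \<subseteq> {(x, y). 1 - D \<le> x \<and> x \<le> 1 - D + D \<and> (if i = 0 then 0 else x) + 2/(M+2) \<le> y \<and> y \<le> (if i = 0 then 0 else x) + 2/(M+2) + 4 / M^2}"
    proof
      fix z assume z: "z \<in> cell n"
      obtain x y where xy: "z = (x, y)" by (cases z)
      show "z \<in> {(x, y). 1 - D \<le> x \<and> x \<le> 1 - D + D \<and> (if i = 0 then 0 else x) + 2/(M+2) \<le> y \<and> y \<le> (if i = 0 then 0 else x) + 2/(M+2) + 4 / M^2}"
        using pt[of x y] z unfolding xy by (cases "i = 0") simp_all
    qed
  qed (use D in auto)
  also have "\<dots> = 8 * (length n + 1) / M ^ 3" unfolding D_def by (simp add: power2_eq_square power3_eq_cube)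
  finally show "vol (cell n) \<le> 8 * (length n + 1) / real (n ! i) ^ 3" unfolding M_def .
qed

lemma triangle_fmeasurable: "triangle \<in> fmeasurable lborel"
proof -
  have "bounded triangle"
    by (rule bounded_subset[OF bounded_cbox[of "(0, 0)" "(1, 1)"]]) (auto simp: triangle_def cbox_Pair_eq)
  then show ?thesis unfolding fmeasurable_def using emeasure_bounded_finite by simp
qed

lemma measure_triangle_cell_le: "vol (cell n) \<le> 1 / 2"
proof -
  have "vol (cell n) \<le> vol triangle"
    using triangle_cell_subset triangle_fmeasurable by (intro measure_mono_fmeasurable) auto
  then show ?thesis by (simp add: measure_triangle)
qed

text \<open>One constant serves for diameter, area and, in \<open>triangle_cell_count\<close>, the
  number of cells. Above the threshold it dominates the bounds of \<open>large_index_cell\<close>;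
  below it, \<open>c k / M ^ 3\<close> is at least 1 and the estimates are trivial.\<close>

lemma triangle_cell_geometry:
  defines "c \<equiv> \<lambda>k::nat. real ((4 * k + 9) ^ (k + 3))"
  assumes k: "length n = k"
  shows "fits (c k / max_index n) (cell n)"
    "vol (cell n) \<le> c k / real (max_index n) ^ 3"
proof -
  define M where "M = real (max_index n)"
  have M1: "M \<ge> 1" using max_index_ge_1[of n] unfolding M_def by simp
  have c: "c k \<ge> (4 * k + 9) ^ 3" unfolding c_def of_nat_le_iff by (rule power_increasing) auto
  have c1: "real ((4 * k + 9) ^ 3) \<ge> 8 * (k + 1)"
  proof -
    have "8 * (k + 1) \<le> (4 * k + 9) * (4 * k + 9) ^ 2" by (simp add: power2_eq_square algebra_simps)
    also have "\<dots> = (4 * k + 9) ^ 3" by (simp add: power2_eq_square power3_eq_cube)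
    finally show ?thesis by (simp only: of_nat_le_iff)
  qed
  have "fits (c k / M) (cell n) \<and> vol (cell n) \<le> c k / M ^ 3"
  proof (cases "max_index n \<ge> 4 * k + 8")
    case True
    then have "max_index n \<noteq> 1" by auto
    then obtain i where i: "i < length n" "n ! i = max_index n" using max_index_cases[of n] by auto
    note L = large_index_cell[OF i(1), unfolded i(2) k, OF True, folded M_def]
    have "2 * (k + 1) \<le> c k" using c c1 by linarith
    then have D: "real (2 * (k + 1)) / M \<le> c k / M" using M1 by (intro divide_right_mono) auto
    moreover have "8 * (k + 1) / M ^ 3 \<le> c k / M ^ 3" using c c1 M1 by (intro divide_right_mono) auto
    ultimately show ?thesis using fits_mono[OF L(1) D] L(2) by simp
  next
    case False
    then have M: "M \<le> 4 * k + 9" unfolding M_def by simp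
    have M3: "M ^ 3 \<le> c k"
    proof -
      have "M ^ 3 \<le> real (4 * k + 9) ^ 3" using M M1 by (intro power_mono) auto
      then show ?thesis using c by simp
    qed
    have "M ^ 1 \<le> M ^ 3" using M1 by (intro power_increasing) auto
    then have "M \<le> c k" using M3 by simp
    then have "1 \<le> c k / M" "1 \<le> c k / M ^ 3" using M1 M3 by auto
    then show ?thesis using fits_mono[OF fits_triangle_cell[of n]] measure_triangle_cell_le[of n] by auto
  qed
  then show "fits (c k / max_index n) (cell n)"
    "vol (cell n) \<le> c k / real (max_index n) ^ 3" unfolding M_def by auto
qed

lemma triangle_cell_count:
  shows "finite {n. length n = k \<and> max_index n = m \<and> cell n \<noteq> {}}" (is "finite ?S")
    "card {n. length n = k \<and> max_index n = m \<and> cell n \<noteq> {}} \<le> (4 * k + 9) ^ (k + 3)"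
proof -
  have sub: "?S \<subseteq> {n. set n \<subseteq> {..m} \<and> length n = k}" using nth_le_max_index by auto
  show fin: "finite ?S" by (rule finite_subset[OF sub]) (rule finite_lists_length_eq, simp)
  show "card ?S \<le> (4 * k + 9) ^ (k + 3)"
  proof (cases "m \<ge> 4 * k + 8")
    case False
    have "card ?S \<le> card {n. set n \<subseteq> {..m} \<and> length n = k}" by (rule card_mono[OF _ sub]) (rule finite_lists_length_eq, simp)
    also have "\<dots> = Suc m ^ k" by (subst card_lists_length_eq) auto
    also have "\<dots> \<le> (4 * k + 9) ^ k" using False by (intro power_mono) auto
    also have "\<dots> \<le> (4 * k + 9) ^ (k + 3)" by (intro power_increasing) auto
    finally show ?thesis .
  next
    case True
    \<comment> \<open>The position of the large index determines the whole list, so there are at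
      most \<open>k\<close> lists.\<close>
    let ?g = "\<lambda>i m l. if l = i then m else if l = Suc i \<or> Suc l = i then 1 else 2"
    have "?S \<subseteq> (\<lambda>i. map (?g i m) [0..<k]) ` {..<k}"
    proof
      fix n assume n: "n \<in> ?S"
      then have "max_index n \<noteq> 1" using True by auto
      then obtain i where i: "i < length n" "n ! i = max_index n" using max_index_cases[of n] by auto
      obtain x y where z: "(x, y) \<in> cell n" using n by auto
      have mi: "n ! i \<ge> 4 * length n + 8" using True i n by simp
      have "n = map (?g i (max_index n)) [0..<k]"
      proof (rule nth_equalityI)
        fix l assume l: "l < length n"
        show "n ! l = map (?g i (max_index n)) [0..<k] ! l"
          using large_index_structure(1)[OF z i(1) mi l] l n unfolding i(2) by simp
      qed (use n in simp)
      moreover have "max_index n = m" using n by simp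
      ultimately have "n = map (?g i m) [0..<k]" by (simp only:)
      then show "n \<in> (\<lambda>i. map (?g i m) [0..<k]) ` {..<k}"
        using i(1) n by (intro image_eqI[where x = i]) (assumption, simp)
    qed
    then have "card ?S \<le> card {..<k}" using surj_card_le[of "{..<k}"] by blast
    also have "\<dots> \<le> (4 * k + 9) ^ 1" by simp
    also have "\<dots> \<le> (4 * k + 9) ^ (k + 3)" by (intro power_increasing) auto
    finally show ?thesis .
  qed
qed

section \<open>Consecutive Farey fractions\<close>

lemma rden_pos: "rden x > 0"
  unfolding rden_def using quotient_of_denom_pos' by blast

lemma coprime_rnum_rden: "coprime (rnum x) (rden x)"
  unfolding rnum_def rden_def using quotient_of_coprime[of x "fst (quotient_of x)" "snd (quotient_of x)"] by simp

lemma rat_eq_rnum_rden: "x = of_int (rnum x) / of_int (rden x)"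
  unfolding rnum_def rden_def using quotient_of_div[of x "fst (quotient_of x)" "snd (quotient_of x)"] by simp

lemma rnum_rden_of_coprime:
  assumes "q > 0" "coprime a q"
  shows "rnum (of_int a / of_int q) = a" "rden (of_int a / of_int q) = q"
proof -
  have "quotient_of (of_int a / of_int q) = (a, q)"
    using assms by (simp add: Fract_of_int_quotient[symmetric] quotient_of_Fract normalize_stable)
  then show "rnum (of_int a / of_int q) = a" "rden (of_int a / of_int q) = q" unfolding rnum_def rden_def by auto
qed

lemma of_int_divide_less_iff:
  fixes a b q s :: int
  assumes "q > 0" "s > 0"
  shows "(of_int a / of_int q :: rat) < of_int b / of_int s \<longleftrightarrow> a * s < b * q"
proof -
  have "(of_int a / of_int q :: rat) < of_int b / of_int s \<longleftrightarrow> (of_int a * of_int s :: rat) < of_int b * of_int q"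
    using assms by (simp add: divide_less_eq less_divide_eq mult.commute)
  also have "\<dots> \<longleftrightarrow> a * s < b * q" by (simp only: of_int_mult[symmetric] of_int_less_iff)
  finally show ?thesis .
qed

text \<open>Two positive determinants are at least 1, and \<open>s\<close> is their combination with
  coefficients \<open>q\<close> and \<open>q'\<close>. So nothing with denominator at most
  \<open>Q\<close> lies between when \<open>q + q' > Q\<close>.\<close>

lemma farey_pair_between:
  fixes a q a' q' b s :: int
  assumes "q * a' - a * q' = 1" "q > 0" "q' > 0" "s > 0"
    and "(of_int a / of_int q :: rat) < of_int b / of_int s" "(of_int b / of_int s :: rat) < of_int a' / of_int q'"
  shows "s \<ge> q + q'"
proof -
  have 1: "b * q - a * s \<ge> 1" "a' * s - b * q' \<ge> 1" using assms by (simp_all add: of_int_divide_less_iff)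
  have "s = s * (q * a' - a * q')" using assms by simp
  also have "\<dots> = q * (a' * s - b * q') + q' * (b * q - a * s)" by (simp add: algebra_simps)
  also have "\<dots> \<ge> q * 1 + q' * 1" using 1 assms by (intro add_mono mult_left_mono) auto
  finally show ?thesis by simp
qed

section \<open>Orbits of coprime pairs as increasing lists of fractions\<close>

definition farey_pairs :: "nat \<Rightarrow> (int \<times> int) set" where
  "farey_pairs Q = {(q, q'). 1 \<le> q \<and> q \<le> int Q \<and> 1 \<le> q' \<and> q' \<le> int Q \<and> int Q < q + q' \<and> coprime q q'}"

definition scaled :: "nat \<Rightarrow> int \<times> int \<Rightarrow> real \<times> real" where
  "scaled Q z = (of_int (fst z) / real Q, of_int (snd z) / real Q)"

definition dens :: "nat \<Rightarrow> int \<times> int \<Rightarrow> nat \<Rightarrow> int" where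
  "dens Q z j = cont (idx (scaled Q z)) (fst z) (snd z) j"

text \<open>The fractions beyond 1 are kept: the orbit is continued periodically, and at most
  \<open>H\<close> tuples run over the end of the unit interval.\<close>

definition good :: "nat \<Rightarrow> nat \<Rightarrow> int \<times> int \<Rightarrow> nat set" where
  "good Q p z = {j. \<not> int p dvd dens Q z j}"

text \<open>The determinant of two consecutive surviving fractions, read off the indices; see
  \<open>det_gap\<close>.\<close>

definition gap :: "nat \<Rightarrow> nat \<Rightarrow> int \<times> int \<Rightarrow> nat \<Rightarrow> nat" where
  "gap Q p z h = (if enumerate (good Q p z) (Suc h) = Suc (enumerate (good Q p z) h) then 1
     else idx (scaled Q z) (enumerate (good Q p z) h))"

lemma scaled_triangle: "z \<in> farey_pairs Q \<Longrightarrow> scaled Q z \<in> triangle"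
proof -
  assume z: "z \<in> farey_pairs Q"
  have Q: "real Q > 0" using z by (auto simp: farey_pairs_def)
  have "int Q < fst z + snd z" using z by (auto simp: farey_pairs_def)
  then have "real_of_int (int Q) < real_of_int (fst z + snd z)" by (simp only: of_int_less_iff)
  then have "real_of_int (fst z) + real_of_int (snd z) > real Q" by simp
  then have "1 < real_of_int (fst z) / real Q + real_of_int (snd z) / real Q"
    using Q by (simp add: add_divide_distrib[symmetric] less_divide_eq)
  then show "scaled Q z \<in> triangle" using z Q unfolding farey_pairs_def triangle_def scaled_def
    by (auto simp: divide_le_eq)
qed

lemma dens_bounds:
  assumes z: "z \<in> farey_pairs Q"
  shows "1 \<le> dens Q z j" "dens Q z j \<le> int Q" "int Q < dens Q z j + dens Q z (Suc j)"
proof -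
  have Q: "real Q > 0" using z by (auto simp: farey_pairs_def)
  define t where "t j = cont (idx (scaled Q z)) (fst (scaled Q z)) (snd (scaled Q z)) j" for j
  have eq: "real_of_int (dens Q z j) = real Q * t j" for j
    unfolding dens_def t_def of_int_cont cont_scale[symmetric] scaled_def using Q by simp
  have T: "(t j, t (Suc j)) \<in> triangle" for j
    using funpow_farey_map_triangle[OF scaled_triangle[OF z], of j]
      funpow_farey_map[of "fst (scaled Q z)" "snd (scaled Q z)" j] scaled_triangle[OF z] unfolding t_def by simp
  have "t j > 0" "t j \<le> 1" "1 < t j + t (Suc j)" using T[of j] triangle_pos[OF T[of j]] by (auto simp: triangle_def)
  then have "real_of_int (dens Q z j) > 0" "real_of_int (dens Q z j) \<le> real Q * 1"
    "real Q * 1 < real Q * (t j + t (Suc j))"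
    unfolding eq using Q by (auto intro: mult_left_mono)
  then have "real_of_int (dens Q z j) > 0" "real_of_int (dens Q z j) \<le> real_of_int (int Q)"
    "real_of_int (int Q) < real_of_int (dens Q z j + dens Q z (Suc j))" by (auto simp: eq distrib_left)
  then show "1 \<le> dens Q z j" "dens Q z j \<le> int Q" "int Q < dens Q z j + dens Q z (Suc j)"
    by (simp_all only: of_int_less_iff of_int_le_iff of_int_0_less_iff)
qed

text \<open>\<open>a\<close> and \<open>a'\<close> are the numerators over the denominators in
  \<open>z\<close>. \<open>X\<close> lists the fractions from the first one on and \<open>Y\<close>
  those with denominator prime to \<open>p\<close>; by \<open>np\<close> both lists start with the
  same fraction.\<close>

locale farey_orbit =
  fixes Q p :: nat and a a' :: int and z :: "int \<times> int"
  assumes z: "z \<in> farey_pairs Q" and det: "fst z * a' - a * snd z = 1" and a: "a \<ge> 0"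
    and p: "prime p" and np: "\<not> int p dvd fst z"
begin

abbreviation "f \<equiv> idx (scaled Q z)"
abbreviation "den \<equiv> dens Q z"
definition "num j = cont f a a' j"
definition "X j = (of_int (num j) / of_int (den j) :: rat)"
abbreviation "r \<equiv> enumerate (good Q p z)"
definition "Y h = X (r h)"

lemma den_pos: "den j > 0" using dens_bounds(1)[OF z, of j] by simp

lemma det_step: "den j * num (Suc j) - num j * den (Suc j) = 1"
  unfolding dens_def num_def cont_det using det .

lemma coprime_num_den: "coprime (num j) (den j)"
proof (rule coprimeI)
  fix d assume "d dvd num j" "d dvd den j"
  then have "d dvd den j * num (Suc j) - num j * den (Suc j)" by auto
  then show "is_unit d" unfolding det_step .
qed

lemma coprime_den: "coprime (den j) (den (Suc j))"
proof (rule coprimeI)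
  fix d assume "d dvd den j" "d dvd den (Suc j)"
  then have "d dvd den j * num (Suc j) - num j * den (Suc j)" by auto
  then show "is_unit d" unfolding det_step .
qed

lemma X_less: "X j < X (Suc j)"
  unfolding X_def of_int_divide_less_iff[OF den_pos den_pos] using det_step[of j] by (simp add: mult.commute)

lemma strict_mono_X: "strict_mono X"
  using X_less by (simp add: strict_mono_Suc_iff)

lemma rden_X: "rden (X j) = den j" "rnum (X j) = num j"
  unfolding X_def using rnum_rden_of_coprime[OF den_pos coprime_num_den] by auto

lemma X_nonneg: "0 \<le> X j"
proof -
  have "0 \<le> X 0" unfolding X_def num_def using a den_pos[of 0] by (simp add: zero_le_divide_iff)
  also have "\<dots> \<le> X j" using strict_mono_X by (simp add: strict_mono_less_eq)
  finally show ?thesis .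
qed

lemma X_farey: "X j \<le> 1 \<Longrightarrow> X j \<in> farey Q"
  unfolding farey_def using X_nonneg[of j] dens_bounds(2)[OF z, of j] by (simp add: rden_X)

lemma no_farey_between:
  assumes "y \<in> farey Q" "X j < y" "y < X (Suc j)"
  shows False
proof -
  have "rden y \<ge> den j + den (Suc j)"
    using assms(2,3) rat_eq_rnum_rden[of y] unfolding X_def
    by (intro farey_pair_between[OF det_step den_pos den_pos rden_pos, of _ "rnum y"]) auto
  then show False using assms(1) dens_bounds(3)[OF z, of j] unfolding farey_def by simp
qed

lemma good_or: "j \<in> good Q p z \<or> Suc j \<in> good Q p z"
proof (rule ccontr)
  assume "\<not> ?thesis"
  then have "int p dvd den j" "int p dvd den (Suc j)" unfolding good_def by auto
  then have "is_unit (int p)" using coprime_den[of j] coprime_common_divisor by blast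
  then show False using p not_prime_unit by fastforce
qed

lemma infinite_good: "infinite (good Q p z)"
  unfolding infinite_nat_iff_unbounded_le using good_or by (meson le_SucI order_refl)

lemma r_good: "r h \<in> good Q p z"
  using enumerate_in_set[OF infinite_good] .

lemma r_0: "r 0 = 0"
proof -
  have "0 \<in> good Q p z" unfolding good_def dens_def using np by simp
  then show ?thesis unfolding enumerate_0 by (rule Least_eq_0)
qed

text \<open>Neighbouring denominators are coprime, so \<open>p\<close> never divides two in a row
  and at most one fraction is skipped at a time.\<close>

lemma r_Suc: "r (Suc h) = Suc (r h) \<or> (r (Suc h) = Suc (Suc (r h)) \<and> Suc (r h) \<notin> good Q p z)"
proof -
  have L: "r (Suc h) = (LEAST s. s \<in> good Q p z \<and> r h < s)" using enumerate_Suc''[OF infinite_good] by simp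
  show ?thesis
  proof (cases "Suc (r h) \<in> good Q p z")
    case True
    have "r (Suc h) = Suc (r h)" unfolding L by (rule Least_equality) (use True in auto)
    then show ?thesis by simp
  next
    case False
    then have g: "Suc (Suc (r h)) \<in> good Q p z" using good_or by blast
    have "r (Suc h) = Suc (Suc (r h))" unfolding L
    proof (rule Least_equality)
      fix y assume y: "y \<in> good Q p z \<and> r h < y"
      then have "y \<noteq> Suc (r h)" using False by auto
      then show "Suc (Suc (r h)) \<le> y" using y by simp
    qed (use g in simp)
    then show ?thesis using False by simp
  qed
qed

text \<open>The recurrence expresses the fraction after next through the next one, which contributes
  the index times 1, and the present one, which contributes nothing. Hence skipping a fraction
  replaces the determinant 1 by the index.\<close>

lemma det_gap: "den (r h) * num (r (Suc h)) - num (r h) * den (r (Suc h)) = int (gap Q p z h)"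
proof (cases "r (Suc h) = Suc (r h)")
  case True
  then show ?thesis unfolding gap_def using det_step by simp
next
  case False
  then have e: "r (Suc h) = Suc (Suc (r h))" using r_Suc[of h] by simp
  define j where "j = r h"
  have "den j * num (Suc (Suc j)) - num j * den (Suc (Suc j)) = int (f j) * (den j * num (Suc j) - num j * den (Suc j))"
    unfolding dens_def num_def by (simp add: algebra_simps)
  then show ?thesis using False unfolding gap_def e det_step j_def by simp
qed

lemma Y_less: "Y h < Y (Suc h)"
  unfolding Y_def using strict_mono_X enumerate_step[OF infinite_good, of h] by (simp add: strict_mono_less)

lemma strict_mono_Y: "strict_mono Y"
  using Y_less by (simp add: strict_mono_Suc_iff)

lemma Y_farey: "Y h \<le> 1 \<Longrightarrow> Y h \<in> farey_coprime Q p"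
  unfolding farey_coprime_def Y_def using X_farey r_good[of h] by (simp add: rden_X good_def)

lemma no_farey_coprime_between:
  assumes y: "y \<in> farey_coprime Q p" "Y h < y" "y < Y (Suc h)"
  shows False
proof (cases "r (Suc h) = Suc (r h)")
  case True
  then show False using no_farey_between[of y "r h"] y unfolding Y_def farey_coprime_def by simp
next
  case False
  then have e: "r (Suc h) = Suc (Suc (r h))" "Suc (r h) \<notin> good Q p z" using r_Suc[of h] by auto
  have "y \<noteq> X (Suc (r h))" using e(2) y(1) unfolding farey_coprime_def good_def by (auto simp: rden_X)
  then consider "y < X (Suc (r h))" | "y > X (Suc (r h))" by linarith
  then show False
    by cases (use no_farey_between[of y "r h"] no_farey_between[of y "Suc (r h)"] y e(1) in \<open>auto simp: Y_def farey_coprime_def\<close>)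
qed

lemma consecutive_eq_Y:
  assumes "consecutive_in (farey_coprime Q p) (Y h) w"
  shows "w = Y (Suc h)"
proof -
  have w: "w \<in> farey_coprime Q p" "Y h < w" "\<And>u. u \<in> farey_coprime Q p \<Longrightarrow> Y h < u \<Longrightarrow> \<not> u < w"
    using assms unfolding consecutive_in_def by auto
  have "\<not> w < Y (Suc h)" using no_farey_coprime_between[OF w(1,2)] by blast
  moreover have "\<not> Y (Suc h) < w"
  proof
    assume lt: "Y (Suc h) < w"
    have "w \<le> 1" using w(1) by (simp add: farey_coprime_def farey_def)
    then have "Y (Suc h) \<in> farey_coprime Q p" using lt by (intro Y_farey) simp
    then show False using w(3) Y_less lt by blast
  qed
  ultimately show ?thesis by simp
qed

lemma consecutive_Y:
  assumes "Y (Suc h) \<le> 1"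
  shows "consecutive_in (farey_coprime Q p) (Y h) (Y (Suc h))"
proof -
  have "Y h \<le> 1" using Y_less[of h] assms by simp
  then show ?thesis unfolding consecutive_in_def
    using Y_farey[of h] Y_farey[of "Suc h"] assms Y_less[of h] no_farey_coprime_between[of _ h] by blast
qed

lemma tuple_eq_Y:
  assumes "xs ! 0 = X 0" "\<And>h. h < H \<Longrightarrow> consecutive_in (farey_coprime Q p) (xs ! h) (xs ! (h + 1))"
  shows "h \<le> H \<Longrightarrow> xs ! h = Y h"
proof (induction h)
  case 0
  then show ?case using assms(1) by (simp add: Y_def r_0)
next
  case (Suc h)
  then show ?case using assms(2)[of h] consecutive_eq_Y[of h "xs ! Suc h"] by simp
qed

text \<open>If the list has passed 1 at position \<open>H\<close>, few elements remain above its
  start; this bounds the number of pairs whose tuple would run over the end.\<close>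

lemma farey_coprime_above:
  assumes "1 < Y H"
  shows "{y \<in> farey_coprime Q p. X 0 < y} \<subseteq> Y ` {1..<H}"
proof
  fix y assume y: "y \<in> {y \<in> farey_coprime Q p. X 0 < y}"
  then have "y \<le> 1" by (simp add: farey_coprime_def farey_def)
  define h where "h = (LEAST h. y < Y h)"
  have "y < Y H" using assms \<open>y \<le> 1\<close> by simp
  then have h: "y < Y h" "h \<le> H" "\<And>i. i < h \<Longrightarrow> \<not> y < Y i" unfolding h_def by (auto intro: LeastI Least_le dest: not_less_Least)
  have Y0: "Y 0 = X 0" by (simp add: Y_def r_0)
  then have "h \<noteq> 0" using h(1) y by (metis (mono_tags, lifting) mem_Collect_eq order_less_asym)
  then obtain i where i: "h = Suc i" using not0_implies_Suc by blast
  have "\<not> Y i < y" using no_farey_coprime_between[of y i] y h(1) i by blast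
  then have "y = Y i" using h(3)[of i] i by simp
  moreover have "i \<noteq> 0" using y Y0 \<open>y = Y i\<close> by (intro notI) simp
  ultimately show "y \<in> Y ` {1..<H}" using h(2) i by auto
qed

end

section \<open>Farey fractions below 1 as coprime pairs\<close>

definition succ_den :: "nat \<Rightarrow> rat \<Rightarrow> int" where
  "succ_den Q x = (SOME q'. int Q - rden x < q' \<and> q' \<le> int Q \<and> rden x dvd rnum x * q' + 1)"

definition pair_of :: "nat \<Rightarrow> rat \<Rightarrow> int \<times> int" where
  "pair_of Q x = (rden x, succ_den Q x)"

text \<open>The relation \<open>q * a' - a * q' = 1\<close> with the right neighbour is a congruence
  for \<open>q'\<close> modulo \<open>q\<close>, and the \<open>q\<close> integers in
  \<open>(Q - q, Q]\<close> meet each class once.\<close>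

lemma succ_den:
  shows "int Q - rden x < succ_den Q x" "succ_den Q x \<le> int Q" "rden x dvd rnum x * succ_den Q x + 1"
proof -
  define q a where "q = rden x" and "a = rnum x"
  have q: "q > 0" "coprime a q" unfolding q_def a_def using rden_pos coprime_rnum_rden by auto
  obtain r where r: "[a * r = 1] (mod q)" using cong_solve_coprime_int[OF q(2)] by blast
  \<comment> \<open>Congruent to \<open>- r\<close> modulo \<open>q\<close>, and less than
    \<open>q\<close> below \<open>Q\<close>.\<close>
  define q' where "q' = int Q - (int Q + r) mod q"
  have "[a * q' + 1 = a * (int Q - (int Q + r)) + 1] (mod q)"
    unfolding q'_def by (intro cong_add cong_mult cong_diff) (auto simp: cong_def)
  also have "a * (int Q - (int Q + r)) + 1 = 1 - a * r" by (simp add: algebra_simps)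
  also have "[1 - a * r = 1 - 1] (mod q)" using r by (intro cong_diff) auto
  finally have "q dvd a * q' + 1" by (simp add: cong_0_iff)
  then have "\<exists>q'. int Q - rden x < q' \<and> q' \<le> int Q \<and> rden x dvd rnum x * q' + 1"
    using q unfolding q'_def q_def a_def by (intro exI[of _ q'] exI[of _ "int Q - (int Q + r) mod rden x"]) (auto simp: q_def)
  from someI_ex[OF this, folded succ_den_def]
  show "int Q - rden x < succ_den Q x" "succ_den Q x \<le> int Q" "rden x dvd rnum x * succ_den Q x + 1" by auto
qed

lemma coprime_of_dvd_Suc:
  fixes a b q :: int
  assumes "q dvd a * b + 1"
  shows "coprime q a" "coprime q b"
proof -
  have "is_unit d" if "d dvd q" "d dvd a \<or> d dvd b" for d
  proof -
    have "d dvd a * b + 1" using that(1) assms by (rule dvd_trans)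
    moreover have "d dvd a * b" using that(2) by auto
    ultimately show ?thesis using dvd_add_right_iff by blast
  qed
  then show "coprime q a" "coprime q b" by (auto intro: coprimeI)
qed

lemma eq_of_dvd_diff:
  fixes c d q :: int
  assumes "q dvd c - d" "\<bar>c - d\<bar> < q"
  shows "c = d"
  using assms dvd_imp_le_int[of "c - d" q] by fastforce

lemma rnum_bounds:
  assumes "0 \<le> x" "x < 1"
  shows "0 \<le> rnum x" "rnum x < rden x"
proof -
  have x: "x = of_int (rnum x) / of_int (rden x)" by (rule rat_eq_rnum_rden)
  have "(0::rat) \<le> of_int (rnum x)" "(of_int (rnum x) :: rat) < of_int (rden x)"
    using assms rden_pos[of x] by (subst (asm) (1 2) x, simp add: zero_le_divide_iff divide_less_eq)+
  then show "0 \<le> rnum x" "rnum x < rden x" by simp_all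
qed

text \<open>The congruence \<open>a * q' \<equiv> -1\<close> modulo \<open>q\<close> gives
  \<open>a\<close> from \<open>(q, q')\<close> and \<open>q'\<close> from \<open>(q, a)\<close>. The
  fraction 1 is left out because it has the denominator of 0 and, modulo that denominator, the same
  numerator.\<close>

lemma bij_betw_pair_of: "bij_betw (pair_of Q) {x \<in> farey Q. x < 1} (farey_pairs Q)"
proof (rule bij_betw_imageI)
  show "inj_on (pair_of Q) {x \<in> farey Q. x < 1}"
  proof (rule inj_onI)
    fix x y assume xy: "x \<in> {x \<in> farey Q. x < 1}" "y \<in> {x \<in> farey Q. x < 1}" "pair_of Q x = pair_of Q y"
    define q q' where "q = rden x" and "q' = succ_den Q x"
    have y: "rden y = q" "succ_den Q y = q'" using xy(3) unfolding pair_of_def q_def q'_def by auto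
    have d: "q dvd rnum x * q' + 1" "q dvd rnum y * q' + 1"
      using succ_den(3)[where Q = Q and x = x] succ_den(3)[where Q = Q and x = y] unfolding y q_def q'_def by auto
    then have "q dvd (rnum x * q' + 1) - (rnum y * q' + 1)" by (rule dvd_diff)
    also have "\<dots> = (rnum x - rnum y) * q'" by (simp add: algebra_simps)
    finally have "q dvd rnum x - rnum y" using coprime_of_dvd_Suc(2)[OF d(1)] by (simp add: coprime_dvd_mult_left_iff)
    moreover have "\<bar>rnum x - rnum y\<bar> < q"
      using rnum_bounds[of x] rnum_bounds[of y] xy y unfolding q_def farey_def by auto
    ultimately have "rnum x = rnum y" by (rule eq_of_dvd_diff)
    then show "x = y" using rat_eq_rnum_rden[of x] rat_eq_rnum_rden[of y] y q_def by simp
  qed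
  show "pair_of Q ` {x \<in> farey Q. x < 1} = farey_pairs Q"
  proof (intro equalityI subsetI)
    fix z assume "z \<in> pair_of Q ` {x \<in> farey Q. x < 1}"
    then obtain x where x: "x \<in> farey Q" "z = (rden x, succ_den Q x)" unfolding pair_of_def by auto
    have "rden x \<le> int Q" using x by (simp add: farey_def)
    then show "z \<in> farey_pairs Q"
      using succ_den[where Q = Q and x = x] rden_pos[of x] coprime_of_dvd_Suc(2)[OF succ_den(3)[where Q = Q and x = x]]
      unfolding x farey_pairs_def by auto
  next
    fix z assume "z \<in> farey_pairs Q"
    then obtain q q' where z: "z = (q, q')" "1 \<le> q" "q \<le> int Q" "1 \<le> q'" "q' \<le> int Q" "int Q < q + q'" "coprime q q'"
      unfolding farey_pairs_def by auto
    obtain s where s: "[q' * s = 1] (mod q)" using cong_solve_coprime_int[of q' q] z(7) by (metis coprime_commute)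
    define a where "a = (- s) mod q"
    have "[a * q' + 1 = (- s) * q' + 1] (mod q)" unfolding a_def by (intro cong_add cong_mult) (auto simp: cong_def)
    also have "(- s) * q' + 1 = 1 - q' * s" by (simp add: algebra_simps)
    also have "[1 - q' * s = 1 - 1] (mod q)" using s by (intro cong_diff) auto
    finally have da: "q dvd a * q' + 1" by (simp add: cong_0_iff)
    have a: "0 \<le> a" "a < q" unfolding a_def using z by auto
    define x where "x = (of_int a / of_int q :: rat)"
    have x: "rnum x = a" "rden x = q" unfolding x_def
      using rnum_rden_of_coprime[of q a] coprime_of_dvd_Suc(1)[OF da] z by (auto simp: coprime_commute)
    have "x \<in> farey Q" "x < 1" using a z x unfolding farey_def by (auto simp: x_def divide_le_eq divide_less_eq)
    moreover have "succ_den Q x = q'"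
    proof (rule eq_of_dvd_diff[of q])
      have "q dvd a * succ_den Q x + 1" using succ_den(3)[where Q = Q and x = x] x by simp
      then have "q dvd (a * succ_den Q x + 1) - (a * q' + 1)" using da by (rule dvd_diff)
      also have "\<dots> = a * (succ_den Q x - q')" by (simp add: algebra_simps)
      finally show "q dvd succ_den Q x - q'" using coprime_of_dvd_Suc(1)[OF da] by (simp add: coprime_dvd_mult_right_iff)
      show "\<bar>succ_den Q x - q'\<bar> < q" using succ_den[where Q = Q and x = x] x z by auto
    qed
    ultimately show "z \<in> pair_of Q ` {x \<in> farey Q. x < 1}" unfolding z(1) pair_of_def using x by force
  qed
qed

lemma farey_orbit_pair_of:
  assumes x: "x \<in> farey_coprime Q p" "x < 1" and p: "prime p"
  obtains a a' where "farey_orbit Q p a a' (pair_of Q x)" "farey_orbit.X Q a a' (pair_of Q x) 0 = x"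
proof -
  define a' where "a' = (rnum x * succ_den Q x + 1) div rden x"
  have a': "rden x * a' = rnum x * succ_den Q x + 1" unfolding a'_def using succ_den(3)[where Q = Q and x = x] by simp
  have "x \<in> farey Q" using x by (simp add: farey_coprime_def)
  then have "pair_of Q x \<in> farey_pairs Q" using bij_betw_imp_surj_on[OF bij_betw_pair_of[of Q]] x by blast
  moreover have "0 \<le> rnum x" using rnum_bounds[of x] x by (simp add: farey_coprime_def farey_def)
  ultimately have o: "farey_orbit Q p (rnum x) a' (pair_of Q x)"
    unfolding farey_orbit_def using a' p x by (simp add: pair_of_def farey_coprime_def)
  interpret farey_orbit Q p "rnum x" a' "pair_of Q x" by (rule o)
  have "X 0 = x" unfolding X_def num_def dens_def using rat_eq_rnum_rden[of x] by (simp add: pair_of_def)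
  then show thesis using that o by blast
qed

lemma finite_farey_pairs: "finite (farey_pairs Q)"
  by (rule finite_subset[of _ "{1..int Q} \<times> {1..int Q}"]) (auto simp: farey_pairs_def)

lemma one_in_farey_coprime:
  assumes "Q \<ge> 1" "prime p"
  shows "1 \<in> farey_coprime Q p"
proof -
  have "rden 1 = 1" by (simp add: rden_def)
  then show ?thesis using assms by (auto simp: farey_coprime_def farey_def dest: not_prime_unit)
qed

lemma bij_betw_pair_of_coprime:
  "bij_betw (pair_of Q) {x \<in> farey_coprime Q p. x < 1 \<and> P (pair_of Q x)} {z \<in> farey_pairs Q. \<not> int p dvd fst z \<and> P z}"
proof (rule bij_betw_imageI)
  show "inj_on (pair_of Q) {x \<in> farey_coprime Q p. x < 1 \<and> P (pair_of Q x)}"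
    by (rule inj_on_subset[OF bij_betw_imp_inj_on[OF bij_betw_pair_of[of Q]]]) (auto simp: farey_coprime_def)
  have "pair_of Q ` {x \<in> farey_coprime Q p. x < 1 \<and> P (pair_of Q x)} =
      {z \<in> pair_of Q ` {x \<in> farey Q. x < 1}. \<not> int p dvd fst z \<and> P z}"
    by (auto simp: farey_coprime_def pair_of_def)
  then show "pair_of Q ` {x \<in> farey_coprime Q p. x < 1 \<and> P (pair_of Q x)} = {z \<in> farey_pairs Q. \<not> int p dvd fst z \<and> P z}"
    unfolding bij_betw_imp_surj_on[OF bij_betw_pair_of] .
qed

lemma card_farey_coprime:
  assumes "Q \<ge> 1" "prime p"
  shows "finite (farey_coprime Q p)"
    "card (farey_coprime Q p) = Suc (card {z \<in> farey_pairs Q. \<not> int p dvd fst z})"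
proof -
  have b: "bij_betw (pair_of Q) {x \<in> farey_coprime Q p. x < 1} {z \<in> farey_pairs Q. \<not> int p dvd fst z}"
    using bij_betw_pair_of_coprime[of Q p "\<lambda>_. True"] by simp
  have fin: "finite {x \<in> farey_coprime Q p. x < 1}"
    using bij_betw_finite[OF b] finite_farey_pairs[of Q] by simp
  have e: "farey_coprime Q p = insert 1 {x \<in> farey_coprime Q p. x < 1}"
    using one_in_farey_coprime[OF assms] by (auto simp: farey_coprime_def farey_def)
  show "finite (farey_coprime Q p)" by (subst e) (simp only: finite_insert fin)
  show "card (farey_coprime Q p) = Suc (card {z \<in> farey_pairs Q. \<not> int p dvd fst z})"
    by (subst e, subst card_insert_disjoint) (use fin bij_betw_same_card[OF b] in auto)
qed

text \<open>Different elements have different numbers of elements above them. Applied to the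
  starting points that are too close to 1 for a full tuple.\<close>

lemma card_few_above:
  fixes F :: "'a::linorder set"
  assumes F: "finite F"
  shows "card {x \<in> F. card {y \<in> F. x < y} < H} \<le> H"
proof -
  have mono: "card {y \<in> F. x' < y} < card {y \<in> F. x < y}" if "x < x'" "x' \<in> F" for x x'
    using F that by (intro psubset_card_mono) auto
  have "inj_on (\<lambda>x. card {y \<in> F. x < y}) {x \<in> F. card {y \<in> F. x < y} < H}"
  proof (rule inj_onI)
    fix x x' assume A: "x \<in> {x \<in> F. card {y \<in> F. x < y} < H}" "x' \<in> {x \<in> F. card {y \<in> F. x < y} < H}"
      "card {y \<in> F. x < y} = card {y \<in> F. x' < y}"
    then show "x = x'" using mono[of x x'] mono[of x' x] by (cases x x' rule: linorder_cases) auto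
  qed
  then have "card {x \<in> F. card {y \<in> F. x < y} < H} \<le> card {..<H}"
    by (rule card_inj_on_le) auto
  then show ?thesis by simp
qed

definition matches :: "nat \<Rightarrow> nat \<Rightarrow> nat list \<Rightarrow> int \<times> int \<Rightarrow> bool" where
  "matches Q p \<Delta> z \<longleftrightarrow> (\<forall>h<length \<Delta>. gap Q p z h = \<Delta> ! h)"

abbreviation "matching Q p \<Delta> \<equiv> {z \<in> farey_pairs Q. \<not> int p dvd fst z \<and> matches Q p \<Delta> z}"

text \<open>A tuple of consecutive elements is determined by its first element, and its gaps are
  those of the orbit. Conversely a matching pair fails to give a tuple only if its list passes 1
  within \<open>length \<Delta>\<close> steps, which happens for at most that many starts.\<close>

lemma farey_tuple_count_approx:
  assumes Q: "Q \<ge> 1" and p: "prime p" and H: "length \<Delta> \<ge> 1"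
  shows "farey_tuple_count Q p \<Delta> \<le> card (matching Q p \<Delta>)"
    "card (matching Q p \<Delta>) \<le> farey_tuple_count Q p \<Delta> + length \<Delta>"
proof -
  define H where "H = length \<Delta>"
  define F where "F = farey_coprime Q p"
  have finF: "finite F" unfolding F_def by (rule card_farey_coprime(1)[OF Q p])
  define TS where "TS = {xs :: rat list. length xs = length \<Delta> + 1 \<and>
     (\<forall>h<length \<Delta>. consecutive_in (farey_coprime Q p) (xs ! h) (xs ! (h+1)) \<and>
        rden (xs ! h) * rnum (xs ! (h+1)) - rnum (xs ! h) * rden (xs ! (h+1)) = int (\<Delta> ! h))}"
  let ?img = "(\<lambda>xs. xs ! 0) ` TS"
  define M where "M = {x \<in> F. x < 1 \<and> matches Q p \<Delta> (pair_of Q x)}"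
  have cM: "card M = card (matching Q p \<Delta>)"
    unfolding M_def F_def by (rule bij_betw_same_card[OF bij_betw_pair_of_coprime])
  have finM: "finite M" unfolding M_def using finF by simp
  have N: "farey_tuple_count Q p \<Delta> = card TS" unfolding farey_tuple_count_def TS_def ..
  have start: "xs ! 0 \<in> F \<and> xs ! 0 < 1" if "xs \<in> TS" for xs
  proof -
    have "\<forall>h<length \<Delta>. consecutive_in F (xs ! h) (xs ! (h+1))" using that unfolding TS_def F_def by blast
    moreover have "0 < length \<Delta>" using H by linarith
    ultimately have "consecutive_in F (xs ! 0) (xs ! (0+1))" by blast
    then show ?thesis unfolding consecutive_in_def F_def farey_coprime_def farey_def by auto
  qed
  have tuple: "xs ! 0 \<in> M \<and> (\<forall>ys\<in>TS. ys ! 0 = xs ! 0 \<longrightarrow> ys = xs)" if xs: "xs \<in> TS" for xs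
  proof -
    define x where "x = xs ! 0"
    have x: "x \<in> farey_coprime Q p" "x < 1" using start[OF xs] unfolding x_def F_def by auto
    obtain a a' where o: "farey_orbit Q p a a' (pair_of Q x)" and X0: "farey_orbit.X Q a a' (pair_of Q x) 0 = x"
      using farey_orbit_pair_of[OF x p] by blast
    interpret farey_orbit Q p a a' "pair_of Q x" by (rule o)
    have eq: "ys ! h = Y h" if "ys \<in> TS" "ys ! 0 = x" "h \<le> H" for ys h
      using that X0 by (intro tuple_eq_Y[of ys H]) (auto simp: TS_def H_def)
    have "gap Q p (pair_of Q x) h = \<Delta> ! h" if h: "h < length \<Delta>" for h
    proof -
      have e: "xs ! h = Y h" "xs ! (h+1) = Y (Suc h)" using eq[OF xs, of h] eq[OF xs, of "h+1"] h unfolding x_def H_def by auto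
      have "int (\<Delta> ! h) = rden (xs ! h) * rnum (xs ! (h+1)) - rnum (xs ! h) * rden (xs ! (h+1))"
        using xs h unfolding TS_def by auto
      also have "\<dots> = int (gap Q p (pair_of Q x) h)"
        unfolding e unfolding Y_def rden_X by (rule det_gap)
      finally show ?thesis by simp
    qed
    then have "x \<in> M" unfolding M_def F_def matches_def using x by auto
    moreover have "ys = xs" if "ys \<in> TS" "ys ! 0 = x" for ys
    proof (rule nth_equalityI)
      show "length ys = length xs" using that xs unfolding TS_def by auto
      fix i assume "i < length ys"
      then have "i \<le> H" using that unfolding TS_def H_def by simp
      then show "ys ! i = xs ! i" using eq[OF that] eq[OF xs x_def[symmetric]] by (simp only:)
    qed
    ultimately show ?thesis unfolding x_def[symmetric] by blast
  qed
  have inj: "inj_on (\<lambda>xs. xs ! 0) TS" using tuple by (intro inj_onI) metis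
  have im: "?img \<subseteq> M" using tuple by auto
  show "farey_tuple_count Q p \<Delta> \<le> card (matching Q p \<Delta>)"
    unfolding N cM[symmetric] by (rule card_inj_on_le[OF inj im finM])
  have "M - ?img \<subseteq> {x \<in> F. card {y \<in> F. x < y} < H}"
  proof
    fix x assume xM: "x \<in> M - ?img"
    then have x: "x \<in> farey_coprime Q p" "x < 1" "matches Q p \<Delta> (pair_of Q x)" unfolding M_def F_def by auto
    obtain a a' where o: "farey_orbit Q p a a' (pair_of Q x)" and X0: "farey_orbit.X Q a a' (pair_of Q x) 0 = x"
      using farey_orbit_pair_of[OF x(1,2) p] by blast
    interpret farey_orbit Q p a a' "pair_of Q x" by (rule o)
    have "1 < Y H"
    proof (rule ccontr)
      assume "\<not> 1 < Y H"
      then have le: "Y h \<le> 1" if "h \<le> H" for h using strict_mono_Y that by (meson not_less order_trans strict_mono_less_eq)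
      define xs where "xs = map Y [0..<H+1]"
      have nth: "xs ! h = Y h" if "h \<le> H" for h using that unfolding xs_def by (simp del: upt_Suc)
      have "consecutive_in (farey_coprime Q p) (xs ! h) (xs ! (h+1)) \<and>
        rden (xs ! h) * rnum (xs ! (h+1)) - rnum (xs ! h) * rden (xs ! (h+1)) = int (\<Delta> ! h)" if h: "h < length \<Delta>" for h
      proof -
        have e: "xs ! h = Y h" "xs ! (h+1) = Y (Suc h)" using h nth unfolding H_def by auto
        have "rden (Y h) * rnum (Y (Suc h)) - rnum (Y h) * rden (Y (Suc h)) = int (gap Q p (pair_of Q x) h)"
          unfolding Y_def rden_X by (rule det_gap)
        then show ?thesis unfolding e using x(3) h consecutive_Y[of h] le[of "Suc h"] unfolding matches_def H_def by simp
      qed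
      then have "xs \<in> TS" unfolding TS_def by (simp add: xs_def H_def)
      moreover have "xs ! 0 = x" using nth[of 0] X0 by (simp add: Y_def r_0)
      ultimately show False using xM by blast
    qed
    from farey_coprime_above[OF this]
    have "card {y \<in> F. x < y} \<le> card (Y ` {1..<H})" unfolding X0 F_def by (intro card_mono) auto
    also have "\<dots> \<le> card {1..<H}" by (rule card_image_le) simp
    also have "\<dots> < H" using H unfolding H_def by simp
    finally show "x \<in> {x \<in> F. card {y \<in> F. x < y} < H}" using x unfolding F_def by simp
  qed
  then have "card (M - ?img) \<le> card {x \<in> F. card {y \<in> F. x < y} < H}"
    using finF by (intro card_mono) auto
  also have "\<dots> \<le> H" by (rule card_few_above[OF finF])
  finally have "card (M - ?img) \<le> H" .
  moreover have "card (?img) = card TS" using inj by (rule card_image)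
  moreover have "card (M - ?img) = card M - card (?img)"
    by (rule card_Diff_subset[OF finite_subset[OF im finM] im])
  ultimately show "card (matching Q p \<Delta>) \<le> farey_tuple_count Q p \<Delta> + length \<Delta>"
    unfolding N cM[symmetric] H_def by linarith
qed

section \<open>The admissible pairs\<close>

lemma cont_not_both_dvd:
  fixes p x y :: int
  assumes "\<not> (p dvd x \<and> p dvd y)"
  shows "\<not> (p dvd cont f x y j \<and> p dvd cont f x y (Suc j))"
proof (induction j)
  case (Suc j)
  have e: "cont f x y j = of_nat (f j) * cont f x y (Suc j) - cont f x y (Suc (Suc j))" by simp
  show ?case
  proof
    assume A: "p dvd cont f x y (Suc j) \<and> p dvd cont f x y (Suc (Suc j))"
    then have "p dvd cont f x y j" by (subst e) (intro dvd_diff dvd_mult, auto)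
    then show False using Suc A by blast
  qed
qed (use assms in simp)

lemma cont_coeffs_not_both_dvd:
  fixes p :: int
  assumes "prime p"
  shows "\<not> (p dvd cont f 1 0 j \<and> p dvd cont f 0 1 j)"
proof
  assume "p dvd cont f 1 0 j \<and> p dvd cont f 0 1 j"
  then have "p dvd cont f 1 0 j * cont f 0 1 (Suc j) - cont f 0 1 j * cont f 1 0 (Suc j)" by (intro dvd_diff dvd_mult2) auto
  then have "p dvd 1" unfolding cont_det by simp
  then show False using assms not_prime_unit by blast
qed

abbreviation zero_pattern :: "nat \<Rightarrow> nat set \<Rightarrow> int list" where
  "zero_pattern R Z \<equiv> map (\<lambda>j. if j \<in> Z then 0 else 1) [0..<R]"

text \<open>The part of membership in \<open>fibre\<close> that depends only on \<open>n\<close> and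
  on where the residues vanish; \<open>delta\<close> sees nothing else of them, so zeros and ones
  can stand for \<open>\<alpha>\<close>. The other conditions hold along any orbit of the
  recurrence.\<close>

definition pattern :: "nat \<Rightarrow> nat list \<Rightarrow> nat list \<Rightarrow> nat set \<Rightarrow> bool" where
  "pattern R \<Delta> n Z \<longleftrightarrow> 0 \<notin> Z \<and> R - 1 \<notin> Z \<and> card {r. r < R \<and> r \<notin> Z} = length \<Delta> + 1 \<and>
     delta (zero_pattern R Z, n) = \<Delta> \<and> (\<forall>m\<in>set n. m \<ge> 1)"

abbreviation cell_zeros :: "nat \<Rightarrow> nat \<Rightarrow> nat list \<Rightarrow> int \<Rightarrow> int \<Rightarrow> nat set" where
  "cell_zeros p R n \<equiv> zero_set (int p) R (cont ((!) n) 1 0) (cont ((!) n) 0 1)"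

definition residues_of :: "nat \<Rightarrow> nat \<Rightarrow> nat list \<Rightarrow> int \<Rightarrow> int \<Rightarrow> int list" where
  "residues_of p R n x y = map (\<lambda>j. cont ((!) n) x y j mod int p) [0..<R]"

lemma delta_cong:
  assumes "length \<alpha> = length \<beta>" "\<And>j. j < length \<alpha> \<Longrightarrow> \<alpha> ! j = 0 \<longleftrightarrow> \<beta> ! j = 0"
  shows "delta (\<alpha>, n) = delta (\<beta>, n)"
proof -
  have "filter (\<lambda>r. \<alpha> ! r \<noteq> 0) [0..<length \<alpha>] = filter (\<lambda>r. \<beta> ! r \<noteq> 0) [0..<length \<beta>]"
    using assms by (intro filter_cong) auto
  then show ?thesis unfolding delta_def by simp
qed

lemma modular_inverse_cong:
  fixes p u :: int
  assumes "prime p" "\<not> p dvd u"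
  shows "[u * modular_inverse p u = 1] (mod p)"
proof -
  have "coprime p u" using assms by (simp add: prime_imp_coprime)
  then show ?thesis using cong_modular_inverse1[of u p] by (simp add: coprime_commute)
qed

lemma cong_mult_inverse_iff:
  fixes p u n s :: int
  assumes "prime p" "\<not> p dvd u"
  shows "[n = s * modular_inverse p u] (mod p) \<longleftrightarrow> [n * u = s] (mod p)"
proof -
  let ?i = "modular_inverse p u"
  have i: "[u * ?i = 1] (mod p)" by (rule modular_inverse_cong[OF assms])
  show ?thesis
  proof
    assume "[n = s * ?i] (mod p)"
    then have "[n * u = s * ?i * u] (mod p)" by (rule cong_scalar_right)
    also have "s * ?i * u = s * (u * ?i)" by (simp add: mult_ac)
    also have "[\<dots> = s * 1] (mod p)" using i by (rule cong_scalar_left)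
    finally show "[n * u = s] (mod p)" by simp
  next
    assume "[n * u = s] (mod p)"
    then have "[n * u * ?i = s * ?i] (mod p)" by (rule cong_scalar_right)
    moreover have "[n * (u * ?i) = n * 1] (mod p)" using i by (rule cong_scalar_left)
    ultimately show "[n = s * ?i] (mod p)" by (metis cong_sym cong_trans mult.assoc mult.right_neutral)
  qed
qed

definition index_conditions :: "nat \<Rightarrow> int \<Rightarrow> int \<Rightarrow> int \<Rightarrow> nat \<Rightarrow> bool" where
  "index_conditions p x y w k \<longleftrightarrow>
     (x = 0 \<and> y \<noteq> 0 \<and> w = 0 \<longrightarrow> p dvd k) \<and>
     (x = 0 \<and> y \<noteq> 0 \<and> w \<noteq> 0 \<longrightarrow> [int k = w * modular_inverse (int p) y] (mod int p)) \<and>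
     (x \<noteq> 0 \<and> y \<noteq> 0 \<and> w = 0 \<longrightarrow> [int k = x * modular_inverse (int p) y] (mod int p)) \<and>
     (x \<noteq> 0 \<and> y \<noteq> 0 \<and> w \<noteq> 0 \<longrightarrow> [int k = (w + x) * modular_inverse (int p) y] (mod int p)) \<and>
     (y = 0 \<longrightarrow> [w = - x] (mod int p))"

text \<open>The clauses are a single congruence \<open>w \<equiv> k * y - x\<close>, sorted by which
  of the three residues vanish and solved for \<open>k\<close> where \<open>y\<close> is
  invertible.\<close>

lemma index_conditions_iff:
  assumes p: "prime p" and range: "x \<in> {0..<int p}" "y \<in> {0..<int p}" "w \<in> {0..<int p}"
  shows "index_conditions p x y w k \<longleftrightarrow> [w = int k * y - x] (mod int p)"
proof (cases "y = 0")
  case False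
  have pi: "prime (int p)" using p by simp
  have y: "\<not> int p dvd y" using False range(2) zdvd_imp_le[of "int p" y] by auto
  note inv = cong_mult_inverse_iff[OF pi y]
  have "[w = int k * y - x] (mod int p) \<longleftrightarrow> [int k * y = w + x] (mod int p)"
  proof -
    have "int p dvd w - (int k * y - x) \<longleftrightarrow> int p dvd (w + x) - int k * y" by (simp add: algebra_simps)
    then show ?thesis by (simp add: cong_iff_dvd_diff dvd_diff_commute)
  qed
  moreover have "[int k * y = 0] (mod int p) \<longleftrightarrow> p dvd k"
    using pi y by (simp add: cong_0_iff prime_dvd_mult_iff)
  ultimately show ?thesis using False by (auto simp: inv index_conditions_def)
qed (auto simp: index_conditions_def)

lemma residues_of_nth: "j < R \<Longrightarrow> residues_of p R n x y ! j = cont ((!) n) x y j mod int p"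
  by (simp add: residues_of_def)

lemma zero_set_cont:
  "cell_zeros p R n x y = {j. j < R \<and> p dvd cont ((!) n) x y j}"
  unfolding zero_set_def cont_linear[of "(!) n" x y, symmetric] ..

text \<open>Reducing the integer recurrence modulo \<open>p\<close> yields the index conditions, and
  no two neighbouring residues vanish; what remains to be checked is \<open>pattern\<close>.\<close>

lemma mem_fibre_iff_pattern:
  assumes p: "prime p" and R: "R \<ge> 2" "length n = R - 2" and xy: "\<not> (int p dvd x \<and> int p dvd y)"
  shows "(residues_of p R n x y, n) \<in> fibre p \<Delta> R \<longleftrightarrow>
     pattern R \<Delta> n (cell_zeros p R n x y)"
proof -
  define c where "c = cont ((!) n) x y"
  define Z where "Z = {j. j < R \<and> int p dvd c j}"
  define \<alpha> where "\<alpha> = residues_of p R n x y"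
  have p0: "int p > 0" using prime_gt_0_nat[OF p] by simp
  have len: "length \<alpha> = R" unfolding \<alpha>_def residues_of_def by simp
  have nth: "\<alpha> ! j = c j mod int p" if "j < R" for j unfolding \<alpha>_def c_def by (rule residues_of_nth[OF that])
  have zero: "\<alpha> ! j = 0 \<longleftrightarrow> j \<in> Z" if "j < R" for j using that unfolding nth[OF that] Z_def by (simp add: dvd_eq_mod_eq_0)
  have rng: "\<alpha> ! j \<in> {0..<int p}" if "j < R" for j using p0 unfolding nth[OF that] by simp
  have sub: "set \<alpha> \<subseteq> {0..<int p}" using rng len by (auto simp: in_set_conv_nth)
  have noz: "\<forall>r<R-1. \<alpha> ! r = 0 \<longrightarrow> \<alpha> ! (r+1) \<noteq> 0"
  proof (intro allI impI)
    fix r assume r: "r < R - 1" "\<alpha> ! r = 0"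
    then have "r \<in> Z" using zero[of r] by simp
    then have "Suc r \<notin> Z" using cont_not_both_dvd[OF xy, of "(!) n" r] unfolding Z_def c_def by auto
    then show "\<alpha> ! (r+1) \<noteq> 0" using zero[of "r+1"] r(1) by simp
  qed
  have rc: "[\<alpha> ! (r+2) = int (n ! r) * \<alpha> ! (r+1) - \<alpha> ! r] (mod int p)" if "r < R - 2" for r
  proof -
    have cm: "[c j = \<alpha> ! j] (mod int p)" if "j < R" for j using nth[OF that] by (simp add: cong_def)
    have "[\<alpha> ! (r+2) = c (r+2)] (mod int p)" using cm[of "r+2"] that by (simp add: cong_sym)
    also have "c (r+2) = int (n ! r) * c (r+1) - c r" unfolding c_def by simp
    also have "[\<dots> = int (n ! r) * \<alpha> ! (r+1) - \<alpha> ! r] (mod int p)"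
      using that by (intro cong_diff cong_mult cong_refl cm) auto
    finally show ?thesis .
  qed
  have conds: "\<forall>r<R-2. index_conditions p (\<alpha> ! r) (\<alpha> ! (r+1)) (\<alpha> ! (r+2)) (n ! r)"
    using rc rng by (auto simp: index_conditions_iff[OF p])
  have card: "{r. r < R \<and> \<alpha> ! r \<noteq> 0} = {r. r < R \<and> r \<notin> Z}" using zero by auto
  have dl: "delta (\<alpha>, n) = delta (zero_pattern R Z, n)"
    using zero len by (intro delta_cong) auto
  have ends: "\<alpha> ! 0 \<noteq> 0 \<longleftrightarrow> 0 \<notin> Z" "\<alpha> ! (R - 1) \<noteq> 0 \<longleftrightarrow> R - 1 \<notin> Z" using zero[of 0] zero[of "R-1"] R by auto
  have "(\<alpha>, n) \<in> fibre p \<Delta> R \<longleftrightarrow> pattern R \<Delta> n Z"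
    unfolding fibre_def admissible_def pattern_def mem_Collect_eq split_conv card dl ends
    by (simp only: len sub R(2) noz[THEN eqTrueI] conds[unfolded index_conditions_def, THEN eqTrueI] simp_thms) blast
  then show ?thesis unfolding \<alpha>_def zero_set_cont Z_def c_def .
qed

text \<open>The recurrence leaves no freedom after the first two residues; past a zero entry it is
  the last clause of \<open>admissible\<close> that fixes the next one.\<close>

lemma fibre_is_residues_of:
  assumes p: "prime p" and R: "R \<ge> 2" and mem: "(\<alpha>, n) \<in> fibre p \<Delta> R"
  shows "\<alpha> = residues_of p R n (\<alpha> ! 0) (\<alpha> ! 1)" "\<alpha> ! 0 \<in> {0..<int p}" "\<alpha> ! 1 \<in> {0..<int p}"
    "\<not> (int p dvd \<alpha> ! 0 \<and> int p dvd \<alpha> ! 1)" "length n = R - 2"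
proof -
  have ad: "length \<alpha> = R" "set \<alpha> \<subseteq> {0..<int p}" "\<alpha> ! 0 \<noteq> 0" "length n = R - 2"
    using mem unfolding fibre_def admissible_def by auto
  have rng: "\<alpha> ! j \<in> {0..<int p}" if "j < R" for j using ad that nth_mem by blast
  show "\<alpha> ! 0 \<in> {0..<int p}" "\<alpha> ! 1 \<in> {0..<int p}" using rng R by auto
  show "\<not> (int p dvd \<alpha> ! 0 \<and> int p dvd \<alpha> ! 1)" using ad(3) rng[of 0] R zdvd_imp_le[of "int p" "\<alpha> ! 0"] by auto
  show "length n = R - 2" by (rule ad)
  have rc: "[\<alpha> ! (r+2) = int (n ! r) * \<alpha> ! (r+1) - \<alpha> ! r] (mod int p)" if r: "r < R - 2" for r
  proof -
    have "index_conditions p (\<alpha> ! r) (\<alpha> ! (r+1)) (\<alpha> ! (r+2)) (n ! r)"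
      using mem r unfolding fibre_def admissible_def index_conditions_def by blast
    then show ?thesis using rng r by (simp add: index_conditions_iff[OF p])
  qed
  have nth: "j < R \<Longrightarrow> \<alpha> ! j = cont ((!) n) (\<alpha> ! 0) (\<alpha> ! 1) j mod int p" for j
  proof (induction "(!) n" "\<alpha> ! 0" "\<alpha> ! 1" j rule: cont.induct)
    case 1
    then show ?case using rng[of 0] R by simp
  next
    case 2
    then show ?case using rng[of 1] R by simp
  next
    case (3 j)
    have e: "\<alpha> ! Suc j = cont ((!) n) (\<alpha> ! 0) (\<alpha> ! 1) (Suc j) mod int p" "\<alpha> ! j = cont ((!) n) (\<alpha> ! 0) (\<alpha> ! 1) j mod int p"
      using 3 by auto
    have "\<alpha> ! Suc (Suc j) = \<alpha> ! Suc (Suc j) mod int p" using rng[of "Suc (Suc j)"] 3(3) by simp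
    also have "\<dots> = (int (n ! j) * \<alpha> ! Suc j - \<alpha> ! j) mod int p" using rc[of j] 3(3) by (simp add: cong_def)
    also have "\<dots> = (int (n ! j) * cont ((!) n) (\<alpha> ! 0) (\<alpha> ! 1) (Suc j) - cont ((!) n) (\<alpha> ! 0) (\<alpha> ! 1) j) mod int p"
    proof -
      have "[\<alpha> ! Suc j = cont ((!) n) (\<alpha> ! 0) (\<alpha> ! 1) (Suc j)] (mod int p)" "[\<alpha> ! j = cont ((!) n) (\<alpha> ! 0) (\<alpha> ! 1) j] (mod int p)"
        by (subst e, simp add: cong_def)+
      then show ?thesis unfolding cong_def[symmetric] by (intro cong_diff cong_mult cong_refl)
    qed
    finally show ?case by simp
  qed
  show "\<alpha> = residues_of p R n (\<alpha> ! 0) (\<alpha> ! 1)"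
  proof (rule nth_equalityI)
    show "length \<alpha> = length (residues_of p R n (\<alpha> ! 0) (\<alpha> ! 1))" by (simp add: ad residues_of_def)
    fix j assume "j < length \<alpha>"
    then have j: "j < R" by (simp only: ad)
    show "\<alpha> ! j = residues_of p R n (\<alpha> ! 0) (\<alpha> ! 1) ! j" by (rule trans[OF nth[OF j] residues_of_nth[OF j, symmetric]])
  qed
qed

text \<open>For a fixed index list the number of admissible \<open>\<alpha>\<close> becomes the
  number of residue pairs, the coefficient in the main term of
  \<open>coprime_zero_set_count\<close>. The inverse map reads off the first two entries.\<close>

lemma card_fibre_slice:
  assumes p: "prime p" and R: "R \<ge> 2" "length n = R - 2"
  shows "bij_betw (\<lambda>(x, y). residues_of p R n x y)
      (residue_pairs p R (cont ((!) n) 1 0) (cont ((!) n) 0 1) (pattern R \<Delta> n)) {\<alpha>. (\<alpha>, n) \<in> fibre p \<Delta> R}"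
proof (rule bij_betw_imageI)
  let ?A = "residue_pairs p R (cont ((!) n) 1 0) (cont ((!) n) 0 1) (pattern R \<Delta> n)"
  have ends: "residues_of p R n x y ! 0 = x" "residues_of p R n x y ! 1 = y" if "(x, y) \<in> ?A" for x y
    using that R residues_of_nth[of 0 R p n x y] residues_of_nth[of 1 R p n x y] by (auto simp: residue_pairs_def)
  show "inj_on (\<lambda>(x, y). residues_of p R n x y) ?A"
  proof (rule inj_onI, clarify)
    fix x y x' y' assume "(x, y) \<in> ?A" "(x', y') \<in> ?A" "residues_of p R n x y = residues_of p R n x' y'"
    then show "x = x' \<and> y = y'" using ends[of x y] ends[of x' y'] by simp
  qed
  show "(\<lambda>(x, y). residues_of p R n x y) ` ?A = {\<alpha>. (\<alpha>, n) \<in> fibre p \<Delta> R}"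
  proof (intro equalityI subsetI)
    fix \<alpha> assume "\<alpha> \<in> (\<lambda>(x, y). residues_of p R n x y) ` ?A"
    then obtain x y where xy: "(x, y) \<in> ?A" "\<alpha> = residues_of p R n x y" by auto
    then show "\<alpha> \<in> {\<alpha>. (\<alpha>, n) \<in> fibre p \<Delta> R}"
      using mem_fibre_iff_pattern[OF p R, of x y \<Delta>] by (auto simp: residue_pairs_def)
  next
    fix \<alpha> assume "\<alpha> \<in> {\<alpha>. (\<alpha>, n) \<in> fibre p \<Delta> R}"
    then have mem: "(\<alpha>, n) \<in> fibre p \<Delta> R" by simp
    note f = fibre_is_residues_of[OF p R(1) mem]
    have "(residues_of p R n (\<alpha> ! 0) (\<alpha> ! 1), n) \<in> fibre p \<Delta> R" by (subst f(1)[symmetric]) (rule mem)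
    then have "(\<alpha> ! 0, \<alpha> ! 1) \<in> ?A"
      using mem_fibre_iff_pattern[OF p R f(4)] f(2-4) unfolding residue_pairs_def by blast
    then show "\<alpha> \<in> (\<lambda>(x, y). residues_of p R n x y) ` ?A" by (intro image_eqI[where x = "(\<alpha> ! 0, \<alpha> ! 1)"]) (simp only: split_conv, rule f(1))
  qed
qed

section \<open>Orbits of Farey pairs as members of the fibres\<close>

definition index_list :: "nat \<Rightarrow> nat \<Rightarrow> int \<times> int \<Rightarrow> nat list" where
  "index_list Q k z = map (idx (scaled Q z)) [0..<k]"

definition orbit_residues :: "nat \<Rightarrow> nat \<Rightarrow> nat \<Rightarrow> int \<times> int \<Rightarrow> int list" where
  "orbit_residues Q p R z = residues_of p R (index_list Q (R - 2) z) (fst z) (snd z)"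

lemma orbit_residues_eq: "orbit_residues Q p R z = map (\<lambda>j. dens Q z j mod int p) [0..<R]"
  unfolding orbit_residues_def residues_of_def
proof (intro map_cong refl)
  fix j assume "j \<in> set [0..<R]"
  then have "cont ((!) (index_list Q (R - 2) z)) (fst z) (snd z) j = dens Q z j"
    unfolding dens_def by (intro cont_cong) (simp add: index_list_def)
  then show "cont ((!) (index_list Q (R - 2) z)) (fst z) (snd z) j mod int p = dens Q z j mod int p" by simp
qed

lemma farey_pair_not_both_dvd: "z \<in> farey_pairs Q \<Longrightarrow> prime p \<Longrightarrow> \<not> (int p dvd fst z \<and> int p dvd snd z)"
  using coprime_common_divisor[of "fst z" "snd z" "int p"] not_prime_unit[of "int p"] by (auto simp: farey_pairs_def)

lemma (in farey_orbit) good_upto: "{j. j < Suc (r h) \<and> j \<in> good Q p z} = r ` {..h}"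
proof (intro equalityI subsetI)
  fix j assume j: "j \<in> {j. j < Suc (r h) \<and> j \<in> good Q p z}"
  then obtain i where i: "r i = j" using enumerate_Ex[of "good Q p z" j] infinite_good by auto
  then have "i \<le> h" using j enumerate_mono_iff[OF infinite_good, of h i] by (auto simp: not_less[symmetric])
  then show "j \<in> r ` {..h}" using i by auto
qed (auto simp: r_good enumerate_mono_le_iff[OF infinite_good] less_Suc_eq_le)

text \<open>At most one position is skipped at each step. With \<open>R = Suc (r H)\<close> this is
  the origin of the range \<open>H + 1\<close> to \<open>2 * H + 1\<close>.\<close>

lemma (in farey_orbit) r_bounds: "h \<le> r h" "r h \<le> 2 * h"
proof -
  show "h \<le> r h" by (rule le_enumerate[OF infinite_good])
  show "r h \<le> 2 * h"
  proof (induction h)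
    case (Suc h)
    then show ?case using r_Suc[of h] by auto
  qed (simp add: r_0)
qed

text \<open>The length is not free: the list has to end at a nonzero residue and to contain
  \<open>H + 1\<close> of them, so its last position is \<open>r H\<close>.\<close>

lemma (in farey_orbit) orbit_in_fibre_iff:
  assumes H: "length \<Delta> = H" "H \<ge> 1" and R: "R \<ge> 2"
  shows "(orbit_residues Q p R z, index_list Q (R - 2) z) \<in> fibre p \<Delta> R \<longleftrightarrow> R = Suc (r H) \<and> matches Q p \<Delta> z"
proof -
  define n where "n = index_list Q (R - 2) z"
  define Z where "Z = cell_zeros p R n (fst z) (snd z)"
  have len: "length n = R - 2" unfolding n_def index_list_def by simp
  have "(orbit_residues Q p R z, n) \<in> fibre p \<Delta> R \<longleftrightarrow> pattern R \<Delta> n Z"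
    unfolding orbit_residues_def n_def[symmetric] Z_def
    by (rule mem_fibre_iff_pattern[OF p R len farey_pair_not_both_dvd[OF z p]])
  moreover have Z: "j \<in> Z \<longleftrightarrow> j \<notin> good Q p z" if "j < R" for j
  proof -
    have "cont ((!) n) (fst z) (snd z) j = dens Q z j"
      unfolding dens_def using that by (intro cont_cong) (simp add: index_list_def n_def)
    then show ?thesis using that unfolding Z_def zero_set_cont good_def by simp
  qed
  have pos: "\<forall>m\<in>set n. m \<ge> 1" unfolding n_def index_list_def using idx_pos[OF scaled_triangle[OF z]] by auto
  have cardset: "{j. j < R \<and> j \<notin> Z} = {j. j < R \<and> j \<in> good Q p z}" using Z by auto
  have 0: "0 \<notin> Z" using Z[of 0] R r_good[of 0] r_0 by simp
  have dl: "delta (zero_pattern R Z, n) = map (gap Q p z) [0..<H]" if RH: "R = Suc (r H)"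
  proof -
    define \<beta> where "\<beta> = map (\<lambda>j. if j \<in> Z then 0 else (1::int)) [0..<R]"
    have "filter (\<lambda>j. \<beta> ! j \<noteq> 0) [0..<length \<beta>] = filter (\<lambda>j. j \<in> good Q p z) [0..<R]"
      using Z by (intro filter_cong) (auto simp: \<beta>_def)
    also have "\<dots> = map r [0..<Suc H]"
    proof (rule sorted_distinct_set_unique)
      show "sorted (map r [0..<Suc H])"
        by (auto simp: sorted_iff_nth_mono enumerate_mono_le_iff[OF infinite_good] simp del: upt_Suc)
      show "distinct (map r [0..<Suc H])"
        by (simp add: distinct_map inj_on_subset[OF inj_enumerate[OF infinite_good] subset_UNIV] del: upt_Suc)
      have "set (filter (\<lambda>j. j \<in> good Q p z) [0..<R]) = {j. j < Suc (r H) \<and> j \<in> good Q p z}" using RH by (auto simp del: upt_Suc)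
      also have "\<dots> = set (map r [0..<Suc H])" unfolding good_upto by (auto simp del: upt_Suc)
      finally show "set (filter (\<lambda>j. j \<in> good Q p z) [0..<R]) = set (map r [0..<Suc H])" .
    qed (auto intro: sorted_wrt_filter)
    finally have rs: "filter (\<lambda>j. \<beta> ! j \<noteq> 0) [0..<length \<beta>] = map r [0..<Suc H]" .
    have "delta (\<beta>, n) = map (\<lambda>h. if map r [0..<Suc H] ! (h + 1) = map r [0..<Suc H] ! h + 1 then 1 else n ! (map r [0..<Suc H] ! h)) [0..<H]"
      unfolding delta_def by (simp add: rs Let_def del: upt_Suc)
    also have "\<dots> = map (gap Q p z) [0..<H]"
    proof (intro map_cong refl)
      fix h assume "h \<in> set [0..<H]"
      then have h: "h < H" by simp
      have e: "map r [0..<Suc H] ! (h + 1) = r (Suc h)" "map r [0..<Suc H] ! h = r h"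
        using h by (auto simp del: upt_Suc)
      \<comment> \<open>The entry is read only when a position is skipped. Then
        \<open>r h + 2 = r (Suc h)\<close> is at most \<open>R - 1\<close>, so \<open>r h\<close>
        lies within the list of length \<open>R - 2\<close>.\<close>
      have "n ! r h = idx (scaled Q z) (r h)" if "r (Suc h) \<noteq> Suc (r h)"
      proof -
        have "r (Suc h) = Suc (Suc (r h))" using r_Suc[of h] that by simp
        moreover have "r (Suc h) \<le> r H" using h enumerate_mono_le_iff[OF infinite_good, of "Suc h" H] by simp
        ultimately have "r h < R - 2" using RH by simp
        then show ?thesis unfolding n_def index_list_def by simp
      qed
      then show "(if map r [0..<Suc H] ! (h + 1) = map r [0..<Suc H] ! h + 1 then 1 else n ! (map r [0..<Suc H] ! h)) = gap Q p z h"
        unfolding e gap_def by auto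
    qed
    finally show ?thesis unfolding \<beta>_def .
  qed
  have dm: "map (gap Q p z) [0..<H] = \<Delta> \<longleftrightarrow> matches Q p \<Delta> z"
    unfolding matches_def H(1) using H(1) by (auto simp: list_eq_iff_nth_eq)
  have injr: "inj_on r A" for A using inj_enumerate[OF infinite_good] inj_on_subset by blast
  have "pattern R \<Delta> n Z \<longleftrightarrow> R = Suc (r H) \<and> matches Q p \<Delta> z"
  proof
    assume P: "pattern R \<Delta> n Z"
    then have "R - 1 \<in> good Q p z" using Z[of "R - 1"] R unfolding pattern_def by auto
    then obtain k where k: "r k = R - 1" using enumerate_Ex infinite_good by blast
    then have Rk: "R = Suc (r k)" using R by simp
    have "card {j. j < R \<and> j \<in> good Q p z} = Suc H" using P cardset H unfolding pattern_def by simp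
    then have "card (r ` {..k}) = Suc H" unfolding Rk good_upto .
    then have "k = H" by (simp add: card_image[OF injr])
    then have RH: "R = Suc (r H)" using Rk by simp
    have "delta (zero_pattern R Z, n) = \<Delta>" using P unfolding pattern_def by blast
    then have "map (gap Q p z) [0..<H] = \<Delta>" using dl[OF RH] by (rule trans[OF sym, rotated])
    then show "R = Suc (r H) \<and> matches Q p \<Delta> z" using RH dm by blast
  next
    assume A: "R = Suc (r H) \<and> matches Q p \<Delta> z"
    then have RH: "R = Suc (r H)" by simp
    have "card {j. j < R \<and> j \<notin> Z} = length \<Delta> + 1" unfolding cardset unfolding RH good_upto
      using H by (simp add: card_image[OF injr])
    moreover have "R - 1 \<notin> Z" using Z[of "R - 1"] RH r_good[of H] by simp
    moreover have "delta (zero_pattern R Z, n) = \<Delta>"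
      by (rule trans[OF dl[OF RH]]) (use dm A in blast)
    ultimately show "pattern R \<Delta> n Z" unfolding pattern_def using 0 pos by blast
  qed
  ultimately show ?thesis unfolding n_def by blast
qed

section \<open>Summing the errors\<close>

definition geo_const :: "nat \<Rightarrow> real" where
  "geo_const k = real ((4 * k + 9) ^ (k + 3))"

lemma geo_const_ge_1: "geo_const k \<ge> 1"
  unfolding geo_const_def by (simp add: Suc_leI)

definition cell_residues :: "nat \<Rightarrow> nat \<Rightarrow> nat list \<Rightarrow> nat list \<Rightarrow> (int \<times> int) set" where
  "cell_residues p R \<Delta> n = residue_pairs p R (cont ((!) n) 1 0) (cont ((!) n) 0 1) (pattern R \<Delta> n)"

definition cell_points :: "nat \<Rightarrow> nat \<Rightarrow> nat \<Rightarrow> nat list \<Rightarrow> nat list \<Rightarrow> (int \<times> int) set" where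
  "cell_points Q p R \<Delta> n = {(a, b) \<in> lattice_pts (cell n) Q. coprime a b \<and>
     pattern R \<Delta> n (cell_zeros p R n a b)}"

text \<open>The bound of \<open>coprime_zero_set_count\<close> with diameter \<open>c / m\<close>
  and area \<open>c / m^3\<close> inserted. The first part is cut off at
  \<open>m \<le> 2 * Q\<close> and carries the logarithm from the sum over \<open>d\<close>; the
  second is summable in \<open>m\<close>.\<close>

definition cell_error :: "nat \<Rightarrow> nat \<Rightarrow> nat \<Rightarrow> real" where
  "cell_error R Q m = (if real m \<le> 2 * real Q then 4 * real (R + 1) * (geo_const (R - 2) + 1) * real Q * (1 + ln (2 * real Q)) * (1 / real m) else 0)
     + real Q * geo_const (R - 2) * (1 / (real m)^2)"

lemma cell_error_nonneg:
  assumes "Q \<ge> 1"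
  shows "cell_error R Q m \<ge> 0"
proof -
  have "ln (2 * real Q) \<ge> 0" using assms by (intro ln_ge_zero) auto
  then show ?thesis unfolding cell_error_def using geo_const_ge_1[of "R - 2"]
    by (intro add_nonneg_nonneg) (auto intro!: mult_nonneg_nonneg)
qed

lemma cell_points_count:
  assumes Q: "Q \<ge> 1" and p: "prime p" and n: "length n = R - 2"
  shows "\<bar>real (card (cell_points Q p R \<Delta> n)) - kappa p * real Q^2 / real p^2 * (card (cell_residues p R \<Delta> n) * vol (cell n))\<bar>
     \<le> (if cell n = {} then 0 else cell_error R Q (max_index n))"
proof (cases "cell n = {}")
  case True
  then show ?thesis by (simp add: cell_points_def lattice_pts_def)
next
  case False
  define m where "m = max_index n"
  define c where "c = geo_const (R - 2)"
  define L where "L = 1 + ln (2 * real Q)"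
  have L: "L \<ge> 1" unfolding L_def using Q by simp
  have c: "c \<ge> 1" unfolding c_def by (rule geo_const_ge_1)
  have m: "real m \<ge> 1" unfolding m_def using max_index_ge_1[of n] by simp
  note g = triangle_cell_geometry[OF n, folded geo_const_def m_def c_def]
  have pi: "prime (int p)" using p by simp
  have "\<bar>real (card (cell_points Q p R \<Delta> n)) - kappa p * real Q^2 * vol (cell n) * card (cell_residues p R \<Delta> n) / real p^2\<bar>
     \<le> (if real m \<le> 2 * real Q then real (2 * (R + 1)) * (2 * real Q * (c / m) * (1 + ln (2 * real Q)) + 2 * real Q / m) else 0) + real Q * m * vol (cell n)"
    unfolding cell_points_def cell_residues_def
  proof (rule coprime_zero_set_count[OF g(1) _ p])
    show "\<not> (int p dvd cont ((!) n) 1 0 j \<and> int p dvd cont ((!) n) 0 1 j)" for j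
      by (rule cont_coeffs_not_both_dvd[OF pi])
    show "real m \<le> 2 * N" if "N > 0" "lattice_pts (cell n) N \<noteq> {}" for N
      using max_index_le_scale[OF that] unfolding m_def .
  qed (use Q m in auto)
  also have "\<dots> \<le> cell_error R Q m"
  proof -
    have "2 * real Q * (c / m) * L + 2 * real Q / m = (2 * c * L + 2 * 1) * (real Q / m)" using m by (simp add: field_simps)
    also have "\<dots> \<le> (2 * c * L + 2 * L) * (real Q / m)" using L Q m by (intro mult_right_mono) auto
    finally have "real (2 * (R + 1)) * (2 * real Q * (c / m) * L + 2 * real Q / m) \<le> real (2 * (R + 1)) * ((2 * c * L + 2 * L) * (real Q / m))"
      by (intro mult_left_mono) auto
    also have "\<dots> = 4 * real (R + 1) * (c + 1) * real Q * L * (1 / real m)" by (simp add: algebra_simps add_divide_distrib)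
    finally have 1: "real (2 * (R + 1)) * (2 * real Q * (c / m) * L + 2 * real Q / m) \<le> 4 * real (R + 1) * (c + 1) * real Q * L * (1 / real m)" .
    have "real Q * m * vol (cell n) \<le> real Q * m * (c / real m ^ 3)"
      using g(2) by (intro mult_left_mono) auto
    also have "\<dots> = real Q * c * (1 / (real m)^2)" using m by (simp add: power2_eq_square power3_eq_cube)
    finally have 2: "real Q * m * vol (cell n) \<le> real Q * c * (1 / (real m)^2)" .
    show ?thesis unfolding cell_error_def c_def[symmetric] L_def[symmetric] using 1 2 by auto
  qed
  finally show ?thesis using False unfolding m_def by (simp add: mult_ac)
qed

text \<open>The outer factor bounds the number of cells with the same largest index; 3 bounds the
  sum of \<open>1 / m^2\<close>.\<close>

definition total_const :: "nat \<Rightarrow> real" where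
  "total_const R = geo_const (R - 2) * (4 * real (R + 1) * (geo_const (R - 2) + 1) + 3 * geo_const (R - 2))"

lemma sum_inverse_square_le: "(\<Sum>m\<in>{1..M}. 1 / (real m)^2) \<le> 3"
proof (cases "M = 0")
  case False
  have s: "summable (\<lambda>n. 1 / (real (n + 1))^2)"
    using inverse_squares_sums by (simp add: sums_iff add.commute)
  have "(\<Sum>m\<in>{1..M}. 1 / (real m)^2) = (\<Sum>n<M. 1 / (real (n + 1))^2)"
    by (rule sum.reindex_bij_witness[of _ "\<lambda>n. n + 1" "\<lambda>m. m - 1"]) auto
  also have "\<dots> \<le> (\<Sum>n. 1 / (real (n + 1))^2)" by (intro sum_le_suminf s) auto
  also have "\<dots> = pi^2 / 6" using inverse_squares_sums by (simp add: sums_iff add.commute)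
  also have "\<dots> \<le> 4^2 / 6" using pi_less_4 by (intro divide_right_mono power_mono) auto
  finally show ?thesis by simp
qed simp

text \<open>The second logarithm arises here, from the sum of \<open>1 / m\<close> over
  \<open>m \<le> 2 * Q\<close>.\<close>

lemma sum_cell_error_le:
  assumes Q: "Q \<ge> 1"
  shows "(\<Sum>m\<in>{1..M}. geo_const (R - 2) * cell_error R Q m) \<le> total_const R * real Q * (1 + ln (2 * real Q))^2"
proof -
  define c where "c = geo_const (R - 2)"
  define L where "L = 1 + ln (2 * real Q)"
  define B where "B = 4 * real (R + 1) * (c + 1) * real Q * L"
  have L: "L \<ge> 1" unfolding L_def using Q by simp
  have c: "c \<ge> 1" unfolding c_def by (rule geo_const_ge_1)
  have B: "B \<ge> 0" unfolding B_def using c L by auto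
  have "(\<Sum>m\<in>{1..M}. cell_error R Q m) =
      (\<Sum>m\<in>{1..M}. if real m \<le> 2 * real Q then B * (1 / real m) else 0) + (\<Sum>m\<in>{1..M}. real Q * c * (1 / (real m)^2))"
    unfolding cell_error_def sum.distrib c_def[symmetric] L_def[symmetric] B_def[symmetric] ..
  also have "(\<Sum>m\<in>{1..M}. if real m \<le> 2 * real Q then B * (1 / real m) else 0) \<le> (\<Sum>m\<in>{1..2*Q}. B * (1 / real m))"
  proof -
    have "(\<Sum>m\<in>{1..M}. if real m \<le> 2 * real Q then B * (1 / real m) else 0) = (\<Sum>m\<in>{1..M} \<inter> {1..2*Q}. B * (1 / real m))"
      by (subst sum.inter_restrict) (auto intro!: sum.cong)
    also have "\<dots> \<le> (\<Sum>m\<in>{1..2*Q}. B * (1 / real m))" using B by (intro sum_mono2) auto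
    finally show ?thesis .
  qed
  also have "(\<Sum>m\<in>{1..2*Q}. B * (1 / real m)) \<le> B * L"
    unfolding sum_distrib_left[symmetric] L_def using sum_inverse_le_ln[of "2 * Q"] Q B by (intro mult_left_mono) auto
  also have "(\<Sum>m\<in>{1..M}. real Q * c * (1 / (real m)^2)) \<le> real Q * c * 3"
    unfolding sum_distrib_left[symmetric] using sum_inverse_square_le[of M] c by (intro mult_left_mono) auto
  also have "real Q * c * 3 \<le> real Q * c * 3 * L^2"
  proof -
    have "real Q * c * 3 * 1 \<le> real Q * c * 3 * L^2" using L c by (intro mult_left_mono) (auto simp: one_le_power)
    then show ?thesis by simp
  qed
  finally have "(\<Sum>m\<in>{1..M}. cell_error R Q m) \<le> B * L + real Q * c * 3 * L^2" by simp
  then have "c * (\<Sum>m\<in>{1..M}. cell_error R Q m) \<le> c * (B * L + real Q * c * 3 * L^2)" using c by (intro mult_left_mono) auto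
  also have "\<dots> = c * (4 * real (R + 1) * (c + 1) + 3 * c) * real Q * L^2"
    unfolding B_def by (simp add: power2_eq_square algebra_simps)
  finally show ?thesis unfolding total_const_def c_def[symmetric] L_def[symmetric] sum_distrib_left .
qed

abbreviation cell_mass :: "nat \<Rightarrow> nat \<Rightarrow> nat list \<Rightarrow> nat list set \<Rightarrow> real" where
  "cell_mass p R \<Delta> F \<equiv> \<Sum>n\<in>F. card (cell_residues p R \<Delta> n) * vol (cell n)"

text \<open>The bound does not involve \<open>F\<close>; this is what
  \<open>infsum_fibre_close\<close> uses to let \<open>F\<close> grow.\<close>

lemma sum_cell_points_count:
  assumes Q: "Q \<ge> 1" and p: "prime p" and F: "finite F" "\<And>n. n \<in> F \<Longrightarrow> length n = R - 2"
  shows "\<bar>(\<Sum>n\<in>F. real (card (cell_points Q p R \<Delta> n))) -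
      kappa p * real Q^2 / real p^2 * cell_mass p R \<Delta> F\<bar>
     \<le> total_const R * real Q * (1 + ln (2 * real Q))^2"
proof -
  let ?Fm = "\<lambda>m. {n\<in>{n\<in>F. cell n \<noteq> {}}. max_index n = m}"
  let ?E = "\<lambda>n. if cell n = {} then 0 else cell_error R Q (max_index n)"
  have "\<bar>(\<Sum>n\<in>F. real (card (cell_points Q p R \<Delta> n))) -
      kappa p * real Q^2 / real p^2 * cell_mass p R \<Delta> F\<bar>
    = \<bar>\<Sum>n\<in>F. real (card (cell_points Q p R \<Delta> n)) - kappa p * real Q^2 / real p^2 * (card (cell_residues p R \<Delta> n) * vol (cell n))\<bar>"
    by (simp add: sum_subtractf sum_distrib_left)
  also have "\<dots> \<le> (\<Sum>n\<in>F. ?E n)"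
    using F by (intro order_trans[OF sum_abs] sum_mono cell_points_count Q p) auto
  also have "\<dots> = (\<Sum>n\<in>{n\<in>F. cell n \<noteq> {}}. cell_error R Q (max_index n))"
    using F(1) by (subst sum.inter_filter) (auto intro!: sum.cong)
  also have "\<dots> = (\<Sum>m\<in>{1..Max (insert 1 (max_index ` F))}. \<Sum>n\<in>(?Fm m). cell_error R Q (max_index n))"
    using F(1) max_index_ge_1 by (intro sum.group[symmetric]) (auto intro!: Max_ge)
  also have "\<dots> \<le> (\<Sum>m\<in>{1..Max (insert 1 (max_index ` F))}. geo_const (R - 2) * cell_error R Q m)"
  proof (intro sum_mono)
    fix m
    have "(\<Sum>n\<in>(?Fm m). cell_error R Q (max_index n))
       = real (card (?Fm m)) * cell_error R Q m" by simp
    also have "\<dots> \<le> geo_const (R - 2) * cell_error R Q m"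
    proof (intro mult_right_mono cell_error_nonneg Q)
      have "card (?Fm m) \<le> card {n. length n = R - 2 \<and> max_index n = m \<and> cell n \<noteq> {}}"
        using F by (intro card_mono triangle_cell_count) auto
      also have "\<dots> \<le> (4 * (R - 2) + 9) ^ (R - 2 + 3)" by (rule triangle_cell_count)
      finally show "real (card (?Fm m)) \<le> geo_const (R - 2)"
        unfolding geo_const_def by (simp only: of_nat_le_iff)
    qed
    finally show "(\<Sum>n\<in>(?Fm m). cell_error R Q (max_index n)) \<le> geo_const (R - 2) * cell_error R Q m" .
  qed
  also have "\<dots> \<le> total_const R * real Q * (1 + ln (2 * real Q))^2" by (rule sum_cell_error_le[OF Q])
  finally show ?thesis .
qed

lemma sum_measure_cells_le:
  assumes F: "finite F" "\<And>n. n \<in> F \<Longrightarrow> length n = k"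
  shows "(\<Sum>n\<in>F. vol (cell n)) \<le> 1 / 2"
proof -
  have fc: "cell n \<in> fmeasurable lborel" for n
    using triangle_cell_subset by (intro fmeasurableI2[OF triangle_fmeasurable]) auto
  have disj: "cell n \<inter> cell n' = {}" if "n \<in> F" "n' \<in> F" "n \<noteq> n'" for n n'
    using that F(2) by (metis (no_types, lifting) IntE emptyE equals0I mem_triangle_cell_iff_idx)
  have "(\<Sum>n\<in>F. vol (cell n)) = vol (\<Union>n\<in>F. cell n)"
  proof (rule measure_finite_Union[symmetric])
    show "disjoint_family_on cell F" using disj unfolding disjoint_family_on_def by blast
    show "emeasure lborel (cell n) \<noteq> \<infinity>" for n using fmeasurableD2[OF fc] by simp
  qed (use F(1) triangle_cell_borel in auto)
  also have "\<dots> \<le> vol triangle"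
    using triangle_cell_subset triangle_fmeasurable F(1) by (intro measure_mono_fmeasurable) auto
  finally show ?thesis by (simp add: measure_triangle)
qed

section \<open>Infinite sums over the fibres\<close>

definition fibre_over :: "nat \<Rightarrow> nat list \<Rightarrow> nat \<Rightarrow> nat list set \<Rightarrow> (int list \<times> nat list) set" where
  "fibre_over p \<Delta> R F = {an \<in> fibre p \<Delta> R. snd an \<in> F}"

lemma fibre_over_sum:
  assumes p: "prime p" and R: "R \<ge> 2" and F: "finite F" "\<And>n. n \<in> F \<Longrightarrow> length n = R - 2"
  shows "finite (fibre_over p \<Delta> R F)"
    "(\<Sum>an\<in>fibre_over p \<Delta> R F. weight p an) =
     2 / (real p * (real p - 1)) * cell_mass p R \<Delta> F"
proof -
  define S where "S n = {\<alpha>. (\<alpha>, n) \<in> fibre p \<Delta> R}" for n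
  have S: "finite (S n)" "card (S n) = card (cell_residues p R \<Delta> n)" if "n \<in> F" for n
    using bij_betw_finite[OF card_fibre_slice[OF p R F(2)[OF that], of \<Delta>]] bij_betw_same_card[OF card_fibre_slice[OF p R F(2)[OF that], of \<Delta>]]
    by (auto simp: S_def cell_residues_def finite_residue_pairs)
  have e: "fibre_over p \<Delta> R F = (\<lambda>(n, \<alpha>). (\<alpha>, n)) ` Sigma F S"
    unfolding fibre_over_def S_def by force
  have fin: "finite (Sigma F S)" using S F by auto
  show "finite (fibre_over p \<Delta> R F)" unfolding e using fin by simp
  have "(\<Sum>an\<in>fibre_over p \<Delta> R F. weight p an) = (\<Sum>(n, \<alpha>)\<in>Sigma F S. weight p (\<alpha>, n))"
    unfolding e by (subst sum.reindex) (auto simp: inj_on_def intro!: sum.cong)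
  also have "\<dots> = (\<Sum>n\<in>F. \<Sum>\<alpha>\<in>S n. weight p (\<alpha>, n))"
    using F S by (intro sum.Sigma[symmetric]) auto
  also have "\<dots> = (\<Sum>n\<in>F. 2 / (real p * (real p - 1)) * (card (cell_residues p R \<Delta> n) * vol (cell n)))"
    by (intro sum.cong refl) (simp add: weight_def area_def S)
  finally show "(\<Sum>an\<in>fibre_over p \<Delta> R F. weight p an) =
     2 / (real p * (real p - 1)) * cell_mass p R \<Delta> F"
    by (simp only: sum_distrib_left)
qed

lemma prime_ratio_bounds:
  assumes "prime (p::nat)"
  shows "real p \<ge> 2" "(real p)^2 \<le> 2 * (real p * (real p - 1))" "real p * (real p - 1) > 0"
proof -
  show p: "real p \<ge> 2" using prime_ge_2_nat[OF assms] by simp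
  have "real p * 2 \<le> real p * real p" using p by (intro mult_left_mono) auto
  then show "(real p)^2 \<le> 2 * (real p * (real p - 1))" by (simp add: power2_eq_square right_diff_distrib)
  show "real p * (real p - 1) > 0" using p by simp
qed

lemma weight_nonneg: "prime p \<Longrightarrow> 0 \<le> weight p an"
  using prime_ratio_bounds(3)[of p] by (auto simp: weight_def area_def split: prod.split)

text \<open>Each cell has at most \<open>p^2\<close> residue pairs, the cells are disjoint of total
  area at most \<open>1/2\<close>, and \<open>p^2 \<le> 2 * p * (p - 1)\<close>. This gives both
  summability and a bound for the main term.\<close>

lemma fibre_over_sum_le:
  assumes p: "prime p" and R: "R \<ge> 2" and F: "finite F" "\<And>n. n \<in> F \<Longrightarrow> length n = R - 2"
  shows "(\<Sum>an\<in>fibre_over p \<Delta> R F. weight p an) \<le> 2"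
proof -
  note b = prime_ratio_bounds[OF p]
  have "cell_mass p R \<Delta> F \<le> (\<Sum>n\<in>F. (real p)^2 * vol (cell n))"
    using card_residue_pairs_le[of "int p"] by (intro sum_mono mult_right_mono) (auto simp: cell_residues_def)
  also have "\<dots> \<le> (real p)^2 * (1 / 2)"
    unfolding sum_distrib_left[symmetric] using sum_measure_cells_le[OF F] by (intro mult_left_mono) auto
  finally have "2 / (real p * (real p - 1)) * cell_mass p R \<Delta> F
     \<le> 2 / (real p * (real p - 1)) * ((real p)^2 * (1 / 2))"
    using b by (intro mult_left_mono) auto
  also have "\<dots> \<le> 2" using b by (simp add: pos_divide_le_eq)
  finally show ?thesis using fibre_over_sum(2)[OF p R F, of \<Delta>] by linarith
qed

lemma subset_fibre_over:
  assumes "Y \<subseteq> fibre p \<Delta> R" "snd ` Y \<subseteq> F"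
  shows "Y \<subseteq> fibre_over p \<Delta> R F"
  using assms by (auto simp: fibre_over_def)

lemma fibre_snd_length:
  assumes "prime p" "R \<ge> 2" "an \<in> fibre p \<Delta> R"
  shows "length (snd an) = R - 2"
  using fibre_is_residues_of(5)[OF assms(1,2), of "fst an" "snd an"] assms(3) by simp

lemma fibre_summable:
  assumes p: "prime p" and R: "R \<ge> 2"
  shows "weight p summable_on fibre p \<Delta> R" "0 \<le> infsum (weight p) (fibre p \<Delta> R)" "infsum (weight p) (fibre p \<Delta> R) \<le> 2"
proof -
  have bound: "sum (weight p) Y \<le> 2" if Y: "finite Y" "Y \<subseteq> fibre p \<Delta> R" for Y
  proof -
    have F: "finite (snd ` Y)" "\<And>n. n \<in> snd ` Y \<Longrightarrow> length n = R - 2"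
      using Y fibre_snd_length[OF p R] by auto
    have "sum (weight p) Y \<le> sum (weight p) (fibre_over p \<Delta> R (snd ` Y))"
      using subset_fibre_over[OF Y(2) order_refl] fibre_over_sum(1)[OF p R F] weight_nonneg[OF p] by (intro sum_mono2) auto
    also have "\<dots> \<le> 2" by (rule fibre_over_sum_le[OF p R F])
    finally show ?thesis .
  qed
  show s: "weight p summable_on fibre p \<Delta> R"
    using weight_nonneg[OF p] bound by (intro nonneg_bdd_above_summable_on bdd_aboveI2[where M = 2]) auto
  show "0 \<le> infsum (weight p) (fibre p \<Delta> R)" using weight_nonneg[OF p] by (intro infsum_nonneg) auto
  show "infsum (weight p) (fibre p \<Delta> R) \<le> 2" using s bound by (intro infsum_le_finite_sums) auto
qed

text \<open>In the application \<open>base\<close> holds the index lists that occur at the given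
  \<open>Q\<close>. The same \<open>E\<close> works for every finite family containing it, so the
  finite sums may tend to the infinite one while \<open>N\<close> stays fixed.\<close>

lemma infsum_fibre_close:
  fixes N W E :: real
  assumes p: "prime p" and R: "R \<ge> 2" and base: "finite base" and W: "W \<ge> 0"
    and close: "\<And>F. finite F \<Longrightarrow> base \<subseteq> F \<Longrightarrow> (\<And>n. n \<in> F \<Longrightarrow> length n = R - 2) \<Longrightarrow>
      \<bar>N - W * (\<Sum>an\<in>fibre_over p \<Delta> R F. weight p an)\<bar> \<le> E"
    and blen: "\<And>n. n \<in> base \<Longrightarrow> length n = R - 2"
  shows "\<bar>N - W * infsum (weight p) (fibre p \<Delta> R)\<bar> \<le> E"
proof (rule field_le_epsilon)
  let ?I = "infsum (weight p) (fibre p \<Delta> R)"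
  fix e :: real assume e: "e > 0"
  \<comment> \<open>\<open>W + 1\<close> rather than \<open>W\<close>, since \<open>W\<close> may be
    0.\<close>
  define e' where "e' = e / (W + 1)"
  have e': "e' > 0" "W * e' \<le> e" using e W unfolding e'_def by (auto simp: field_simps)
  have "(weight p has_sum ?I) (fibre p \<Delta> R)"
    using fibre_summable(1)[OF p R] by (rule has_sum_infsum)
  then have "(sum (weight p) \<longlongrightarrow> ?I) (finite_subsets_at_top (fibre p \<Delta> R))"
    unfolding has_sum_def .
  then have "\<forall>\<^sub>F Y in finite_subsets_at_top (fibre p \<Delta> R). dist (sum (weight p) Y) (?I) < e'"
    using e' by (intro tendstoD) auto
  then have "\<exists>Y0. finite Y0 \<and> Y0 \<subseteq> fibre p \<Delta> R \<and> (\<forall>Y. finite Y \<and> Y0 \<subseteq> Y \<and> Y \<subseteq> fibre p \<Delta> R \<longrightarrow>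
      dist (sum (weight p) Y) (?I) < e')"
    unfolding eventually_finite_subsets_at_top .
  then obtain Y0 where Y0: "finite Y0 \<and> Y0 \<subseteq> fibre p \<Delta> R \<and> (\<forall>Y. finite Y \<and> Y0 \<subseteq> Y \<and> Y \<subseteq> fibre p \<Delta> R \<longrightarrow>
      dist (sum (weight p) Y) (?I) < e')" by (rule exE)
  have Y0f: "finite Y0" "Y0 \<subseteq> fibre p \<Delta> R" using Y0 by simp_all
  define F where "F = snd ` Y0 \<union> base"
  have F: "finite F" "base \<subseteq> F" "\<And>n. n \<in> F \<Longrightarrow> length n = R - 2"
    using Y0f base blen fibre_snd_length[OF p R] unfolding F_def by auto
  have "dist (sum (weight p) (fibre_over p \<Delta> R F)) (?I) < e'"
  proof (rule Y0[THEN conjunct2, THEN conjunct2, rule_format], intro conjI)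
    show "finite (fibre_over p \<Delta> R F)" by (rule fibre_over_sum(1)[OF p R F(1,3)])
    show "Y0 \<subseteq> fibre_over p \<Delta> R F" by (rule subset_fibre_over[OF Y0f(2)]) (simp add: F_def)
    show "fibre_over p \<Delta> R F \<subseteq> fibre p \<Delta> R" by (auto simp: fibre_over_def)
  qed
  then have "W * \<bar>sum (weight p) (fibre_over p \<Delta> R F) - ?I\<bar> \<le> W * e'"
    using W by (intro mult_left_mono) (auto simp: dist_real_def)
  then have "\<bar>W * (sum (weight p) (fibre_over p \<Delta> R F) - ?I)\<bar> \<le> e"
    using e' W by (simp add: abs_mult)
  then have "\<bar>W * sum (weight p) (fibre_over p \<Delta> R F) - W * ?I\<bar> \<le> e"
    by (simp only: right_diff_distrib)
  then show "\<bar>N - W * ?I\<bar> \<le> E + e" using close[OF F] by linarith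
qed

section \<open>Counting by cells and comparison with the number of fractions\<close>

lemma scaled_triangle_iff:
  assumes "Q \<ge> 1"
  shows "z \<in> farey_pairs Q \<longleftrightarrow> scaled Q z \<in> triangle \<and> coprime (fst z) (snd z)"
proof
  assume A: "scaled Q z \<in> triangle \<and> coprime (fst z) (snd z)"
  have Q: "real Q > 0" using assms by simp
  have "0 < real_of_int (fst z)" "0 < real_of_int (snd z)"
    using triangle_pos[of "fst (scaled Q z)" "snd (scaled Q z)"] A Q by (auto simp: scaled_def zero_less_divide_iff)
  moreover have "real_of_int (fst z) \<le> real_of_int (int Q)" "real_of_int (snd z) \<le> real_of_int (int Q)"
    "real_of_int (int Q) < real_of_int (fst z + snd z)"
    using A Q by (auto simp: scaled_def triangle_def divide_le_eq less_divide_eq add_divide_distrib[symmetric])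
  ultimately show "z \<in> farey_pairs Q" using A unfolding farey_pairs_def of_int_le_iff of_int_less_iff by (auto simp: split_beta)
qed (auto simp: scaled_triangle, auto simp: farey_pairs_def)

definition matched :: "nat \<Rightarrow> nat \<Rightarrow> nat list \<Rightarrow> nat \<Rightarrow> (int \<times> int) set" where
  "matched Q p \<Delta> R = {z \<in> farey_pairs Q. (orbit_residues Q p R z, index_list Q (R - 2) z) \<in> fibre p \<Delta> R}"

lemma card_matched:
  assumes Q: "Q \<ge> 1" and p: "prime p" and R: "R \<ge> 2"
    and F: "finite F" "\<And>n. n \<in> F \<Longrightarrow> length n = R - 2" "index_list Q (R - 2) ` farey_pairs Q \<subseteq> F"
  shows "card (matched Q p \<Delta> R) = (\<Sum>n\<in>F. card (cell_points Q p R \<Delta> n))"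
proof -
  have fin: "finite (matched Q p \<Delta> R)" unfolding matched_def using finite_farey_pairs by simp
  have slice: "{z \<in> matched Q p \<Delta> R. index_list Q (R - 2) z = n} = cell_points Q p R \<Delta> n" if n: "n \<in> F" for n
  proof (intro Set.set_eqI)
    fix z
    have cell: "scaled Q z \<in> cell n \<longleftrightarrow> scaled Q z \<in> triangle \<and> n = index_list Q (R - 2) z"
      unfolding mem_triangle_cell_iff_idx index_list_def F(2)[OF n] ..
    have lat: "z \<in> lattice_pts (cell n) Q \<longleftrightarrow> scaled Q z \<in> cell n"
      by (cases z) (simp add: lattice_pts_def scaled_def)
    have "z \<in> cell_points Q p R \<Delta> n \<longleftrightarrow> scaled Q z \<in> cell n \<and> coprime (fst z) (snd z) \<and>
        pattern R \<Delta> n (cell_zeros p R n (fst z) (snd z))"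
      unfolding lat[symmetric] cell_points_def by (cases z) simp
    also have "\<dots> \<longleftrightarrow> z \<in> farey_pairs Q \<and> n = index_list Q (R - 2) z \<and>
        pattern R \<Delta> n (cell_zeros p R n (fst z) (snd z))"
      unfolding cell scaled_triangle_iff[OF Q] by blast
    also have "\<dots> \<longleftrightarrow> z \<in> {z \<in> matched Q p \<Delta> R. index_list Q (R - 2) z = n}"
      using mem_fibre_iff_pattern[OF p R F(2)[OF n] farey_pair_not_both_dvd[OF _ p], of z Q \<Delta>]
      unfolding matched_def orbit_residues_def by blast
    finally show "z \<in> {z \<in> matched Q p \<Delta> R. index_list Q (R - 2) z = n} \<longleftrightarrow> z \<in> cell_points Q p R \<Delta> n" by blast
  qed
  have "card (matched Q p \<Delta> R) = (\<Sum>z\<in>matched Q p \<Delta> R. 1)" by simp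
  also have "\<dots> = (\<Sum>n\<in>F. \<Sum>z\<in>{z \<in> matched Q p \<Delta> R. index_list Q (R - 2) z = n}. 1)"
    using F fin by (intro sum.group[symmetric]) (auto simp: matched_def)
  also have "\<dots> = (\<Sum>n\<in>F. card (cell_points Q p R \<Delta> n))" by (intro sum.cong refl) (simp add: slice)
  finally show ?thesis .
qed

text \<open>The asymptotic number of fractions: \<open>kappa p * Q^2\<close> times the area
  \<open>1/2\<close> times the proportion \<open>p * (p - 1) / p^2\<close> of residue pairs with
  nonzero first entry. It also turns weights into point counts, because multiplied by
  \<open>2 / (p * (p - 1))\<close> it is \<open>kappa p * Q^2 / p^2\<close>.\<close>

definition main_scale :: "nat \<Rightarrow> nat \<Rightarrow> real" where
  "main_scale Q p = kappa p * real Q^2 * (real p * (real p - 1)) / (2 * real p^2)"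

text \<open>The factors are \<open>1/2\<close> from the area, \<open>1/12\<close> from
  \<open>kappa_ge\<close> and \<open>1/2\<close> from \<open>(p - 1) / p\<close>.\<close>

lemma main_scale_ge:
  assumes "prime p"
  shows "main_scale Q p \<ge> real Q^2 / 48"
proof -
  note b = prime_ratio_bounds[OF assms]
  have "1 / 2 \<le> real p * (real p - 1) / real p^2" using b by (simp add: field_simps)
  then have "1 / 12 * (1 / 2) \<le> kappa p * (real p * (real p - 1) / real p^2)"
    using kappa_ge[OF assms] by (intro mult_mono) auto
  then have "real Q^2 / 2 * (1 / 12 * (1 / 2)) \<le> real Q^2 / 2 * (kappa p * (real p * (real p - 1) / real p^2))"
    by (intro mult_left_mono) auto
  also have "\<dots> = main_scale Q p" unfolding main_scale_def by simp
  finally show ?thesis by simp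
qed

lemma card_matched_approx:
  assumes Q: "Q \<ge> 1" and p: "prime p" and R: "R \<ge> 2"
  shows "\<bar>real (card (matched Q p \<Delta> R)) - main_scale Q p * infsum (weight p) (fibre p \<Delta> R)\<bar>
    \<le> total_const R * real Q * (1 + ln (2 * real Q))^2"
proof (rule infsum_fibre_close[OF p R, where base = "index_list Q (R - 2) ` farey_pairs Q"])
  show "finite (index_list Q (R - 2) ` farey_pairs Q)" using finite_farey_pairs by simp
  show "0 \<le> main_scale Q p" using main_scale_ge[OF p, of Q] by (rule order_trans[rotated]) simp
  show "length n = R - 2" if "n \<in> index_list Q (R - 2) ` farey_pairs Q" for n using that by (auto simp: index_list_def)
  fix F assume F: "finite F" "index_list Q (R - 2) ` farey_pairs Q \<subseteq> F" "\<And>n. n \<in> F \<Longrightarrow> length n = R - 2"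
  have "real (card (matched Q p \<Delta> R)) = (\<Sum>n\<in>F. real (card (cell_points Q p R \<Delta> n)))"
    using card_matched[OF Q p R F(1,3,2), of \<Delta>] by simp
  moreover have "main_scale Q p * (\<Sum>an\<in>fibre_over p \<Delta> R F. weight p an) =
     kappa p * real Q^2 / real p^2 * cell_mass p R \<Delta> F"
    using prime_ratio_bounds(1,3)[OF p] fibre_over_sum(2)[OF p R F(1,3), of \<Delta>] by (simp add: main_scale_def)
  ultimately show "\<bar>real (card (matched Q p \<Delta> R)) - main_scale Q p * (\<Sum>an\<in>fibre_over p \<Delta> R F. weight p an)\<bar>
      \<le> total_const R * real Q * (1 + ln (2 * real Q))^2"
    using sum_cell_points_count[OF Q p F(1,3), of \<Delta>] by simp
qed

lemma farey_orbit_exists: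
  assumes z: "z \<in> farey_pairs Q" and p: "prime p" "\<not> int p dvd fst z"
  obtains a a' where "farey_orbit Q p a a' z"
proof -
  obtain x where x: "x \<in> farey Q" "x < 1" "z = pair_of Q x"
    using bij_betw_imp_surj_on[OF bij_betw_pair_of[of Q]] z by blast
  then have "x \<in> farey_coprime Q p" using p by (simp add: farey_coprime_def pair_of_def)
  from farey_orbit_pair_of[OF this x(2) p(1)] show thesis using that x(3) by blast
qed

text \<open>Each matching pair has exactly one length \<open>R = Suc (r H)\<close>, so the sets for
  different \<open>R\<close> are disjoint.\<close>

lemma card_matches:
  assumes p: "prime p" and H: "length \<Delta> = H" "H \<ge> 1"
  shows "card (matching Q p \<Delta>) = (\<Sum>R=H+1..2*H+1. card (matched Q p \<Delta> R))"
proof -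
  have not0: "\<not> int p dvd fst z" if "z \<in> matched Q p \<Delta> R" "R \<ge> 2" for z R
  proof -
    have "orbit_residues Q p R z ! 0 \<noteq> 0" using that(1) unfolding matched_def fibre_def admissible_def by auto
    moreover have "orbit_residues Q p R z ! 0 = fst z mod int p" using that(2) unfolding orbit_residues_eq by (simp add: dens_def)
    ultimately show ?thesis by (simp add: dvd_eq_mod_eq_0)
  qed
  have iff: "\<exists>R0\<in>{H+1..2*H+1}. \<forall>R\<ge>2. z \<in> matched Q p \<Delta> R \<longleftrightarrow> R = R0 \<and> matches Q p \<Delta> z"
    if z: "z \<in> farey_pairs Q" "\<not> int p dvd fst z" for z
  proof -
    obtain a a' where o: "farey_orbit Q p a a' z" using farey_orbit_exists[OF z(1) p z(2)] .
    interpret farey_orbit Q p a a' z by (rule o)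
    have "Suc (r H) \<in> {H+1..2*H+1}" using r_bounds[of H] by simp
    moreover have "\<forall>R\<ge>2. z \<in> matched Q p \<Delta> R \<longleftrightarrow> R = Suc (r H) \<and> matches Q p \<Delta> z"
      using orbit_in_fibre_iff[OF H] z(1) unfolding matched_def by blast
    ultimately show ?thesis by blast
  qed
  have "matching Q p \<Delta> = (\<Union>R\<in>{H+1..2*H+1}. matched Q p \<Delta> R)"
  proof (intro equalityI subsetI)
    fix z assume "z \<in> matching Q p \<Delta>"
    then have z: "z \<in> farey_pairs Q" "\<not> int p dvd fst z" "matches Q p \<Delta> z" by auto
    obtain R0 where R0: "R0 \<in> {H+1..2*H+1}" "\<forall>R\<ge>2. z \<in> matched Q p \<Delta> R \<longleftrightarrow> R = R0 \<and> matches Q p \<Delta> z"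
      using iff[OF z(1,2)] by blast
    have "R0 \<ge> 2" using R0(1) H by auto
    then show "z \<in> (\<Union>R\<in>{H+1..2*H+1}. matched Q p \<Delta> R)" using R0 z(3) by blast
  next
    fix z assume "z \<in> (\<Union>R\<in>{H+1..2*H+1}. matched Q p \<Delta> R)"
    then obtain R where R: "R \<in> {H+1..2*H+1}" "z \<in> matched Q p \<Delta> R" by blast
    then have R2: "R \<ge> 2" using H by auto
    have z: "z \<in> farey_pairs Q" "\<not> int p dvd fst z" using R(2) not0[OF R(2) R2] unfolding matched_def by auto
    then show "z \<in> matching Q p \<Delta>" using iff[OF z] R(2) R2 by blast
  qed
  also have "card \<dots> = (\<Sum>R=H+1..2*H+1. card (matched Q p \<Delta> R))"
  proof (rule card_UN_disjoint)
    show "\<forall>R\<in>{H+1..2*H+1}. finite (matched Q p \<Delta> R)" unfolding matched_def using finite_farey_pairs by simp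
    show "\<forall>R\<in>{H+1..2*H+1}. \<forall>R'\<in>{H+1..2*H+1}. R \<noteq> R' \<longrightarrow> matched Q p \<Delta> R \<inter> matched Q p \<Delta> R' = {}"
    proof (intro ballI impI)
      fix R R' assume RR: "R \<in> {H+1..2*H+1}" "R' \<in> {H+1..2*H+1}" "R \<noteq> R'"
      then have R2: "R \<ge> 2" "R' \<ge> 2" using H by auto
      show "matched Q p \<Delta> R \<inter> matched Q p \<Delta> R' = {}"
      proof (rule equals0I)
        fix z assume z: "z \<in> matched Q p \<Delta> R \<inter> matched Q p \<Delta> R'"
        then have "z \<in> farey_pairs Q" "\<not> int p dvd fst z" using not0[of z R] R2 unfolding matched_def by auto
        from iff[OF this] show False using z R2 RR(3) by blast
      qed
    qed
  qed simp
  finally show ?thesis .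
qed

lemma card_farey_coprime_approx:
  assumes Q: "Q \<ge> 1" and p: "prime p"
  shows "\<bar>real (card (farey_coprime Q p)) - main_scale Q p\<bar> \<le> 18 * real Q * (1 + ln (2 * real Q))"
proof -
  define L where "L = 1 + ln (2 * real Q)"
  have L: "L \<ge> 1" unfolding L_def using Q by simp
  \<comment> \<open>A single linear form, the first coordinate, required not to vanish: the
    denominator is prime to \<open>p\<close>. The empty index list gives the whole triangle.\<close>
  define P where "P Z \<longleftrightarrow> (0::nat) \<notin> Z" for Z
  have pi: "prime (int p)" using p by simp
  have p0: "p > 0" using p by (rule prime_gt_0_nat)
  have zs: "P (zero_set p 1 (\<lambda>_. 1) (\<lambda>_. 0) x y) \<longleftrightarrow> \<not> int p dvd x" for x y
    unfolding P_def zero_set_def by auto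
  have cell: "cell [] = triangle" unfolding triangle_cell_def by simp
  have max1: "max_index [] = 1" unfolding max_index_def by simp
  have "\<bar>real (card {(a, b) \<in> lattice_pts triangle Q. coprime a b \<and> P (zero_set p 1 (\<lambda>_. 1) (\<lambda>_. 0) a b)})
     - kappa p * real Q^2 * vol triangle * card (residue_pairs p 1 (\<lambda>_. 1) (\<lambda>_. 0) P) / real p^2\<bar>
     \<le> (if 1 \<le> 2 * real Q then real (2 * (1 + 1)) * (2 * real Q * 1 * (1 + ln (2 * real Q)) + 2 * real Q / 1) else 0) + real Q * 1 * vol triangle"
  proof (rule coprime_zero_set_count[OF _ _ p])
    show "fits 1 triangle" using fits_triangle_cell[of "[]"] unfolding cell .
    show "1 \<le> 2 * N" if "N > 0" "lattice_pts triangle N \<noteq> {}" for N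
      using max_index_le_scale[of N "[]"] that unfolding cell max1 by simp
    show "\<not> (int p dvd 1 \<and> int p dvd 0)" using pi not_prime_unit by blast
  qed (use Q in auto)
  moreover have "{(a, b) \<in> lattice_pts triangle Q. coprime a b \<and> P (zero_set p 1 (\<lambda>_. 1) (\<lambda>_. 0) a b)} = {z \<in> farey_pairs Q. \<not> int p dvd fst z}"
    unfolding zs by (auto simp: scaled_triangle_iff[OF Q] scaled_def lattice_pts_def)
  moreover have "real (card (residue_pairs p 1 (\<lambda>_. 1) (\<lambda>_. 0) P)) = real p * (real p - 1)"
  proof -
    have "residue_pairs p 1 (\<lambda>_. 1) (\<lambda>_. 0) P = {1..<int p} \<times> {0..<int p}"
    proof -
      have small: "int p dvd x \<longleftrightarrow> x = 0" if "x \<in> {0..<int p}" for x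
        using that zdvd_imp_le[of "int p" x] by (cases "x = 0") auto
      have "(x, y) \<in> residue_pairs p 1 (\<lambda>_. 1) (\<lambda>_. 0) P \<longleftrightarrow> (x, y) \<in> {1..<int p} \<times> {0..<int p}" for x y
      proof -
        have "(x, y) \<in> residue_pairs p 1 (\<lambda>_. 1) (\<lambda>_. 0) P \<longleftrightarrow> x \<in> {0..<int p} \<and> y \<in> {0..<int p} \<and> \<not> int p dvd x"
          unfolding residue_pairs_def mem_Collect_eq split_conv zs by blast
        also have "\<dots> \<longleftrightarrow> x \<in> {0..<int p} \<and> y \<in> {0..<int p} \<and> x \<noteq> 0" using small by blast
        finally show ?thesis by auto
      qed
      then show ?thesis by (intro Set.set_eqI) (simp only: split_paired_all)
    qed
    then show ?thesis using p0 by (simp add: card_cartesian_product of_nat_diff)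
  qed
  moreover have "kappa p * real Q^2 * vol triangle * (real p * (real p - 1)) / real p^2 = main_scale Q p"
    unfolding main_scale_def measure_triangle by simp
  ultimately have approx: "\<bar>real (card {z \<in> farey_pairs Q. \<not> int p dvd fst z}) - main_scale Q p\<bar> \<le> 4 * (2 * real Q * L + 2 * real Q) + real Q / 2"
    using Q unfolding L_def by (simp add: measure_triangle)
  have card: "real (card (farey_coprime Q p)) = 1 + real (card {z \<in> farey_pairs Q. \<not> int p dvd fst z})"
    using card_farey_coprime(2)[OF Q p] by simp
  define y where "y = real Q * L"
  have "real Q * 1 \<le> y" unfolding y_def using L by (intro mult_left_mono) auto
  then have y: "real Q \<le> y" "1 \<le> y" using Q by auto
  have "4 * (2 * real Q * L + 2 * real Q) + real Q / 2 = 8 * y + 8 * real Q + real Q / 2"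
    unfolding y_def by simp
  \<comment> \<open>\<open>8 + 8 + 1/2\<close> from the lattice count and 1 for the fraction 1,
    rounded up.\<close>
  then have "\<bar>real (card (farey_coprime Q p)) - main_scale Q p\<bar> \<le> 18 * y"
    using approx y unfolding card by linarith
  then show ?thesis unfolding L_def[symmetric] y_def by (simp add: mult.assoc)
qed

lemma rho_error:
  assumes H: "H \<ge> 1" "length \<Delta> = H" and Q: "Q \<ge> 1" and p: "prime p"
    and big: "1728 * (1 + ln (2 * real Q)) \<le> real Q"
  shows "\<bar>rho Q p \<Delta> - (\<Sum>R=H+1..2*H+1. infsum (weight p) (fibre p \<Delta> R))\<bar>
    \<le> 96 * (real H + (\<Sum>R=H+1..2*H+1. total_const R) + 36 * real (H + 1)) * (1 + ln (2 * real Q))^2 / real Q"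
proof -
  define L where "L = 1 + ln (2 * real Q)"
  define K where "K = (\<Sum>R=H+1..2*H+1. total_const R)"
  define S where "S = (\<Sum>R=H+1..2*H+1. infsum (weight p) (fibre p \<Delta> R))"
  define W where "W = main_scale Q p"
  define N where "N = real (farey_tuple_count Q p \<Delta>)"
  define F where "F = real (card (farey_coprime Q p))"
  define M where "M = (\<Sum>R=H+1..2*H+1. real (card (matched Q p \<Delta> R)))"
  have q: "real Q \<ge> 1" using Q by simp
  have L: "L \<ge> 1" unfolding L_def using Q by simp
  have R2: "R \<ge> 2" if "R \<in> {H+1..2*H+1}" for R using that H by auto
  have S: "0 \<le> S" "S \<le> 2 * real (H + 1)"
  proof -
    show "0 \<le> S" unfolding S_def using fibre_summable(2)[OF p] R2 by (intro sum_nonneg) auto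
    have "S \<le> (\<Sum>R=H+1..2*H+1. 2)" unfolding S_def using fibre_summable(3)[OF p] R2 by (intro sum_mono) auto
    then show "S \<le> 2 * real (H + 1)" by simp
  qed
  have "M = real (card (matching Q p \<Delta>))"
    unfolding M_def card_matches[OF p H(2,1)] by simp
  then have NM: "\<bar>N - M\<bar> \<le> real H"
    using farey_tuple_count_approx[OF Q p, of \<Delta>] H unfolding N_def by simp
  have MW: "\<bar>M - W * S\<bar> \<le> K * real Q * L^2"
  proof -
    have "M - W * S = (\<Sum>R=H+1..2*H+1. real (card (matched Q p \<Delta> R)) - W * infsum (weight p) (fibre p \<Delta> R))"
      unfolding M_def S_def sum_distrib_left sum_subtractf ..
    also have "\<bar>\<dots>\<bar> \<le> (\<Sum>R=H+1..2*H+1. total_const R * real Q * L^2)"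
      unfolding W_def L_def using card_matched_approx[OF Q p] R2 by (intro order_trans[OF sum_abs] sum_mono) blast
    also have "\<dots> = K * real Q * L^2" unfolding K_def sum_distrib_right ..
    finally show ?thesis .
  qed
  have FW: "\<bar>F - W\<bar> \<le> 18 * (real Q * L)"
    using card_farey_coprime_approx[OF Q p] unfolding F_def W_def L_def by (simp add: mult.assoc)
  \<comment> \<open>\<open>1728 = 18 * 96\<close>: the error in \<open>F\<close> is then at most
    half of the lower bound \<open>Q^2 / 48\<close> for \<open>W\<close>.\<close>
  have F: "F \<ge> real Q^2 / 96"
  proof -
    have "real Q * (1728 * L) \<le> real Q * real Q" using big unfolding L_def by (intro mult_left_mono) auto
    then have "18 * (real Q * L) \<le> real Q^2 / 96" by (simp add: power2_eq_square)
    moreover have "W \<ge> real Q^2 / 48" unfolding W_def by (rule main_scale_ge[OF p])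
    ultimately show ?thesis using FW by linarith
  qed
  have F0: "F > 0" using F q by (intro less_le_trans[OF _ F]) auto
  have SF: "\<bar>S * (F - W)\<bar> \<le> 36 * real (H + 1) * (real Q * L)"
  proof -
    have "\<bar>S * (F - W)\<bar> = S * \<bar>F - W\<bar>" using S by (simp add: abs_mult)
    also have "\<dots> \<le> (2 * real (H + 1)) * (18 * (real Q * L))" using S FW by (intro mult_mono) auto
    also have "\<dots> = 36 * real (H + 1) * (real Q * L)" by (simp add: algebra_simps)
    finally show ?thesis .
  qed
  have LL: "L \<le> L^2" "1 \<le> L^2" using L self_le_power[of L 2] by (auto simp: one_le_power)
  have K: "K \<ge> 0" unfolding K_def total_const_def
    using geo_const_ge_1 by (intro sum_nonneg mult_nonneg_nonneg add_nonneg_nonneg) (auto intro: order_trans[OF zero_le_one])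
  define A where "A = real H + K + 36 * real (H + 1)"
  \<comment> \<open>Both counts are compared with \<open>W\<close>, so \<open>W\<close>, and with it
    \<open>kappa p\<close>, drops out; multiplying through by \<open>F\<close> avoids expanding a
    quotient.\<close>
  have "N - S * F = (N - M) + (M - W * S) - S * (F - W)" by (simp add: algebra_simps)
  then have "\<bar>N - S * F\<bar> \<le> real H + K * real Q * L^2 + 36 * real (H + 1) * (real Q * L)"
    using NM MW SF by linarith
  also have "\<dots> \<le> real H * (real Q * L^2) + K * (real Q * L^2) + 36 * real (H + 1) * (real Q * L^2)"
  proof -
    have "1 * 1 \<le> real Q * L^2" using q LL by (intro mult_mono) auto
    then have "real H * 1 \<le> real H * (real Q * L^2)" by (intro mult_left_mono) auto
    then have 1: "real H \<le> real H * (real Q * L^2)" by simp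
    have 2: "K * real Q * L^2 \<le> K * (real Q * L^2)" by simp
    have 3: "36 * real (H + 1) * (real Q * L) \<le> 36 * real (H + 1) * (real Q * L^2)"
      using LL by (intro mult_left_mono) auto
    show ?thesis by (intro add_mono 1 2 3)
  qed
  also have "\<dots> = A * (real Q * L^2)" unfolding A_def by (simp add: distrib_right)
  finally have NS: "\<bar>N - S * F\<bar> \<le> A * (real Q * L^2)" .
  have "rho Q p \<Delta> - S = (N - S * F) / F" unfolding rho_def N_def[symmetric] F_def[symmetric] using F0 by (simp add: field_simps)
  then have "\<bar>rho Q p \<Delta> - S\<bar> = \<bar>N - S * F\<bar> / F" using F0 by simp
  also have "\<dots> \<le> A * (real Q * L^2) / (real Q^2 / 96)"
    using NS F F0 q by (intro frac_le) auto
  also have "\<dots> = 96 * A * L^2 / real Q" using q by (simp add: power2_eq_square)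
  finally show ?thesis unfolding S_def A_def K_def L_def .
qed

text \<open>\<open>C\<close> is chosen before \<open>Q\<close>, \<open>p\<close> and
  \<open>\<Delta>\<close>, so it depends on \<open>H\<close> only. Summability is asserted as well
  because the infinite sum of a family that is not summable is 0 by convention, and the estimate
  would then have another meaning.\<close>

theorem theorem1:
  fixes H :: nat
  assumes "H \<ge> 1"
  shows "(\<forall>p \<Delta>. prime p \<and> length \<Delta> = H \<and> (\<forall>d\<in>set \<Delta>. d \<ge> 1) \<longrightarrow>
            (\<forall>R\<in>{H+1..2*H+1}. weight p summable_on fibre p \<Delta> R)) \<and>
         (\<exists>C::real. \<forall>\<^sub>F Q in sequentially. \<forall>p \<Delta>.
            prime p \<and> length \<Delta> = H \<and> (\<forall>d\<in>set \<Delta>. d \<ge> 1) \<longrightarrow>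
            \<bar>rho Q p \<Delta> - (\<Sum>R=H+1..2*H+1. \<Sum>\<^sub>\<infinity>an\<in>fibre p \<Delta> R. weight p an)\<bar>
              \<le> C * (ln (real Q))\<^sup>2 / real Q)"
proof (intro conjI allI impI ballI)
  fix p :: nat and \<Delta> :: "nat list" and R assume "prime p \<and> length \<Delta> = H \<and> (\<forall>d\<in>set \<Delta>. d \<ge> 1)" "R \<in> {H+1..2*H+1}"
  then show "weight p summable_on fibre p \<Delta> R" using assms by (intro fibre_summable(1)) auto
next
  define A where "A = 96 * (real H + (\<Sum>R=H+1..2*H+1. total_const R) + 36 * real (H + 1))"
  have A: "A \<ge> 0" unfolding A_def total_const_def
    using geo_const_ge_1 by (intro mult_nonneg_nonneg add_nonneg_nonneg sum_nonneg) (auto intro: order_trans[OF zero_le_one])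
  have "\<forall>\<^sub>F Q in sequentially. 1728 * (1 + ln (2 * real Q)) \<le> real Q" by real_asymp
  \<comment> \<open>The left side is \<open>ln Q\<close> plus a constant, so any factor above 1
    would do; 3 becomes the \<open>9\<close> below after squaring.\<close>
  moreover have "\<forall>\<^sub>F Q in sequentially. 1 + ln (2 * real Q) \<le> 3 * ln (real Q)" by real_asymp
  moreover have "\<forall>\<^sub>F Q in sequentially. Q \<ge> (1::nat)" by (rule eventually_ge_at_top)
  ultimately have "\<forall>\<^sub>F Q in sequentially. \<forall>p \<Delta>.
            prime p \<and> length \<Delta> = H \<and> (\<forall>d\<in>set \<Delta>. d \<ge> 1) \<longrightarrow>
            \<bar>rho Q p \<Delta> - (\<Sum>R=H+1..2*H+1. \<Sum>\<^sub>\<infinity>an\<in>fibre p \<Delta> R. weight p an)\<bar>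
              \<le> 9 * A * (ln (real Q))\<^sup>2 / real Q"
  proof eventually_elim
    case (elim Q)
    show ?case
    proof (intro allI impI)
      fix p :: nat and \<Delta> :: "nat list" assume h: "prime p \<and> length \<Delta> = H \<and> (\<forall>d\<in>set \<Delta>. d \<ge> 1)"
      have "ln (2 * real Q) \<ge> 0" using elim(3) by (intro ln_ge_zero) auto
      then have "(1 + ln (2 * real Q))^2 \<le> (3 * ln (real Q))^2" using elim(2) by (intro power_mono) auto
      then have "A * (1 + ln (2 * real Q))^2 / real Q \<le> A * (3 * ln (real Q))^2 / real Q"
        using A by (intro divide_right_mono mult_left_mono) auto
      also have "\<dots> = 9 * A * (ln (real Q))^2 / real Q" by (simp add: power_mult_distrib)
      finally show "\<bar>rho Q p \<Delta> - (\<Sum>R=H+1..2*H+1. \<Sum>\<^sub>\<infinity>an\<in>fibre p \<Delta> R. weight p an)\<bar>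
              \<le> 9 * A * (ln (real Q))\<^sup>2 / real Q"
        using rho_error[OF assms _ elim(3) _ elim(1), of \<Delta> p] h unfolding A_def by linarith
    qed
  qed
  then show "\<exists>C::real. \<forall>\<^sub>F Q in sequentially. \<forall>p \<Delta>.
            prime p \<and> length \<Delta> = H \<and> (\<forall>d\<in>set \<Delta>. d \<ge> 1) \<longrightarrow>
            \<bar>rho Q p \<Delta> - (\<Sum>R=H+1..2*H+1. \<Sum>\<^sub>\<infinity>an\<in>fibre p \<Delta> R. weight p an)\<bar>
              \<le> C * (ln (real Q))\<^sup>2 / real Q" by blast
qed

end
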